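(* Let $\mathcal{M}$ be a non-empty set of probability mass functions on $\mathcal{X}$ and let $\mathcal{Q}$ be a non-empty, bounded, convex set of rate matrices with separately specified rows, with corresponding imprecise continuous-time Markov chain $\mathbb{P}_{\mathcal{Q},\mathcal{M}}$. Let $u\in\mathcal{U}$, let $h_t\in\mathcal{L}(\mathcal{X})$ with $h_t\ge 0$ for every $t\in u$, let $s\in\mathbb{R}_{\ge 0}$, $f\in\mathcal{L}(\mathcal{X})$ and $\mu\in\mathbb{R}$. Put $u'=u\cup\{s\}$. If $s\notin u$, let $g_s=f-\mu$ and $g_t=h_t$ for all $t\in u$; if $s\in u$, let $g_s=(f-\mu)h_s$ and $g_t=h_t$ for all $t\in u\setminus\{s\}$. Write $u'=\{t_0<t_1<\dots<t_n\}$, and define functions $g_{t_i}^+,g_{t_i}^-\in\mathcal{L}(\mathcal{X})$ by backward recursion: $g_{t_n}^+=g_{t_n}^-=g_{t_n}$ and, for all $i\in\{0,\dots,n-1\}$ and $x\in\mathcal{X}$, $$g_{t_i}^+(x)=\begin{cases} g_{t_i}(x)\,\underline{\mathbb{E}}_{\mathcal{Q}}[g_{t_{i+1}}^+(X_{t_{i+1}})\mid X_{t_i}=x] & \text{if } g_{t_i}(x)\ge 0,\\ g_{t_i}(x)\,\overline{\mathbb{E}}_{\mathcal{Q}}[g_{t_{i+1}}^-(X_{t_{i+1}})\mid X_{t_i}=x] & \text{if } g_{t_i}(x)<0,\end{cases}$$ $$g_{t_i}^-(x)=\begin{cases} g_{t_i}(x)\,\overline{\mathbb{E}}_{\mathcal{Q}}[g_{t_{i+1}}^-(X_{t_{i+1}})\mid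 X_{t_i}=x] & \text{if } g_{t_i}(x)\ge 0,\\ g_{t_i}(x)\,\underline{\mathbb{E}}_{\mathcal{Q}}[g_{t_{i+1}}^+(X_{t_{i+1}})\mid X_{t_i}=x] & \text{if } g_{t_i}(x)<0.\end{cases}$$ Then $$\underline{\mathbb{E}}_{\mathcal{Q},\mathcal{M}}\Bigl[\prod_{t\in u'}g_t(X_t)\Bigr]=\underline{\mathbb{E}}_{\mathcal{Q},\mathcal{M}}\bigl[g_{t_0}^+(X_{t_0})\bigr]\quad\text{and}\quad \overline{\mathbb{E}}_{\mathcal{Q},\mathcal{M}}\Bigl[\prod_{t\in u'}g_t(X_t)\Bigr]=\overline{\mathbb{E}}_{\mathcal{Q},\mathcal{M}}\bigl[g_{t_0}^-(X_{t_0})\bigr].$$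
   Context: $\mathcal{X}$ is a fixed non-empty finite set (the state space). $\mathcal{U}$ is the set of all non-empty finite sets $u\subset\mathbb{R}_{\ge 0}$ (viewed as increasingly ordered sequences of time points). For $u\in\mathcal{U}$, $\mathcal{X}_u=\prod_{t\in u}\mathcal{X}$ with generic element $x_u=(x_t)_{t\in u}$, and $\mathcal{L}(\mathcal{X}_u)$ is the set of real-valued functions on $\mathcal{X}_u$. Stochastic processes. Let $\Omega$ be the set of all functions $\omega:\mathbb{R}_{\ge 0}\to\mathcal{X}$ and $X_t(\omega)=\omega(t)$. A continuous-time stochastic process $P$ assigns a number $P(A\mid X_u=x_u)$ to every finite, possibly empty, $u\subset\mathbb{R}_{\ge0}$, every $x_u\in\mathcal{X}_u$ and every $A$ in the algebra generated by the events $(X_s=x)$, $x\in\mathcal{X}$, with $s\in u$ or $s$ larger than all elements of $u$, in such a way that $P$ extends to a full conditional probability on $\Omega$, i.e. a map $(A,C)\mapsto P(A\mid C)$ defined for all $A\subseteq\Omega$ and $\emptyset\ne C\subseteq\Omega$ with: $P(A\mid C)\ge 0$; $P(A\mid C)=1$ if $C\subseteq A$; $P(A\cup B\mid C)=P(A\mid C)+P(B\mid C)$ if $A\cap B=\emptyset$; $P(A\cap D\mid C)=P(A\mid D\cap C)P(D\mid C)$ if $D\cap C\neq\emptyset$. For $u=\emptyset$ one writes $P(A)$. Expectations $\mathbb{E}_P[\,\cdot\,]$ and $\mathbb{E}_P[\,\cdot\mid X_u=x_u]$ of functions of finitely many $X_t$ are the corresponding finite sums. Rate matrices. A rate matrix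 is a real $|\mathcal{X}|\times|\mathcal{X}|$ matrix with non-negative off-diagonal entries and rows summing to zero. A set $\mathcal{Q}$ of rate matrices is bounded if there is $c\ge0$ with $|Q(x,x)|<c$ for all $Q\in\mathcal{Q}$, $x\in\mathcal{X}$; it has separately specified rows if every rate matrix $Q$, such that for each $x\in\mathcal{X}$ there is $Q'\in\mathcal{Q}$ with $Q(x,\cdot)=Q'(x,\cdot)$, belongs to $\mathcal{Q}$. ICTMC. For a process $P$, times $t\le s$, and a (possibly empty) finite history $x_u$ with all elements of $u$ smaller than $t$, let $T_{t,x_u}^s(x,y)=P(X_s=y\mid X_t=x,X_u=x_u)$. $P$ is well-behaved if for all such $t,x_u$ the matrices $\frac1\Delta(T_{t,x_u}^{t+\Delta}-I)$ and (for $t>0$) $\frac1\Delta(T_{t-\Delta,x_u}^{t}-I)$ remain bounded as $\Delta\to0^+$; it is consistent with $\mathcal{Q}$ if all limit points of these matrices as $\Delta\to0^+$ belong to $\mathcal{Q}$, for all such $t,x_u$. The imprecise continuous-time Markov chain (ICTMC) $\mathbb{P}_{\mathcal{Q},\mathcal{M}}$ is the set of all well-behaved processes $P$ that are consistent with $\mathcal{Q}$ and whose initial mass function $P(X_0=\cdot)$ belongs to $\mathcal{M}$. Its lower expectation is $\underline{\mathbb{E}}_{\mathcal{Q},\mathcal{M}}[\cdot]=\inf\{\mathbb{E}_P[\cdot]:P\in\mathbb{P}_{\mathcal{Q},\mathcal{M}}\}$ and its upper expectation is $\overline{\mathbb{E}}_{\mathcal{Q},\mathcal{M}}[\cdot]=-\underline{\mathbb{E}}_{\mathcal{Q},\mathcal{M}}[-\,\cdot\,]$;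 similarly for conditional ones. Conditional lower expectations at a single time. Let $[\underline{Q}f](x)=\inf\{\sum_{x'\in\mathcal{X}}Q(x,x')f(x'):Q\in\mathcal{Q}\}$ for $f\in\mathcal{L}(\mathcal{X})$. For $t\le s$ and $f\in\mathcal{L}(\mathcal{X})$, $\underline{\mathbb{E}}_{\mathcal{Q}}[f(X_s)\mid X_t=x]=\Bigl(\lim_{n\to+\infty}\bigl[I+\tfrac{s-t}{n}\underline{Q}\bigr]^n f\Bigr)(x)$, where $I$ is the identity operator on $\mathcal{L}(\mathcal{X})$; it is known from earlier work that this limit exists and equals $\underline{\mathbb{E}}_{\mathcal{Q},\mathcal{M}}[f(X_s)\mid X_t=x]=\inf\{\mathbb{E}_P[f(X_s)\mid X_t=x]:P\in\mathbb{P}_{\mathcal{Q},\mathcal{M}}\}$. Moreover $\overline{\mathbb{E}}_{\mathcal{Q}}[f(X_s)\mid X_t=x]=-\underline{\mathbb{E}}_{\mathcal{Q}}[-f(X_s)\mid X_t=x]$. *)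

theory Defs
  imports "HOL-Analysis.Analysis" "HOL-Probability.Probability_Mass_Function"
begin

subsection \<open>Paths, finite-dimensional events, stochastic processes\<close>

text \<open>
  The state space is a type of class \<^class>\<open>finite\<close>. A state assignment \<open>x\<^sub>u\<close> on a set \<open>u\<close> of time
  points is given by any function \<open>real \<Rightarrow> 'x\<close>, of which only the values on \<open>u\<close> are used.
\<close>

type_synonym 'x process = "(real \<Rightarrow> 'x) set \<times> (real \<Rightarrow> 'x) set \<Rightarrow> real"

definition paths :: "(real \<Rightarrow> 'x) set" where
  "paths = {0..} \<rightarrow>\<^sub>E UNIV"

definition cyl :: "real set \<Rightarrow> (real \<Rightarrow> 'x) \<Rightarrow> (real \<Rightarrow> 'x) set" where
  "cyl u x = {\<omega> \<in> paths. \<forall>t\<in>u. \<omega> t = x t}"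

definition event_algebra :: "real set \<Rightarrow> (real \<Rightarrow> 'x) set set" where
  "event_algebra u = algebra paths hull
     {{\<omega> \<in> paths. \<omega> s = y} | s y. 0 \<le> s \<and> (s \<in> u \<or> (\<forall>t\<in>u. t < s))}"

definition process_domain :: "((real \<Rightarrow> 'x) set \<times> (real \<Rightarrow> 'x) set) set" where
  "process_domain = {(A, cyl u x) | A u x. finite u \<and> u \<subseteq> {0..} \<and> A \<in> event_algebra u}"

definition full_cond_prob :: "('w set \<times> 'w set \<Rightarrow> real) \<Rightarrow> 'w set \<Rightarrow> bool" where
  "full_cond_prob P W \<longleftrightarrow>
     (\<forall>A C. A \<subseteq> W \<and> C \<subseteq> W \<and> C \<noteq> {} \<longrightarrow> 0 \<le> P (A, C)) \<and>
     (\<forall>A C. A \<subseteq> W \<and> C \<subseteq> W \<and> C \<noteq> {} \<and> C \<subseteq> A \<longrightarrow> P (A, C) = 1) \<and>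
     (\<forall>A B C. A \<subseteq> W \<and> B \<subseteq> W \<and> C \<subseteq> W \<and> C \<noteq> {} \<and> A \<inter> B = {} \<longrightarrow>
        P (A \<union> B, C) = P (A, C) + P (B, C)) \<and>
     (\<forall>A D C. A \<subseteq> W \<and> D \<subseteq> W \<and> C \<subseteq> W \<and> D \<inter> C \<noteq> {} \<longrightarrow>
        P (A \<inter> D, C) = P (A, D \<inter> C) * P (D, C))"

text \<open>
  A process is a partial function: it is \<^const>\<open>undefined\<close> outside \<^const>\<open>process_domain\<close>.
\<close>

definition stochastic_process ::
    "'x process \<Rightarrow> bool" where
  "stochastic_process P \<longleftrightarrow> P \<in> extensional process_domain \<and>
     (\<exists>P'. full_cond_prob P' paths \<and> (\<forall>z\<in>process_domain. P' z = P z))"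

text \<open>The expectation of \<open>h(X\<^sub>v)\<close> for a finite set \<open>v\<close> of time points.\<close>

definition expect ::
    "'x process \<Rightarrow> real set \<Rightarrow> ((real \<Rightarrow> 'x) \<Rightarrow> real) \<Rightarrow> real" where
  "expect P v h = (\<Sum>x \<in> v \<rightarrow>\<^sub>E UNIV. h x * P (cyl v x, paths))"


subsection \<open>Sets of rate matrices\<close>

definition rate_matrix :: "real^'x^('x::finite) \<Rightarrow> bool" where
  "rate_matrix Q \<longleftrightarrow>
     (\<forall>x y. x \<noteq> y \<longrightarrow> 0 \<le> Q $ x $ y) \<and> (\<forall>x. (\<Sum>y\<in>UNIV. Q $ x $ y) = 0)"

definition bounded_rates :: "(real^'x^('x::finite)) set \<Rightarrow> bool" where
  "bounded_rates \<Q> \<longleftrightarrow> (\<exists>c\<ge>0. \<forall>Q\<in>\<Q>. \<forall>x. \<bar>Q $ x $ x\<bar> < c)"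

definition separately_specified_rows :: "(real^'x^('x::finite)) set \<Rightarrow> bool" where
  "separately_specified_rows \<Q> \<longleftrightarrow>
     (\<forall>Q. rate_matrix Q \<and> (\<forall>x. \<exists>Q'\<in>\<Q>. Q $ x = Q' $ x) \<longrightarrow> Q \<in> \<Q>)"


subsection \<open>Imprecise continuous-time Markov chains\<close>

definition trans_matrix ::
    "('x::finite) process \<Rightarrow> real set \<Rightarrow> (real \<Rightarrow> 'x) \<Rightarrow> real \<Rightarrow> real
       \<Rightarrow> real^'x^'x" where
  "trans_matrix P u xu t s =
     (\<chi> x y. P ({\<omega> \<in> paths. \<omega> s = y}, cyl (insert t u) (xu(t := x))))"

definition right_quotient ::
    "('x::finite) process \<Rightarrow> real set \<Rightarrow> (real \<Rightarrow> 'x) \<Rightarrow> real \<Rightarrow> real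
       \<Rightarrow> real^'x^'x" where
  "right_quotient P u xu t \<Delta> = (1 / \<Delta>) *\<^sub>R (trans_matrix P u xu t (t + \<Delta>) - mat 1)"

definition left_quotient ::
    "('x::finite) process \<Rightarrow> real set \<Rightarrow> (real \<Rightarrow> 'x) \<Rightarrow> real \<Rightarrow> real
       \<Rightarrow> real^'x^'x" where
  "left_quotient P u xu t \<Delta> = (1 / \<Delta>) *\<^sub>R (trans_matrix P u xu (t - \<Delta>) t - mat 1)"

definition well_behaved ::
    "('x::finite) process \<Rightarrow> bool" where
  "well_behaved P \<longleftrightarrow>
     (\<forall>t u xu. 0 \<le> t \<and> finite u \<and> u \<subseteq> {0..<t} \<longrightarrow>
        Bfun (right_quotient P u xu t) (at_right 0) \<and>
        (0 < t \<longrightarrow> Bfun (left_quotient P u xu t) (at_right 0)))"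

definition limit_points_at_0 :: "(real \<Rightarrow> real^'x^('x::finite)) \<Rightarrow> (real^'x^'x) set" where
  "limit_points_at_0 F =
     {S. \<exists>\<delta>. filterlim \<delta> (at_right 0) sequentially \<and> (\<lambda>n. F (\<delta> n)) \<longlonglongrightarrow> S}"

definition consistent_with ::
    "('x::finite) process \<Rightarrow> (real^'x^'x) set \<Rightarrow> bool" where
  "consistent_with P \<Q> \<longleftrightarrow>
     (\<forall>t u xu. 0 \<le> t \<and> finite u \<and> u \<subseteq> {0..<t} \<longrightarrow>
        limit_points_at_0 (right_quotient P u xu t) \<subseteq> \<Q> \<and>
        (0 < t \<longrightarrow> limit_points_at_0 (left_quotient P u xu t) \<subseteq> \<Q>))"

definition ICTMC ::
    "(real^'x^('x::finite)) set \<Rightarrow> 'x pmf set \<Rightarrow> 'x process set" where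
  "ICTMC \<Q> \<M> =
     {P. stochastic_process P \<and> well_behaved P \<and> consistent_with P \<Q> \<and>
         (\<exists>p\<in>\<M>. \<forall>x. P ({\<omega> \<in> paths. \<omega> 0 = x}, paths) = pmf p x)}"

definition lower_expect ::
    "(real^'x^('x::finite)) set \<Rightarrow> 'x pmf set \<Rightarrow> real set \<Rightarrow> ((real \<Rightarrow> 'x) \<Rightarrow> real) \<Rightarrow> real" where
  "lower_expect \<Q> \<M> v h = (INF P \<in> ICTMC \<Q> \<M>. expect P v h)"

definition upper_expect ::
    "(real^'x^('x::finite)) set \<Rightarrow> 'x pmf set \<Rightarrow> real set \<Rightarrow> ((real \<Rightarrow> 'x) \<Rightarrow> real) \<Rightarrow> real" where
  "upper_expect \<Q> \<M> v h = - lower_expect \<Q> \<M> v (\<lambda>x. - h x)"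


subsection \<open>Conditional lower and upper expectations at a single time\<close>

definition lower_rate :: "(real^'x^('x::finite)) set \<Rightarrow> ('x \<Rightarrow> real) \<Rightarrow> 'x \<Rightarrow> real" where
  "lower_rate \<Q> f x = (INF Q \<in> \<Q>. \<Sum>x'\<in>UNIV. Q $ x $ x' * f x')"

text \<open>
  The state space being finite, the limit of functions on it is taken pointwise.
\<close>

definition cond_lower_expect ::
    "(real^'x^('x::finite)) set \<Rightarrow> real \<Rightarrow> real \<Rightarrow> ('x \<Rightarrow> real) \<Rightarrow> 'x \<Rightarrow> real" where
  "cond_lower_expect \<Q> t s f x =
     lim (\<lambda>n. ((\<lambda>g y. g y + (s - t) / real n * lower_rate \<Q> g y) ^^ n) f x)"

definition cond_upper_expect ::
    "(real^'x^('x::finite)) set \<Rightarrow> real \<Rightarrow> real \<Rightarrow> ('x \<Rightarrow> real) \<Rightarrow> 'x \<Rightarrow> real" where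
  "cond_upper_expect \<Q> t s f x = - cond_lower_expect \<Q> t s (\<lambda>y. - f y) x"

end

theory Submission
  imports Defs
begin

text \<open>
  Write \<open>L\<^sub>t\<close> for the limit of \<open>(I + t/n \<cdot> lower_rate)\<^sup>n\<close>, a monotone semigroup of operators.

  For any process of the chain and any history, the expectation of \<open>(L\<^bsub>b-r\<^esub> f)(X\<^sub>r)\<close> given that
  history has nonnegative lower right Dini derivative in \<open>r\<close> by consistency, so it is nondecreasing and
  \<open>L\<^bsub>b-t\<^esub> f\<close> is a lower bound for the conditional expectation of \<open>f(X\<^sub>b)\<close>. Applying this step by step
  along the time grid, with \<open>gp\<close> or \<open>gm\<close> according to the sign of the product of the earlier factors,
  bounds the expectation of the whole product from below.

  For the converse, piecewise constant choices of rate matrices come arbitrarily close to \<open>L\<close>. Only the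
  factor at \<open>s\<close> can be negative, so a nearly optimal policy needs to remember nothing but \<open>X\<^sub>s\<close>.
  A process with these transitions is obtained as a cluster point, in the product topology, of the
  conditional probabilities of finitely supported chains perturbed so that every history has positive
  probability. Given a history that does not contain \<open>s\<close>, its transitions are mixtures over the state
  at \<open>s\<close>; convexity and separately specified rows make it consistent nevertheless.
\<close>

subsection \<open>The lower transition semigroup\<close>

text \<open>The definition asks for an extension to a full conditional probability on all subsets of
  an uncountable path space, so null events have to be conditioned on as well. Finitely supported
  masses are additive on all subsets, and their conditional probabilities lie in
  \<open>[0, 1]\<close>, which gives the compactness for a cluster point; uniform noise makes every
  denominator eventually positive and vanishes in the limit. The factor at \<open>s\<close> can
  reverse the direction of optimisation: after a negative value the rest of the product has to be
  maximised. In general no single Markov policy does both, so the transitions are indexed by the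
  state at \<open>s\<close>, which in turn creates histories that do not reveal the branch.
  \<open>\<Q>\<close> is not assumed closed: infima over it need not be attained, and limits of rate
  matrices may leave it. Choices are therefore optimal up to an error only, and consistency of the
  constructed process is shown through convex hulls of finitely many rows, which are compact. The
  upper equality is the lower one for the product with the sign of the factor at \<open>s\<close>
  changed, so the recursion is studied with an arbitrary function at one grid time.\<close>

locale rate_set =
  fixes \<Q> :: "(real^'x^('x::finite)) set" and c :: real
  assumes nonempty: "\<Q> \<noteq> {}"
    and rate: "Q \<in> \<Q> \<Longrightarrow> rate_matrix Q"
    and diag_bound: "Q \<in> \<Q> \<Longrightarrow> \<bar>Q $ x $ x\<bar> \<le> c"
begin

lemma row_action_split:
  "(\<Sum>y\<in>UNIV. Q $ x $ y * f y) = Q $ x $ x * f x + (\<Sum>y\<in>UNIV - {x}. Q $ x $ y * f y)"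
  for Q :: "real^'x^'x" by (simp add: sum.remove)

text \<open>The off-diagonal entries are nonnegative and sum to \<open>- Q $ x $ x\<close>, so
  diagonal and off-diagonal part contribute at most \<open>c\<close> each. Hence the Lipschitz
  constant \<open>2 * c\<close> of the rate operator in all later error bounds.\<close>

lemma abs_row_sum:
  assumes "Q \<in> \<Q>" shows "(\<Sum>y\<in>UNIV. \<bar>Q $ x $ y\<bar>) \<le> 2 * c"
proof -
  have r: "rate_matrix Q" using rate assms by blast
  have "(\<Sum>y\<in>UNIV. Q $ x $ y) = Q $ x $ x + (\<Sum>y\<in>UNIV-{x}. Q $ x $ y)"
    by (simp add: sum.remove)
  hence 1: "(\<Sum>y\<in>UNIV-{x}. Q $ x $ y) = - Q $ x $ x"
    using r by (simp add: rate_matrix_def)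
  have "(\<Sum>y\<in>UNIV. \<bar>Q $ x $ y\<bar>) = \<bar>Q $ x $ x\<bar> + (\<Sum>y\<in>UNIV-{x}. \<bar>Q $ x $ y\<bar>)"
    by (simp add: sum.remove)
  also have "(\<Sum>y\<in>UNIV-{x}. \<bar>Q $ x $ y\<bar>) = (\<Sum>y\<in>UNIV-{x}. Q $ x $ y)"
    using r by (intro sum.cong) (auto simp: rate_matrix_def)
  finally show ?thesis using diag_bound[OF assms, of x] 1 by linarith
qed

lemma row_action_bound:
  assumes "Q \<in> \<Q>" "\<And>y. \<bar>f y\<bar> \<le> B" shows "\<bar>\<Sum>y\<in>UNIV. Q $ x $ y * f y\<bar> \<le> 2 * c * B"
proof -
  have B: "0 \<le> B" using assms(2)[of undefined] by linarith
  have "\<bar>\<Sum>y\<in>UNIV. Q $ x $ y * f y\<bar> \<le> (\<Sum>y\<in>UNIV. \<bar>Q $ x $ y\<bar> * B)"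
    using assms(2) by (intro order_trans[OF sum_abs] sum_mono) (simp add: abs_mult mult_left_mono)
  also have "\<dots> \<le> 2 * c * B"
    using abs_row_sum[OF assms(1), of x] B by (simp add: sum_distrib_right[symmetric] mult_right_mono)
  finally show ?thesis .
qed

lemma bounded_function:
  fixes f :: "'x \<Rightarrow> real" obtains B where "\<And>y. \<bar>f y\<bar> \<le> B"
  using member_le_sum[of _ UNIV "\<lambda>y. \<bar>f y\<bar>"] by auto

lemma lower_rate_le:
  assumes "Q \<in> \<Q>" shows "lower_rate \<Q> f x \<le> (\<Sum>y\<in>UNIV. Q $ x $ y * f y)"
proof -
  obtain B where B: "\<And>y. \<bar>f y\<bar> \<le> B" using bounded_function by blast
  show ?thesis unfolding lower_rate_def
  proof (rule cINF_lower[OF _ assms])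
    have "- (2 * c * B) \<le> (\<Sum>y\<in>UNIV. Q $ x $ y * f y)" if "Q \<in> \<Q>" for Q
      using row_action_bound[of Q f B x] that B by (simp add: abs_le_iff)
    thus "bdd_below ((\<lambda>Q. \<Sum>y\<in>UNIV. Q $ x $ y * f y) ` \<Q>)"
      by (intro bdd_belowI2)
  qed
qed

lemma le_lower_rate:
  assumes "\<And>Q. Q \<in> \<Q> \<Longrightarrow> a \<le> (\<Sum>y\<in>UNIV. Q $ x $ y * f y)" shows "a \<le> lower_rate \<Q> f x"
  unfolding lower_rate_def using nonempty assms by (intro cINF_greatest)

lemma lower_rate_near:
  assumes "0 < \<eta>"
  obtains Q where "Q \<in> \<Q>" "(\<Sum>y\<in>UNIV. Q $ x $ y * f y) < lower_rate \<Q> f x + \<eta>"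
proof -
  have "\<exists>Q\<in>\<Q>. (\<Sum>y\<in>UNIV. Q $ x $ y * f y) < lower_rate \<Q> f x + \<eta>"
  proof (rule ccontr)
    assume "\<not> ?thesis"
    hence "lower_rate \<Q> f x + \<eta> \<le> lower_rate \<Q> f x"
      by (intro le_lower_rate) (auto simp: not_less)
    thus False using assms by simp
  qed
  thus thesis using that by blast
qed

lemma lower_rate_lipschitz:
  assumes "\<And>y. \<bar>f y - g y\<bar> \<le> e" shows "\<bar>lower_rate \<Q> f x - lower_rate \<Q> g x\<bar> \<le> 2 * c * e"
proof -
  have "lower_rate \<Q> f x - 2 * c * e \<le> lower_rate \<Q> g x"
    if *: "\<And>y. \<bar>f y - g y\<bar> \<le> e" for f g
  proof (rule le_lower_rate)
    fix Q assume Q: "Q \<in> \<Q>"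
    have "\<bar>\<Sum>y\<in>UNIV. Q $ x $ y * (f y - g y)\<bar> \<le> 2 * c * e"
      using Q * by (intro row_action_bound)
    moreover have "(\<Sum>y\<in>UNIV. Q $ x $ y * (f y - g y)) =
        (\<Sum>y\<in>UNIV. Q $ x $ y * f y) - (\<Sum>y\<in>UNIV. Q $ x $ y * g y)"
      by (simp add: algebra_simps sum_subtractf)
    ultimately show "lower_rate \<Q> f x - 2 * c * e \<le> (\<Sum>y\<in>UNIV. Q $ x $ y * g y)"
      using lower_rate_le[OF Q, of f x] by linarith
  qed
  from this[of f g] this[of g f] assms show ?thesis by (fastforce simp: abs_minus_commute)
qed

lemma lower_rate_add_const [simp]: "lower_rate \<Q> (\<lambda>y. f y + k) = lower_rate \<Q> f"
proof -
  have "(\<Sum>y\<in>UNIV. Q $ x $ y * (f y + k)) = (\<Sum>y\<in>UNIV. Q $ x $ y * f y)" if "Q \<in> \<Q>" for Q x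
    using rate[OF that] by (simp add: algebra_simps sum.distrib sum_distrib_left[symmetric] rate_matrix_def)
  thus ?thesis by (auto simp: lower_rate_def fun_eq_iff)
qed

lemma lower_rate_zero [simp]: "lower_rate \<Q> (\<lambda>_. 0) = (\<lambda>_. 0)"
  using nonempty by (auto simp: lower_rate_def fun_eq_iff)

lemma lower_rate_bound:
  assumes "\<And>y. \<bar>f y\<bar> \<le> B" shows "\<bar>lower_rate \<Q> f x\<bar> \<le> 2 * c * B"
  using lower_rate_lipschitz[of f "\<lambda>_. 0" B x] assms by simp

section \<open>Euler iterates of the lower rate operator and their error bounds\<close>

definition euler :: "real \<Rightarrow> nat \<Rightarrow> ('x \<Rightarrow> real) \<Rightarrow> 'x \<Rightarrow> real" where
  "euler d n = (\<lambda>g y. g y + d * lower_rate \<Q> g y) ^^ n"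

lemma euler_0 [simp]: "euler d 0 f = f" by (simp add: euler_def)

lemma euler_Suc: "euler d (Suc n) f x = euler d n f x + d * lower_rate \<Q> (euler d n f) x"
  by (simp add: euler_def)

lemma euler_add: "euler d (m + n) f = euler d m (euler d n f)"
  by (simp add: euler_def funpow_add)

text \<open>The condition \<open>d * c \<le> 1\<close> makes the diagonal
  \<open>1 + d * Q $ x $ x\<close> nonnegative, so every \<open>I + d * Q\<close> has nonnegative
  entries; taking the infimum over \<open>Q\<close> preserves monotonicity.\<close>

lemma euler_step_mono:
  assumes d: "0 \<le> d" "d * c \<le> 1" and "\<And>y. f y \<le> g y"
  shows "f x + d * lower_rate \<Q> f x \<le> g x + d * lower_rate \<Q> g x"
proof (cases "d = 0")
  case False
  hence d0: "0 < d" using d by simp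
  \<comment> \<open>Division by \<open>d\<close> gives the claim the form of
    \<open>le_lower_rate\<close>, so that each \<open>Q\<close> can be treated separately.\<close>
  have "(f x - g x) / d + lower_rate \<Q> f x \<le> lower_rate \<Q> g x"
  proof (rule le_lower_rate)
    fix Q assume Q: "Q \<in> \<Q>"
    have q: "rate_matrix Q" using rate Q by blast
    have "0 \<le> (\<Sum>y\<in>UNIV-{x}. Q $ x $ y * (g y - f y))"
      using q assms(3) by (intro sum_nonneg mult_nonneg_nonneg) (auto simp: rate_matrix_def)
    moreover have "- c * (g x - f x) \<le> Q $ x $ x * (g x - f x)"
      using diag_bound[OF Q, of x] assms(3)[of x] by (intro mult_right_mono) (auto simp: abs_le_iff)
    ultimately have "- c * (g x - f x) \<le> (\<Sum>y\<in>UNIV. Q $ x $ y * (g y - f y))"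
      by (subst row_action_split) linarith
    also have "\<dots> = (\<Sum>y\<in>UNIV. Q $ x $ y * g y) - (\<Sum>y\<in>UNIV. Q $ x $ y * f y)"
      by (simp add: algebra_simps sum_subtractf)
    finally have 1: "- c * (g x - f x) \<le> (\<Sum>y\<in>UNIV. Q $ x $ y * g y) - lower_rate \<Q> f x"
      using lower_rate_le[OF Q, of f x] by linarith
    have "c \<le> 1 / d" using d d0 by (simp add: field_simps)
    hence "c * (g x - f x) \<le> (1 / d) * (g x - f x)"
      using assms(3)[of x] by (intro mult_right_mono) auto
    with 1 show "(f x - g x) / d + lower_rate \<Q> f x \<le> (\<Sum>y\<in>UNIV. Q $ x $ y * g y)"
      by (simp add: diff_divide_distrib)
  qed
  hence "d * ((f x - g x) / d + lower_rate \<Q> f x) \<le> d * lower_rate \<Q> g x"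
    using d by (intro mult_left_mono)
  moreover have "d * ((f x - g x) / d + lower_rate \<Q> f x) = f x - g x + d * lower_rate \<Q> f x"
    using d0 by (simp add: field_simps)
  ultimately show ?thesis by linarith
qed (use assms in simp)

lemma euler_mono:
  assumes d: "0 \<le> d" "d * c \<le> 1" and "\<And>y. f y \<le> g y"
  shows "euler d n f x \<le> euler d n g x"
  by (induction n arbitrary: x) (use assms in \<open>auto simp: euler_Suc intro: euler_step_mono\<close>)

lemma euler_add_const: "euler d n (\<lambda>y. f y + k) = (\<lambda>y. euler d n f y + k)"
proof (induction n)
  case (Suc n)
  show ?case by (rule ext) (simp add: euler_Suc Suc)
qed simp

lemma euler_const: "euler d n (\<lambda>y. k) = (\<lambda>y. k)"
proof -
  have "euler d n (\<lambda>_. 0) = (\<lambda>_. 0)"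
  proof (induction n)
    case (Suc n)
    show ?case by (rule ext) (simp add: euler_Suc Suc)
  qed simp
  thus ?thesis using euler_add_const[of d n "\<lambda>_. 0" k] by simp
qed

text \<open>A monotone operator that commutes with adding constants is nonexpansive in the supremum
  norm: apply it to \<open>f \<le> g + e\<close> and \<open>g \<le> f + e\<close>.\<close>

lemma euler_nonexpansive:
  assumes d: "0 \<le> d" "d * c \<le> 1" and e: "\<And>y. \<bar>f y - g y\<bar> \<le> e"
  shows "\<bar>euler d n f x - euler d n g x\<bar> \<le> e"
proof -
  have "f y \<le> g y + e" "g y \<le> f y + e" for y using e[of y] by (auto simp: abs_le_iff)
  with d have "euler d n f x \<le> euler d n (\<lambda>y. g y + e) x" "euler d n g x \<le> euler d n (\<lambda>y. f y + e) x"
    by (auto intro!: euler_mono)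
  thus ?thesis by (auto simp: euler_add_const)
qed

lemma euler_bound:
  assumes "0 \<le> d" "d * c \<le> 1" "\<And>y. \<bar>f y\<bar> \<le> B" shows "\<bar>euler d n f x\<bar> \<le> B"
  using euler_nonexpansive[of d f "\<lambda>_. 0" B n x] assms by (simp add: euler_const)

lemma euler_dist_start:
  assumes "0 \<le> d" "d * c \<le> 1" "\<And>y. \<bar>f y\<bar> \<le> B"
  shows "\<bar>euler d n f x - f x\<bar> \<le> n * d * (2 * c * B)"
proof (induction n)
  case (Suc n)
  have "\<bar>d * lower_rate \<Q> (euler d n f) x\<bar> \<le> d * (2 * c * B)"
    using assms by (simp add: abs_mult mult_left_mono lower_rate_bound euler_bound)
  with Suc show ?case by (simp add: euler_Suc algebra_simps)
qed simp

text \<open>After \<open>n\<close> steps the iterate has moved by at most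
  \<open>n * d * (2 * c * B)\<close>, so the next step differs from one with the rate frozen at
  \<open>f\<close> by at most \<open>n * d\<^sup>2 * ((2 * c)\<^sup>2 * B)\<close>. The sum is
  quadratic in the total time \<open>n * d\<close>, uniformly in the number of steps.\<close>

lemma euler_first_order:
  assumes "0 \<le> d" "d * c \<le> 1" "\<And>y. \<bar>f y\<bar> \<le> B"
  shows "\<bar>euler d n f x - (f x + n * d * lower_rate \<Q> f x)\<bar> \<le> (n * d)\<^sup>2 * ((2 * c)\<^sup>2 * B)"
proof (induction n)
  case (Suc n)
  have B: "0 \<le> B" using assms(3)[of undefined] by linarith
  have "\<bar>lower_rate \<Q> (euler d n f) x - lower_rate \<Q> f x\<bar> \<le> 2 * c * (n * d * (2 * c * B))"
    using assms by (intro lower_rate_lipschitz euler_dist_start)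
  hence "\<bar>d * (lower_rate \<Q> (euler d n f) x - lower_rate \<Q> f x)\<bar> \<le> d * (2 * c * (n * d * (2 * c * B)))"
    using assms by (simp add: abs_mult mult_left_mono)
  moreover have "euler d (Suc n) f x - (f x + Suc n * d * lower_rate \<Q> f x) =
     (euler d n f x - (f x + n * d * lower_rate \<Q> f x)) + d * (lower_rate \<Q> (euler d n f) x - lower_rate \<Q> f x)"
    by (simp add: euler_Suc algebra_simps)
  ultimately have "\<bar>euler d (Suc n) f x - (f x + Suc n * d * lower_rate \<Q> f x)\<bar> \<le>
     (n * d)\<^sup>2 * ((2 * c)\<^sup>2 * B) + d * (2 * c * (n * d * (2 * c * B)))"
    using Suc by linarith
  also have "\<dots> = (real n ^ 2 + n) * (d\<^sup>2 * ((2 * c)\<^sup>2 * B))" by (simp add: power2_eq_square algebra_simps)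
  also have "\<dots> \<le> (real (Suc n))\<^sup>2 * (d\<^sup>2 * ((2 * c)\<^sup>2 * B))"
    using B by (intro mult_right_mono mult_nonneg_nonneg) (auto simp: power2_eq_square algebra_simps)
  finally show ?case by (simp add: power_mult_distrib)
qed simp

text \<open>One step of length \<open>d\<close> and \<open>m\<close> steps of length
  \<open>d / m\<close> agree up to second order by \<open>euler_first_order\<close>. Since Euler
  steps are nonexpansive, these \<open>n\<close> local errors only add up.\<close>

lemma euler_refine:
  assumes "0 \<le> d" "d * c \<le> 1" "\<And>y. \<bar>f y\<bar> \<le> B" "0 < m"
  shows "\<bar>euler d n f x - euler (d / m) (n * m) f x\<bar> \<le> n * d\<^sup>2 * ((2 * c)\<^sup>2 * B)"
proof (induction n arbitrary: x)
  case (Suc n)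
  let ?h = "euler (d / m) (n * m) f"
  have "d * c \<le> m" using assms(2,4) by linarith
  hence d': "0 \<le> d / m" "d / m * c \<le> 1"
    using assms(1,4) by (simp_all add: divide_le_eq)
  have hB: "\<bar>?h y\<bar> \<le> B" for y using d' assms by (intro euler_bound)
  have "\<bar>euler d 1 (euler d n f) x - euler d 1 ?h x\<bar> \<le> n * d\<^sup>2 * ((2 * c)\<^sup>2 * B)"
    using assms Suc by (intro euler_nonexpansive)
  moreover have "\<bar>euler (d / m) m ?h x - (?h x + m * (d / m) * lower_rate \<Q> ?h x)\<bar> \<le> (m * (d / m))\<^sup>2 * ((2 * c)\<^sup>2 * B)"
    using d' hB by (intro euler_first_order)
  hence "\<bar>euler (d / m) m ?h x - euler d 1 ?h x\<bar> \<le> d\<^sup>2 * ((2 * c)\<^sup>2 * B)"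
    using assms by (simp add: euler_Suc)
  moreover have "euler d (Suc n) f x = euler d 1 (euler d n f) x" using euler_add[of d 1 n f] by simp
  moreover have "euler (d / m) (Suc n * m) f x = euler (d / m) m ?h x"
    using euler_add[of "d / m" m "n * m" f] by simp
  ultimately have "\<bar>euler d (Suc n) f x - euler (d / m) (Suc n * m) f x\<bar>
      \<le> n * d\<^sup>2 * ((2 * c)\<^sup>2 * B) + d\<^sup>2 * ((2 * c)\<^sup>2 * B)" by linarith
  thus ?case by (simp add: distrib_right)
qed simp

section \<open>The limit semigroup, its generator and its regularity in time\<close>

definition lower_trans :: "real \<Rightarrow> ('x \<Rightarrow> real) \<Rightarrow> 'x \<Rightarrow> real" where
  "lower_trans t f x = lim (\<lambda>n. euler (t / n) n f x)"

lemma cond_lower_expect_eq: "cond_lower_expect \<Q> t s f x = lower_trans (s - t) f x"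
  by (simp add: cond_lower_expect_def lower_trans_def euler_def)

text \<open>Both discretisations are compared with their common refinement into \<open>n * m\<close>
  steps.\<close>

lemma euler_Cauchy_bound:
  assumes "0 \<le> t" "\<And>y. \<bar>f y\<bar> \<le> B" "0 < n" "t * c \<le> n" "0 < m" "t * c \<le> m"
  shows "\<bar>euler (t / n) n f x - euler (t / m) m f x\<bar> \<le> t\<^sup>2 * ((2 * c)\<^sup>2 * B) / n + t\<^sup>2 * ((2 * c)\<^sup>2 * B) / m"
proof -
  have *: "\<bar>euler (t / n) n f x - euler (t / (n * m)) (n * m) f x\<bar> \<le> t\<^sup>2 * ((2 * c)\<^sup>2 * B) / n"
    if "0 < n" "t * c \<le> n" "0 < m" for n m :: nat
  proof -
    have "\<bar>euler (t / n) n f x - euler (t / n / m) (n * m) f x\<bar> \<le> n * (t / n)\<^sup>2 * ((2 * c)\<^sup>2 * B)"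
      using assms(1,2) that by (intro euler_refine) (auto simp: field_simps)
    also have "n * (t / n)\<^sup>2 * ((2 * c)\<^sup>2 * B) = t\<^sup>2 * ((2 * c)\<^sup>2 * B) / n"
      using that by (simp add: power2_eq_square field_simps)
    finally show ?thesis by simp
  qed
  from *[of n m] *[of m n] assms show ?thesis by (simp add: mult.commute[of n m] mult.commute[of "real n"] abs_le_iff)
qed

lemma euler_tendsto_lower_trans:
  assumes t: "0 \<le> t" shows "(\<lambda>n. euler (t / n) n f x) \<longlonglongrightarrow> lower_trans t f x"
proof -
  obtain B where B: "\<And>y. \<bar>f y\<bar> \<le> B" using bounded_function by blast
  have K0: "0 \<le> t\<^sup>2 * ((2 * c)\<^sup>2 * B)" using B[of undefined] by (intro mult_nonneg_nonneg) auto
  define K where "K = t\<^sup>2 * ((2 * c)\<^sup>2 * B) + 1"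
  have K: "0 < K" "t\<^sup>2 * ((2 * c)\<^sup>2 * B) \<le> K" unfolding K_def using K0 by linarith+
  have "Cauchy (\<lambda>n. euler (t / n) n f x)"
  proof (rule metric_CauchyI)
    fix e :: real assume e: "0 < e"
    define N where "N = Suc (nat \<lceil>max (t * c) (2 * K / e)\<rceil>)"
    have N: "max (t * c) (2 * K / e) < N" unfolding N_def by linarith
    show "\<exists>M. \<forall>m\<ge>M. \<forall>n\<ge>M. dist (euler (t / m) m f x) (euler (t / n) n f x) < e"
    proof (intro exI allI impI)
      fix m n assume mn: "N \<le> m" "N \<le> n"
      have *: "t\<^sup>2 * ((2 * c)\<^sup>2 * B) / k < e / 2" "0 < k" "t * c \<le> k" if "N \<le> k" for k :: nat
      proof -
        have "real N \<le> k" using that by simp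
        with N have k: "t * c < k" "2 * K / e < k" by auto
        show k0: "0 < k" "t * c \<le> k" using k that by (auto simp: N_def)
        have "K / k < e / 2" using k k0 e by (simp add: field_simps)
        moreover have "t\<^sup>2 * ((2 * c)\<^sup>2 * B) / k \<le> K / k" using K by (simp add: divide_right_mono)
        ultimately show "t\<^sup>2 * ((2 * c)\<^sup>2 * B) / k < e / 2" by linarith
      qed
      have "\<bar>euler (t / m) m f x - euler (t / n) n f x\<bar> \<le> t\<^sup>2 * ((2 * c)\<^sup>2 * B) / m + t\<^sup>2 * ((2 * c)\<^sup>2 * B) / n"
        using * mn t B by (intro euler_Cauchy_bound) auto
      also have "\<dots> < e" using *(1)[OF mn(1)] *(1)[OF mn(2)] by linarith
      finally show "dist (euler (t / m) m f x) (euler (t / n) n f x) < e" by (simp add: dist_real_def)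
    qed
  qed
  thus ?thesis unfolding lower_trans_def by (simp add: Cauchy_convergent_iff convergent_LIMSEQ_iff)
qed

lemma euler_approx_lower_trans:
  assumes "0 \<le> t" "\<And>y. \<bar>f y\<bar> \<le> B" "0 < n" "t * c \<le> n"
  shows "\<bar>euler (t / n) n f x - lower_trans t f x\<bar> \<le> t\<^sup>2 * ((2 * c)\<^sup>2 * B) / n"
proof (rule LIMSEQ_le)
  show "(\<lambda>m. \<bar>euler (t / n) n f x - euler (t / m) m f x\<bar>) \<longlonglongrightarrow> \<bar>euler (t / n) n f x - lower_trans t f x\<bar>"
    using assms by (intro tendsto_intros euler_tendsto_lower_trans)
  have "(\<lambda>m. t\<^sup>2 * ((2 * c)\<^sup>2 * B) / n + t\<^sup>2 * ((2 * c)\<^sup>2 * B) / real m) \<longlonglongrightarrow> t\<^sup>2 * ((2 * c)\<^sup>2 * B) / n + 0"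
    by (intro tendsto_intros lim_const_over_n)
  thus "(\<lambda>m. t\<^sup>2 * ((2 * c)\<^sup>2 * B) / n + t\<^sup>2 * ((2 * c)\<^sup>2 * B) / real m) \<longlonglongrightarrow> t\<^sup>2 * ((2 * c)\<^sup>2 * B) / n" by simp
  show "\<exists>N. \<forall>m\<ge>N. \<bar>euler (t / n) n f x - euler (t / m) m f x\<bar> \<le> t\<^sup>2 * ((2 * c)\<^sup>2 * B) / n + t\<^sup>2 * ((2 * c)\<^sup>2 * B) / real m"
  proof (intro exI[of _ "Suc (nat \<lceil>t * c\<rceil>)"] allI impI euler_Cauchy_bound)
    fix m assume "Suc (nat \<lceil>t * c\<rceil>) \<le> m"
    thus "0 < m" "t * c \<le> m" by linarith+
  qed (use assms in auto)
qed

lemma eventually_small_step: "\<forall>\<^sub>F n in sequentially. t / real n * c \<le> 1"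
proof -
  have "(\<lambda>n. t / real n * c) \<longlonglongrightarrow> 0 * c" by (intro tendsto_intros lim_const_over_n)
  hence "\<forall>\<^sub>F n in sequentially. t / real n * c < 1" by (rule order_tendstoD) simp
  thus ?thesis by eventually_elim simp
qed

lemma lower_trans_mono:
  assumes t: "0 \<le> t" and "\<And>y. f y \<le> g y" shows "lower_trans t f x \<le> lower_trans t g x"
proof (rule tendsto_le[OF _ euler_tendsto_lower_trans euler_tendsto_lower_trans])
  show "\<forall>\<^sub>F n in sequentially. euler (t / n) n f x \<le> euler (t / n) n g x"
    using eventually_small_step[of t] by eventually_elim (use assms in \<open>auto intro!: euler_mono\<close>)
qed (use t in auto)

lemma lower_trans_add_const: "0 \<le> t \<Longrightarrow> lower_trans t (\<lambda>y. f y + k) x = lower_trans t f x + k"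
  using tendsto_add[OF euler_tendsto_lower_trans[of t f x] tendsto_const[of k]] euler_tendsto_lower_trans[of t "\<lambda>y. f y + k" x]
  by (intro LIMSEQ_unique) (auto simp: euler_add_const)

lemma lower_trans_const: "0 \<le> t \<Longrightarrow> lower_trans t (\<lambda>_. k) x = k"
  using euler_tendsto_lower_trans[of t "\<lambda>_. k" x] by (intro LIMSEQ_unique[OF _ tendsto_const]) (auto simp: euler_const)

lemma lower_trans_nonexpansive:
  assumes t: "0 \<le> t" and e: "\<And>y. \<bar>f y - g y\<bar> \<le> e" shows "\<bar>lower_trans t f x - lower_trans t g x\<bar> \<le> e"
proof -
  have "f y \<le> g y + e" "g y \<le> f y + e" for y using e[of y] by (auto simp: abs_le_iff)
  with t have "lower_trans t f x \<le> lower_trans t (\<lambda>y. g y + e) x" "lower_trans t g x \<le> lower_trans t (\<lambda>y. f y + e) x"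
    by (auto intro!: lower_trans_mono)
  thus ?thesis using t by (auto simp: lower_trans_add_const)
qed

lemma lower_trans_bound:
  assumes "0 \<le> t" "\<And>y. \<bar>f y\<bar> \<le> B" shows "\<bar>lower_trans t f x\<bar> \<le> B"
  using lower_trans_nonexpansive[of t f "\<lambda>_. 0" B x] assms by (simp add: lower_trans_const)

lemma lower_trans_0 [simp]: "lower_trans 0 f = f"
proof
  fix x
  have "euler 0 n f x = f x" for n by (induction n) (auto simp: euler_Suc)
  thus "lower_trans 0 f x = f x" using euler_tendsto_lower_trans[of 0 f x] by (intro LIMSEQ_unique[OF _ tendsto_const]) auto
qed

text \<open>This is the Euler approximation with a single step. It exhibits the lower rate operator
  as the generator of the semigroup.\<close>

lemma lower_trans_first_order:
  assumes "0 \<le> t" "t * c \<le> 1" "\<And>y. \<bar>f y\<bar> \<le> B"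
  shows "\<bar>lower_trans t f x - (f x + t * lower_rate \<Q> f x)\<bar> \<le> t\<^sup>2 * ((2 * c)\<^sup>2 * B)"
  using euler_approx_lower_trans[of t f B 1 x] assms by (simp add: euler_Suc abs_minus_commute)

lemma euler_time_lipschitz:
  assumes "0 \<le> d" "d * c \<le> 1" "0 \<le> e" "e * c \<le> 1" "\<And>y. \<bar>f y\<bar> \<le> B"
  shows "\<bar>euler d n f x - euler e n f x\<bar> \<le> n * \<bar>d - e\<bar> * (2 * c * B)"
proof (induction n arbitrary: x)
  case (Suc n)
  have "\<bar>euler d 1 (euler d n f) x - euler d 1 (euler e n f) x\<bar> \<le> n * \<bar>d - e\<bar> * (2 * c * B)"
    using assms Suc by (intro euler_nonexpansive)
  moreover have "\<bar>(d - e) * lower_rate \<Q> (euler e n f) x\<bar> \<le> \<bar>d - e\<bar> * (2 * c * B)"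
    using assms by (simp add: abs_mult mult_left_mono lower_rate_bound euler_bound)
  ultimately show ?case by (simp add: euler_Suc algebra_simps)
qed simp

lemma lower_trans_time_lipschitz:
  assumes t: "0 \<le> t" "0 \<le> r" "\<And>y. \<bar>f y\<bar> \<le> B"
  shows "\<bar>lower_trans t f x - lower_trans r f x\<bar> \<le> \<bar>t - r\<bar> * (2 * c * B)"
proof (rule tendsto_upperbound)
  show "(\<lambda>n. \<bar>euler (t / n) n f x - euler (r / n) n f x\<bar>) \<longlonglongrightarrow> \<bar>lower_trans t f x - lower_trans r f x\<bar>"
    using assms by (intro tendsto_intros euler_tendsto_lower_trans)
  show "\<forall>\<^sub>F n in sequentially. \<bar>euler (t / n) n f x - euler (r / n) n f x\<bar> \<le> \<bar>t - r\<bar> * (2 * c * B)"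
    using eventually_small_step[of t] eventually_small_step[of r] eventually_gt_at_top[of 0]
  proof eventually_elim
    case (elim n)
    have "\<bar>euler (t / n) n f x - euler (r / n) n f x\<bar> \<le> n * \<bar>t / n - r / n\<bar> * (2 * c * B)"
      using assms elim by (intro euler_time_lipschitz) auto
    also have "n * \<bar>t / n - r / n\<bar> = \<bar>t - r\<bar>"
      using elim by (simp add: diff_divide_distrib[symmetric] abs_divide)
    finally show ?case .
  qed
qed simp

text \<open>Step lengths that reach \<open>t\<close> only approximately are allowed because the
  semigroup property needs one step length for two times that may be incommensurable.\<close>

lemma euler_tendsto_lower_trans':
  assumes d: "\<And>k. 0 \<le> d k" "d \<longlonglongrightarrow> 0" and n: "(\<lambda>k. n k * d k) \<longlonglongrightarrow> t" and t: "0 \<le> t"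
  shows "(\<lambda>k. euler (d k) (n k) f x) \<longlonglongrightarrow> lower_trans t f x"
proof (rule Lim_transform2)
  obtain B where B: "\<And>y. \<bar>f y\<bar> \<le> B" using bounded_function by blast
  show "(\<lambda>k. lower_trans (n k * d k) f x) \<longlonglongrightarrow> lower_trans t f x"
  proof (rule Lim_transform2[OF tendsto_const], rule Lim_null_comparison)
    show "(\<lambda>k. \<bar>n k * d k - t\<bar> * (2 * c * B)) \<longlonglongrightarrow> 0"
      using tendsto_mult_right[OF tendsto_rabs[OF tendsto_diff[OF n tendsto_const[of t]]], of "2 * c * B"]
      by simp
    show "\<forall>\<^sub>F k in sequentially. norm (lower_trans t f x - lower_trans (n k * d k) f x) \<le> \<bar>n k * d k - t\<bar> * (2 * c * B)"
    proof (intro always_eventually allI)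
      fix k
      have "\<bar>lower_trans t f x - lower_trans (n k * d k) f x\<bar> \<le> \<bar>t - n k * d k\<bar> * (2 * c * B)"
        using t d B by (intro lower_trans_time_lipschitz) auto
      thus "norm (lower_trans t f x - lower_trans (n k * d k) f x) \<le> \<bar>n k * d k - t\<bar> * (2 * c * B)"
        by (simp add: abs_minus_commute)
    qed
  qed
  show "(\<lambda>k. lower_trans (n k * d k) f x - euler (d k) (n k) f x) \<longlonglongrightarrow> 0"
  proof (rule Lim_null_comparison)
    show "(\<lambda>k. (n k * d k) * d k * ((2 * c)\<^sup>2 * B)) \<longlonglongrightarrow> 0"
      using tendsto_mult_right[OF tendsto_mult[OF n d(2)]] by simp
    have "(\<lambda>k. d k * c) \<longlonglongrightarrow> 0" using tendsto_mult_right[OF d(2), of c] by simp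
    hence "\<forall>\<^sub>F k in sequentially. d k * c < 1" by (rule order_tendstoD) simp
    thus "\<forall>\<^sub>F k in sequentially. norm (lower_trans (n k * d k) f x - euler (d k) (n k) f x) \<le> (n k * d k) * d k * ((2 * c)\<^sup>2 * B)"
    proof eventually_elim
      case (elim k)
      show ?case
      proof (cases "n k = 0")
        case False
        have "real (n k) * (d k * c) \<le> real (n k) * 1" using elim by (intro mult_left_mono) auto
        hence "\<bar>euler ((n k * d k) / n k) (n k) f x - lower_trans (n k * d k) f x\<bar> \<le> (n k * d k)\<^sup>2 * ((2 * c)\<^sup>2 * B) / n k"
          using False d elim B by (intro euler_approx_lower_trans) auto
        thus ?thesis using False by (simp add: abs_minus_commute power2_eq_square ac_simps)
      qed simp
    qed
  qed
qed

text \<open>With the common step length \<open>1 / Suc k\<close>, Euler iterates compose exactly.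
  The error of the inner iterate passes through the outer one without growing, and the supremum of
  that error is bounded by its sum over the finite state space.\<close>

lemma lower_trans_semigroup:
  assumes t: "0 \<le> t" "0 \<le> r" shows "lower_trans (t + r) f = lower_trans t (lower_trans r f)"
proof
  fix x
  define d where "d k = 1 / real (Suc k)" for k
  define n where "n a k = nat \<lfloor>a * Suc k\<rfloor>" for a :: real and k :: nat
  have d: "0 \<le> d k" "d \<longlonglongrightarrow> 0" for k
    using LIMSEQ_inverse_real_of_nat by (auto simp: d_def[abs_def] inverse_eq_divide)
  have n: "(\<lambda>k. real (n a k) * d k) \<longlonglongrightarrow> a" if "0 \<le> a" for a
  proof (rule Lim_transform2[OF tendsto_const], rule Lim_null_comparison[OF _ d(2)], rule always_eventually, rule allI)
    fix k
    have "0 \<le> a * Suc k" using that by simp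
    hence "\<bar>a * Suc k - n a k\<bar> \<le> 1" unfolding n_def by linarith
    moreover have "a - n a k * d k = (a * Suc k - n a k) * d k" by (simp add: d_def field_simps del: of_nat_Suc)
    ultimately show "norm (a - n a k * d k) \<le> d k"
      using d(1)[of k] by (simp add: abs_mult mult_left_le_one_le)
  qed
  have "(\<lambda>k. real (n t k + n r k) * d k) \<longlonglongrightarrow> t + r"
    using tendsto_add[OF n[OF t(1)] n[OF t(2)]] by (simp add: algebra_simps)
  hence 1: "(\<lambda>k. euler (d k) (n t k + n r k) f x) \<longlonglongrightarrow> lower_trans (t + r) f x"
    using d t by (intro euler_tendsto_lower_trans') auto
  have 2: "(\<lambda>k. euler (d k) (n t k) (lower_trans r f) x) \<longlonglongrightarrow> lower_trans t (lower_trans r f) x"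
    using d n t by (intro euler_tendsto_lower_trans') auto
  have 3: "(\<lambda>k. euler (d k) (n r k) f y) \<longlonglongrightarrow> lower_trans r f y" for y
    using d n t by (intro euler_tendsto_lower_trans') auto
  have 4: "(\<lambda>k. lower_trans r f y - euler (d k) (n r k) f y) \<longlonglongrightarrow> 0" for y
    using tendsto_diff[OF tendsto_const[of "lower_trans r f y"] 3[of y]] by simp
  have "(\<lambda>k. euler (d k) (n t k + n r k) f x) \<longlonglongrightarrow> lower_trans t (lower_trans r f) x"
  proof (rule Lim_transform2[OF 2], rule Lim_null_comparison)
    show "(\<lambda>k. \<Sum>y\<in>UNIV. \<bar>lower_trans r f y - euler (d k) (n r k) f y\<bar>) \<longlonglongrightarrow> 0"
      by (intro tendsto_null_sum tendsto_rabs_zero) (rule 4)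
    have "(\<lambda>k. d k * c) \<longlonglongrightarrow> 0" using tendsto_mult_right[OF d(2), of c] by simp
    hence "\<forall>\<^sub>F k in sequentially. d k * c < 1" by (rule order_tendstoD) simp
    thus "\<forall>\<^sub>F k in sequentially. norm (euler (d k) (n t k) (lower_trans r f) x - euler (d k) (n t k + n r k) f x)
        \<le> (\<Sum>y\<in>UNIV. \<bar>lower_trans r f y - euler (d k) (n r k) f y\<bar>)"
    proof eventually_elim
      case (elim k)
      show ?case unfolding euler_add real_norm_def
        using elim d by (intro euler_nonexpansive member_le_sum) auto
    qed
  qed
  from LIMSEQ_unique[OF 1 this] show "lower_trans (t + r) f x = lower_trans t (lower_trans r f) x" .
qed

end

subsection \<open>Conditional probabilities on path space\<close>

abbreviation state_at :: "real \<Rightarrow> 'x \<Rightarrow> (real \<Rightarrow> 'x) set" where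
  "state_at t y \<equiv> {\<omega> \<in> paths. \<omega> t = y}"

lemma cyl_subset_paths: "cyl V x \<subseteq> paths"
  by (auto simp: cyl_def)

lemma cyl_empty: "cyl {} x = paths"
  by (auto simp: cyl_def)

lemma cyl_nonempty: "V \<subseteq> {0..} \<Longrightarrow> cyl V x \<noteq> {}"
proof -
  assume "V \<subseteq> {0..}"
  hence "restrict x {0..} \<in> cyl V x" by (auto simp: cyl_def paths_def)
  thus ?thesis by blast
qed

lemma cyl_insert: "cyl (insert t V) x = state_at t (x t) \<inter> cyl V x"
  by (auto simp: cyl_def)

lemma cyl_cong: "(\<And>t. t \<in> V \<Longrightarrow> x t = y t) \<Longrightarrow> cyl V x = cyl V y"
  by (auto simp: cyl_def)

lemma state_at_in_event_algebra:
  "0 \<le> s \<Longrightarrow> s \<in> u \<or> (\<forall>t\<in>u. t < s) \<Longrightarrow> state_at s y \<in> event_algebra u"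
  unfolding event_algebra_def by (rule hull_inc) blast

lemma event_algebra_Int:
  assumes "A \<in> event_algebra u" "B \<in> event_algebra u" shows "A \<inter> B \<in> event_algebra u"
  using assms by (auto simp: event_algebra_def hull_def algebra_iff_Int)

lemma paths_in_event_algebra: "paths \<in> event_algebra u"
  by (auto simp: event_algebra_def hull_def dest: algebra.top)

lemma cyl_in_event_algebra:
  assumes "finite V" "V \<subseteq> {0..}" shows "cyl V x \<in> event_algebra {}"
  using assms
proof (induction V)
  case empty
  show ?case by (simp add: cyl_empty paths_in_event_algebra)
next
  case (insert t V)
  thus ?case unfolding cyl_insert
    by (intro event_algebra_Int state_at_in_event_algebra) auto
qed

lemma state_at_process_domain:
  assumes "finite u" "u \<subseteq> {0..}" "0 \<le> s" "s \<in> u \<or> (\<forall>t\<in>u. t < s)"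
  shows "(state_at s y, cyl u x) \<in> process_domain"
  unfolding process_domain_def using assms state_at_in_event_algebra[of s u y] by blast

lemma cyl_process_domain:
  assumes "finite V" "V \<subseteq> {0..}" shows "(cyl V x, paths) \<in> process_domain"
  unfolding process_domain_def using cyl_in_event_algebra[OF assms, of x] cyl_empty[of x] by blast

lemma trans_matrix_nth:
  assumes "\<And>z. z \<in> process_domain \<Longrightarrow> R z = P z"
    and "finite u" "u \<subseteq> {0..}" "0 \<le> t" "t < s" "\<And>r. r \<in> u \<Longrightarrow> r < s"
  shows "trans_matrix P u x t s $ w $ y = R (state_at s y, cyl (insert t u) (x(t := w)))"
  unfolding trans_matrix_def using assms(2-) by (auto intro!: assms(1)[symmetric] state_at_process_domain)

locale path_cond_prob =
  fixes R :: "('x::finite) process"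
  assumes fcp: "full_cond_prob R paths"
begin

lemma cp_nonneg: "A \<subseteq> paths \<Longrightarrow> C \<subseteq> paths \<Longrightarrow> C \<noteq> {} \<Longrightarrow> 0 \<le> R (A, C)"
  by (rule fcp[unfolded full_cond_prob_def, THEN conjunct1, rule_format]) auto

lemma cp_one: "A \<subseteq> paths \<Longrightarrow> C \<noteq> {} \<Longrightarrow> C \<subseteq> A \<Longrightarrow> R (A, C) = 1"
  by (rule fcp[unfolded full_cond_prob_def, THEN conjunct2, THEN conjunct1, rule_format]) auto

lemma cp_add: "A \<subseteq> paths \<Longrightarrow> B \<subseteq> paths \<Longrightarrow> C \<subseteq> paths \<Longrightarrow> C \<noteq> {} \<Longrightarrow> A \<inter> B = {} \<Longrightarrow>
    R (A \<union> B, C) = R (A, C) + R (B, C)"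
  by (rule fcp[unfolded full_cond_prob_def, THEN conjunct2, THEN conjunct2, THEN conjunct1, rule_format]) auto

lemma cp_mult: "A \<subseteq> paths \<Longrightarrow> D \<subseteq> paths \<Longrightarrow> C \<subseteq> paths \<Longrightarrow> D \<inter> C \<noteq> {} \<Longrightarrow>
    R (A \<inter> D, C) = R (A, D \<inter> C) * R (D, C)"
  by (rule fcp[unfolded full_cond_prob_def, THEN conjunct2, THEN conjunct2, THEN conjunct2, rule_format]) auto

lemma cp_empty: "C \<subseteq> paths \<Longrightarrow> C \<noteq> {} \<Longrightarrow> R ({}, C) = 0"
  using cp_add[of "{}" "{}" C] by simp

lemma cp_restrict: "A \<subseteq> paths \<Longrightarrow> C \<subseteq> paths \<Longrightarrow> C \<noteq> {} \<Longrightarrow> R (A \<inter> C, C) = R (A, C)"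
  using cp_mult[of A C C] cp_one[of C C] by simp

lemma cp_sum_state:
  assumes "A \<subseteq> paths" "C \<subseteq> paths" "C \<noteq> {}"
  shows "R (A, C) = (\<Sum>y\<in>UNIV. R (A \<inter> state_at t y, C))"
proof -
  have "R ({\<omega> \<in> A. \<omega> t \<in> S}, C) = (\<Sum>y\<in>S. R (A \<inter> state_at t y, C))" if "finite S" for S
    using that
  proof induction
    case empty
    show ?case using assms by (simp add: cp_empty)
  next
    case (insert y S)
    have "{\<omega> \<in> A. \<omega> t \<in> insert y S} = (A \<inter> state_at t y) \<union> {\<omega> \<in> A. \<omega> t \<in> S}"
      using assms by auto
    moreover have "R (\<dots>, C) = R (A \<inter> state_at t y, C) + R ({\<omega> \<in> A. \<omega> t \<in> S}, C)"
      using assms insert by (intro cp_add) auto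
    ultimately show ?case using insert by simp
  qed
  from this[of UNIV] show ?thesis by simp
qed

lemma cp_state_sum_1: "C \<subseteq> paths \<Longrightarrow> C \<noteq> {} \<Longrightarrow> (\<Sum>y\<in>UNIV. R (state_at t y, C)) = 1"
  using cp_sum_state[of paths C t] cp_one[of paths C] by (simp add: Int_absorb1)

text \<open>If \<open>t \<in> V\<close>, the factor \<open>R (state_at t w, cyl V x)\<close> vanishes unless \<open>w = x t\<close>.\<close>

lemma cp_total:
  assumes "A \<subseteq> paths" "V \<subseteq> {0..}"
  shows "R (A, cyl V x) =
    (\<Sum>w\<in>UNIV. R (state_at t w, cyl V x) * R (A, cyl (insert t V) (x(t := w))))"
proof -
  have "R (A \<inter> state_at t w, cyl V x) =
      R (state_at t w, cyl V x) * R (A, cyl (insert t V) (x(t := w)))" for w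
  proof (cases "state_at t w \<inter> cyl V x = {}")
    case True
    hence "R (state_at t w, cyl V x) = 0"
      using assms cp_restrict[of "state_at t w" "cyl V x"] cyl_subset_paths[of V x] cyl_nonempty[of V x]
      by (auto simp: cp_empty)
    moreover have "R (A \<inter> state_at t w, cyl V x) = 0"
    proof -
      have "A \<inter> state_at t w \<inter> cyl V x = {}" using True by blast
      thus ?thesis
        using assms cp_restrict[of "A \<inter> state_at t w" "cyl V x"] cyl_subset_paths[of V x] cyl_nonempty[of V x]
        by (auto simp: cp_empty)
    qed
    ultimately show ?thesis by simp
  next
    case False
    have "state_at t w \<inter> cyl V x = cyl (insert t V) (x(t := w))"
    proof (cases "t \<in> V")
      case True
      hence "x t = w" using False by (auto simp: cyl_def)
      thus ?thesis using True by (simp add: cyl_insert fun_upd_idem)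
    qed (auto simp: cyl_insert cyl_def)
    thus ?thesis using False assms cp_mult[of A "state_at t w" "cyl V x"] cyl_subset_paths[of V x]
      by auto
  qed
  thus ?thesis using assms cp_sum_state[of A "cyl V x" t] cyl_subset_paths[of V x] cyl_nonempty[of V x]
    by simp
qed

end

section \<open>The lower bound for conditional expectations under an arbitrary process of the
  chain\<close>

text \<open>A monotonicity criterion for Dini derivatives. For each \<epsilon> take the supremum of
  the times at which \<phi> lies above the line of slope -\<epsilon> through its initial value: left
  continuity puts the supremum into this set, and the condition on the right would extend the set
  beyond any point before \<open>b\<close>.\<close>

lemma right_slope_nonneg_imp_le:
  fixes \<phi> :: "real \<Rightarrow> real"
  assumes ab: "a \<le> b"
    and right: "\<And>r \<epsilon>. a \<le> r \<Longrightarrow> r < b \<Longrightarrow> 0 < \<epsilon> \<Longrightarrow> \<forall>\<^sub>F \<Delta> in at_right 0. \<phi> r - \<epsilon> * \<Delta> \<le> \<phi> (r + \<Delta>)"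
    and left: "\<And>r. a < r \<Longrightarrow> r \<le> b \<Longrightarrow> ((\<lambda>\<Delta>. \<phi> (r - \<Delta>)) \<longlongrightarrow> \<phi> r) (at_right 0)"
  shows "\<phi> a \<le> \<phi> b"
proof -
  have *: "\<phi> a - \<epsilon> * (b - a) \<le> \<phi> b" if \<epsilon>: "0 < \<epsilon>" for \<epsilon>
  proof -
    define S where "S = {r \<in> {a..b}. \<phi> a - \<epsilon> * (r - a) \<le> \<phi> r}"
    define c where "c = Sup S"
    have aS: "a \<in> S" using ab by (auto simp: S_def)
    have bdd: "bdd_above S" by (auto simp: S_def intro!: bdd_aboveI[of _ b])
    have ac: "a \<le> c" unfolding c_def using aS bdd by (rule cSup_upper)
    have cb: "c \<le> b" unfolding c_def using aS by (intro cSup_least) (auto simp: S_def)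
    have cS: "c \<in> S"
    proof (cases "c = a")
      case False
      have "\<phi> a - \<epsilon> * (c - a) \<le> \<phi> c"
      proof (rule ccontr)
        assume "\<not> ?thesis"
        hence lt: "\<phi> c < \<phi> a - \<epsilon> * (c - a)" by simp
        have "\<forall>\<^sub>F \<Delta> in at_right 0. \<phi> (c - \<Delta>) < \<phi> a - \<epsilon> * (c - a)"
          using left[of c] False ac cb lt by (intro order_tendstoD(2)) auto
        then obtain d where d: "0 < d" "\<And>\<Delta>. 0 < \<Delta> \<Longrightarrow> \<Delta> < d \<Longrightarrow> \<phi> (c - \<Delta>) < \<phi> a - \<epsilon> * (c - a)"
          by (auto simp: eventually_at_right_field)
        obtain r where r: "r \<in> S" "c - d < r" using less_cSupD[of S "c - d"] aS d(1) c_def by auto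
        have rc: "r \<le> c" unfolding c_def using r bdd by (intro cSup_upper)
        have rS: "\<phi> a - \<epsilon> * (r - a) \<le> \<phi> r" using r by (simp add: S_def)
        have "\<epsilon> * (r - a) \<le> \<epsilon> * (c - a)" using rc \<epsilon> by simp
        moreover have "r \<noteq> c" using rS lt by auto
        ultimately show False using d(2)[of "c - r"] r rc rS by simp
      qed
      thus ?thesis using ac cb by (simp add: S_def)
    qed (use aS in simp)
    have "c = b"
    proof (rule ccontr)
      assume "c \<noteq> b"
      hence "c < b" using cb by simp
      from right[OF ac this \<epsilon>] obtain d where d: "0 < d"
        "\<And>\<Delta>. 0 < \<Delta> \<Longrightarrow> \<Delta> < d \<Longrightarrow> \<phi> c - \<epsilon> * \<Delta> \<le> \<phi> (c + \<Delta>)"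
        by (auto simp: eventually_at_right_field)
      define \<Delta> where "\<Delta> = min (d / 2) (b - c)"
      have \<Delta>: "0 < \<Delta>" "\<Delta> < d" "c + \<Delta> \<le> b" using d \<open>c < b\<close> by (auto simp: \<Delta>_def min_def)
      have "\<phi> a - \<epsilon> * (c - a) \<le> \<phi> c" using cS by (simp add: S_def)
      hence "\<phi> a - \<epsilon> * (c + \<Delta> - a) \<le> \<phi> (c + \<Delta>)"
        using d(2)[OF \<Delta>(1,2)] by (simp add: algebra_simps)
      hence "c + \<Delta> \<in> S" using \<Delta> ac by (simp add: S_def)
      hence "c + \<Delta> \<le> c" unfolding c_def using bdd by (intro cSup_upper)
      thus False using \<Delta> by simp
    qed
    thus ?thesis using cS by (simp add: S_def)
  qed
  show ?thesis
  proof (rule field_le_epsilon)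
    fix e :: real assume e: "0 < e"
    \<comment> \<open>The \<open>+ 1\<close> avoids a division by zero when
      \<open>a = b\<close>.\<close>
    have "\<phi> a - e / (b - a + 1) * (b - a) \<le> \<phi> b" using e ab by (intro *) auto
    moreover have "e / (b - a + 1) * (b - a) \<le> e" using e ab by (simp add: field_simps)
    ultimately show "\<phi> a \<le> \<phi> b + e" by linarith
  qed
qed

locale ictmc_process = rate_set \<Q> c + path_cond_prob R
  for \<Q> :: "(real^'x^('x::finite)) set" and c and R +
  fixes P :: "'x process"
  assumes agree: "z \<in> process_domain \<Longrightarrow> R z = P z"
    and wb: "well_behaved P"
    and cons: "consistent_with P \<Q>"
begin

lemma entry_bound:
  fixes q :: "real^'x^'x" and K :: real assumes "norm q \<le> K" shows "\<bar>q $ w $ y\<bar> \<le> K"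
  using assms component_le_norm_cart[of "q $ w" y] Finite_Cartesian_Product.norm_nth_le[of q w] by simp

lemma row_sum_bound:
  fixes q :: "real^'x^'x" and K B :: real assumes "norm q \<le> K" "\<And>y. \<bar>g y\<bar> \<le> B"
  shows "\<bar>\<Sum>y\<in>UNIV. q $ w $ y * g y\<bar> \<le> CARD('x) * (K * B)"
proof -
  have "0 \<le> K" using assms(1) norm_ge_zero[of q] by linarith
  hence "\<bar>q $ w $ y * g y\<bar> \<le> K * B" for y
    using entry_bound[OF assms(1), of w y] assms(2)[of y] by (auto simp: abs_mult intro!: mult_mono)
  hence "(\<Sum>y\<in>UNIV. \<bar>q $ w $ y * g y\<bar>) \<le> of_nat (card (UNIV::'x set)) * (K * B)"
    by (intro sum_bounded_above) auto
  thus ?thesis using sum_abs[of "\<lambda>y. q $ w $ y * g y" UNIV] by linarith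
qed

text \<open>Consistency speaks of limit points only. If the bound failed for arbitrarily small
  \<Delta>, boundedness of the quotients would give a convergent subsequence of violations; its
  limit lies in \<open>\<Q>\<close> and contradicts \<open>lower_rate_le\<close>.\<close>

lemma right_quotient_ge:
  assumes t: "0 \<le> t" "finite u" "u \<subseteq> {0..<t}" and \<eta>: "0 < \<eta>"
  shows "\<forall>\<^sub>F \<Delta> in at_right 0.
    lower_rate \<Q> g w - \<eta> \<le> (\<Sum>y\<in>UNIV. right_quotient P u x t \<Delta> $ w $ y * g y)"
proof (rule ccontr)
  let ?q = "right_quotient P u x t"
  assume "\<not> ?thesis"
  hence fr: "\<exists>\<^sub>F \<Delta> in at_right 0. (\<Sum>y\<in>UNIV. ?q \<Delta> $ w $ y * g y) < lower_rate \<Q> g w - \<eta>"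
    by (simp add: not_eventually not_le)
  obtain K where K: "\<forall>\<^sub>F \<Delta> in at_right 0. norm (?q \<Delta>) \<le> K"
    using wb t unfolding well_behaved_def Bfun_def by blast
  have "\<exists>\<Delta>. (\<Sum>y\<in>UNIV. ?q \<Delta> $ w $ y * g y) < lower_rate \<Q> g w - \<eta> \<and> norm (?q \<Delta>) \<le> K \<and>
      0 < \<Delta> \<and> \<Delta> < 1 / Suc n" for n
  proof -
    have "\<forall>\<^sub>F \<Delta> in at_right 0. \<Delta> \<in> {0<..<1 / real (Suc n)}"
      by (rule eventually_at_right_real) simp
    with K have "\<forall>\<^sub>F \<Delta> in at_right 0. norm (?q \<Delta>) \<le> K \<and> 0 < \<Delta> \<and> \<Delta> < 1 / real (Suc n)"
      by eventually_elim auto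
    from frequently_ex[OF frequently_eventually_frequently[OF fr this]] show ?thesis by blast
  qed
  then obtain d where d: "\<And>n. (\<Sum>y\<in>UNIV. ?q (d n) $ w $ y * g y) < lower_rate \<Q> g w - \<eta>"
    "\<And>n. norm (?q (d n)) \<le> K" "\<And>n. 0 < d n" "\<And>n. d n < 1 / Suc n"
    by metis
  have d0: "filterlim d (at_right 0) sequentially"
  proof (rule tendsto_imp_filterlim_at_right)
    show "d \<longlonglongrightarrow> 0"
      using d(3,4) less_imp_le LIMSEQ_inverse_real_of_nat
      by (intro real_tendsto_sandwich[of "\<lambda>_. 0" d sequentially "\<lambda>n. 1 / Suc n"])
        (auto simp: inverse_eq_divide intro!: always_eventually less_imp_le)
  qed (use d in auto)
  obtain S r where S: "strict_mono r" "((\<lambda>n. ?q (d n)) \<circ> r) \<longlonglongrightarrow> S"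
    using compact_cball[of "0::real^'x^'x" K] d(2) unfolding compact_def
    by (metis mem_cball_0)
  have "filterlim (d \<circ> r) (at_right 0) sequentially"
    using d0 filterlim_subseq[OF S(1)] by (auto simp: o_def intro: filterlim_compose)
  hence "S \<in> limit_points_at_0 ?q" using S unfolding limit_points_at_0_def by (auto simp: o_def)
  hence SQ: "S \<in> \<Q>" using cons t unfolding consistent_with_def by blast
  have "(\<lambda>n. \<Sum>y\<in>UNIV. ?q (d (r n)) $ w $ y * g y) \<longlonglongrightarrow> (\<Sum>y\<in>UNIV. S $ w $ y * g y)"
    using S(2) by (auto intro!: tendsto_intros simp: o_def)
  hence "(\<Sum>y\<in>UNIV. S $ w $ y * g y) \<le> lower_rate \<Q> g w - \<eta>"
    using d(1) by (intro LIMSEQ_le_const2) (auto intro: less_imp_le)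
  with lower_rate_le[OF SQ, of g w] \<eta> show False by linarith
qed

lemma cond_expect_ge:
  assumes t: "0 \<le> t" "finite u" "u \<subseteq> {0..<t}" and tb: "t \<le> b"
  shows "lower_trans (b - t) f (x t) \<le> (\<Sum>y\<in>UNIV. R (state_at b y, cyl (insert t u) x) * f y)"
proof -
  define V where "V = insert t u"
  define C where "C = cyl V x"
  define \<pi> where "\<pi> r w = R (state_at r w, C)" for r w
  define \<tau> where "\<tau> r q w y = R (state_at q y, cyl (insert r V) (x(r := w)))" for r q w y
  \<comment> \<open>\<phi> interpolates between the lower bound at \<open>r = t\<close>, where the
    state is known, and the conditional expectation of \<open>f\<close> at \<open>r = b\<close>,
    where the operator is the identity.\<close>
  define \<phi> where "\<phi> r = (\<Sum>w\<in>UNIV. \<pi> r w * lower_trans (b - r) f w)" for r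
  have V: "finite V" "V \<subseteq> {0..}" "\<And>r. r \<in> V \<Longrightarrow> r \<le> t" using t by (auto simp: V_def)
  have C: "C \<subseteq> paths" "C \<noteq> {}" using V cyl_subset_paths[of V x] cyl_nonempty[of V x] by (auto simp: C_def)
  have \<pi>: "0 \<le> \<pi> r w" "(\<Sum>w\<in>UNIV. \<pi> r w) = 1" for r w
    unfolding \<pi>_def using C by (auto intro: cp_nonneg cp_state_sum_1)
  have CK: "\<pi> q y = (\<Sum>w\<in>UNIV. \<pi> r w * \<tau> r q w y)" for q r y
    unfolding \<pi>_def \<tau>_def C_def using V by (intro cp_total) auto
  obtain B where B: "\<And>y. \<bar>f y\<bar> \<le> B" using bounded_function by blast
  have B0: "0 \<le> B" using B[of undefined] by linarith
  have gB: "\<bar>lower_trans r f y\<bar> \<le> B" if "0 \<le> r" for r y using that B by (intro lower_trans_bound)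
  have incr: "\<phi> q - \<phi> r = (\<Sum>w\<in>UNIV. \<pi> r w * ((\<Sum>y\<in>UNIV. \<tau> r q w y * lower_trans (b - q) f y) - lower_trans (b - r) f w))" for q r
  proof -
    have "\<phi> q = (\<Sum>y\<in>UNIV. \<Sum>w\<in>UNIV. \<pi> r w * (\<tau> r q w y * lower_trans (b - q) f y))"
      unfolding \<phi>_def by (subst CK[of q _ r]) (simp add: sum_distrib_right mult.assoc)
    also have "\<dots> = (\<Sum>w\<in>UNIV. \<pi> r w * (\<Sum>y\<in>UNIV. \<tau> r q w y * lower_trans (b - q) f y))"
      by (subst sum.swap) (simp add: sum_distrib_left)
    finally show ?thesis by (simp add: \<phi>_def right_diff_distrib sum_subtractf)
  qed
  have split: "(\<Sum>y\<in>UNIV. \<tau> r q w y * g y) = g w + d * (\<Sum>y\<in>UNIV. A $ w $ y * g y)"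
    if d: "0 < d" and A: "A = (1 / d) *\<^sub>R (T - mat 1)" and T: "\<And>w y. T $ w $ y = \<tau> r q w y"
    for r q w g d and A T :: "real^'x^'x"
  proof -
    have "\<tau> r q w y = d * A $ w $ y + (if w = y then 1 else 0)" for y
      using d by (simp add: A T[symmetric] mat_def)
    thus ?thesis by (simp add: distrib_right sum.distrib sum_distrib_left mult.assoc if_distrib[of "\<lambda>a. a * _"] cong: if_cong)
  qed
  have "\<phi> t \<le> \<phi> b"
  proof (rule right_slope_nonneg_imp_le[OF tb])
    fix r \<epsilon> :: real assume r: "t \<le> r" "r < b" and \<epsilon>: "0 < \<epsilon>"
    \<comment> \<open>For \<open>r = t\<close> the time \<open>r\<close> already belongs to
      \<open>V\<close>; removing it leaves a history strictly before \<open>r\<close>, as the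
      quotients require.\<close>
    let ?q = "right_quotient P (V - {r}) x r"
    let ?g = "lower_trans (b - r) f"
    have u': "0 \<le> r" "finite (V - {r})" "V - {r} \<subseteq> {0..<r}" using r t V by force+
    obtain K where K: "\<forall>\<^sub>F \<Delta> in at_right 0. norm (?q \<Delta>) \<le> K"
      using wb u' unfolding well_behaved_def Bfun_def by blast
    \<comment> \<open>The three terms come from replacing \<open>?h\<close> by \<open>?g\<close> in
      the quotient, from the same replacement in the lower rate, and from the second-order error of
      the semigroup over time \<Delta>.\<close>
    define D where "D = CARD('x) * (K * (2 * c * B)) + 2 * c * (2 * c * B) + (2 * c)\<^sup>2 * B"
    have small: "\<forall>\<^sub>F \<Delta> in at_right 0. \<Delta> * k < e" if "0 < e" for k e :: real
    proof (rule order_tendstoD)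
      show "((\<lambda>\<Delta>. \<Delta> * k) \<longlongrightarrow> 0) (at_right 0)"
        using tendsto_mult_right[OF tendsto_ident_at, of k 0 "{0<..}"] by simp
    qed (use that in auto)
    have near: "\<forall>\<^sub>F \<Delta> in at_right 0. \<forall>w. lower_rate \<Q> ?g w - \<epsilon> / 2 \<le> (\<Sum>y\<in>UNIV. ?q \<Delta> $ w $ y * ?g y)"
      using right_quotient_ge[OF u', of "\<epsilon> / 2"] \<epsilon> by (intro eventually_all_finite) auto
    have e: "0 < \<epsilon> / 2" "0 < b - r" using \<epsilon> r by auto
    show "\<forall>\<^sub>F \<Delta> in at_right 0. \<phi> r - \<epsilon> * \<Delta> \<le> \<phi> (r + \<Delta>)"
      using near K small[OF e(1), of D] small[OF zero_less_one, of c] small[OF e(2), of 1]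
        eventually_at_right_less[of 0]
    proof eventually_elim
      case (elim \<Delta>)
      let ?h = "lower_trans (b - (r + \<Delta>)) f"
      have \<Delta>: "0 < \<Delta>" "\<Delta> \<le> b - r" "\<Delta> * c \<le> 1" and K: "norm (?q \<Delta>) \<le> K" and D: "\<Delta> * D \<le> \<epsilon> / 2"
        using elim \<epsilon> by simp_all
      have hB: "\<bar>?h y\<bar> \<le> B" for y using \<Delta> by (intro gB) auto
      have hg: "\<bar>?h y - ?g y\<bar> \<le> \<Delta> * (2 * c * B)" for y
        using lower_trans_time_lipschitz[of "b - (r + \<Delta>)" "b - r" f B y] \<Delta> B r by simp
      have step: "- (\<epsilon> * \<Delta>) \<le> (\<Sum>y\<in>UNIV. \<tau> r (r + \<Delta>) w y * ?h y) - ?g w" for w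
      proof -
        have V': "insert r (V - {r}) = insert r V" by blast
        have eq: "(\<Sum>y\<in>UNIV. \<tau> r (r + \<Delta>) w y * ?h y) = ?h w + \<Delta> * (\<Sum>y\<in>UNIV. ?q \<Delta> $ w $ y * ?h y)"
        proof (rule split[OF \<Delta>(1)])
          show "?q \<Delta> = (1 / \<Delta>) *\<^sub>R (trans_matrix P (V - {r}) x r (r + \<Delta>) - mat 1)"
            by (simp add: right_quotient_def)
          show "trans_matrix P (V - {r}) x r (r + \<Delta>) $ w $ y = \<tau> r (r + \<Delta>) w y" for w y
            unfolding \<tau>_def using u' V \<Delta> V' r by (subst trans_matrix_nth[OF agree]) force+
        qed
        \<comment> \<open>The first-order change of the semigroup cancels against the lower rate
          that the process has at least, up to errors that are small compared with \<Delta>.\<close>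
        have "lower_trans \<Delta> ?h = ?g" using lower_trans_semigroup[of \<Delta> "b - (r + \<Delta>)" f] \<Delta> by simp
        hence up: "?g w \<le> ?h w + \<Delta> * lower_rate \<Q> ?h w + \<Delta>\<^sup>2 * ((2 * c)\<^sup>2 * B)"
          using lower_trans_first_order[of \<Delta> ?h B w] \<Delta> hB by (simp add: abs_le_iff)
        have 1: "\<bar>\<Sum>y\<in>UNIV. ?q \<Delta> $ w $ y * (?h y - ?g y)\<bar> \<le> CARD('x) * (K * (\<Delta> * (2 * c * B)))"
          using K hg by (rule row_sum_bound)
        have 2: "(\<Sum>y\<in>UNIV. ?q \<Delta> $ w $ y * (?h y - ?g y)) =
            (\<Sum>y\<in>UNIV. ?q \<Delta> $ w $ y * ?h y) - (\<Sum>y\<in>UNIV. ?q \<Delta> $ w $ y * ?g y)"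
          by (simp add: right_diff_distrib sum_subtractf)
        have 3: "\<bar>lower_rate \<Q> ?h w - lower_rate \<Q> ?g w\<bar> \<le> 2 * c * (\<Delta> * (2 * c * B))"
          using hg by (rule lower_rate_lipschitz)
        have 4: "lower_rate \<Q> ?g w - \<epsilon> / 2 \<le> (\<Sum>y\<in>UNIV. ?q \<Delta> $ w $ y * ?g y)" using elim by blast
        have 5: "\<Delta> * D = CARD('x) * (K * (\<Delta> * (2 * c * B))) + 2 * c * (\<Delta> * (2 * c * B)) + \<Delta> * ((2 * c)\<^sup>2 * B)"
          by (simp add: D_def algebra_simps)
        have "- \<epsilon> \<le> (\<Sum>y\<in>UNIV. ?q \<Delta> $ w $ y * ?h y) - lower_rate \<Q> ?h w - \<Delta> * ((2 * c)\<^sup>2 * B)"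
          using 1 2 3 4 5 D by linarith
        hence "\<Delta> * (- \<epsilon>) \<le> \<Delta> * ((\<Sum>y\<in>UNIV. ?q \<Delta> $ w $ y * ?h y) - lower_rate \<Q> ?h w - \<Delta> * ((2 * c)\<^sup>2 * B))"
          using \<Delta> by (intro mult_left_mono) auto
        thus ?thesis using up unfolding eq by (simp add: algebra_simps power2_eq_square)
      qed
      have "- (\<epsilon> * \<Delta>) = (\<Sum>w\<in>UNIV. \<pi> r w * - (\<epsilon> * \<Delta>))"
        using \<pi>(2)[of r] by (simp add: sum_distrib_right[symmetric] sum_negf)
      also have "\<dots> \<le> \<phi> (r + \<Delta>) - \<phi> r"
        unfolding incr using step \<pi> by (intro sum_mono mult_left_mono) auto
      finally show ?case by linarith
    qed
  next
    fix r assume r: "t < r" "r \<le> b"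
    let ?q = "left_quotient P V x r"
    let ?g = "lower_trans (b - r) f"
    have u': "0 < r" "finite V" "V \<subseteq> {0..<r}" using r t V by force+
    obtain K where K: "\<forall>\<^sub>F \<Delta> in at_right 0. norm (?q \<Delta>) \<le> K"
      using wb u' unfolding well_behaved_def Bfun_def by (meson less_imp_le)
    \<comment> \<open>On the left, continuity is enough, and boundedness of the quotients gives it:
      the increment of \<phi> over time \<Delta> is at most \<open>\<Delta> * D\<close>.\<close>
    define D where "D = 2 * c * B + CARD('x) * (K * B)"
    have "\<forall>\<^sub>F \<Delta> in at_right 0. \<Delta> \<in> {0<..<r - t}"
      using r by (intro eventually_at_right_real) auto
    hence "\<forall>\<^sub>F \<Delta> in at_right 0. norm (\<phi> (r - \<Delta>) - \<phi> r) \<le> \<Delta> * D"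
      using K
    proof eventually_elim
      case (elim \<Delta>)
      have step: "\<bar>(\<Sum>y\<in>UNIV. \<tau> (r - \<Delta>) r w y * ?g y) - lower_trans (b - (r - \<Delta>)) f w\<bar> \<le> \<Delta> * D" for w
      proof -
        have eq: "(\<Sum>y\<in>UNIV. \<tau> (r - \<Delta>) r w y * ?g y) = ?g w + \<Delta> * (\<Sum>y\<in>UNIV. ?q \<Delta> $ w $ y * ?g y)"
        proof (rule split)
          show "?q \<Delta> = (1 / \<Delta>) *\<^sub>R (trans_matrix P V x (r - \<Delta>) r - mat 1)"
            by (simp add: left_quotient_def)
          show "trans_matrix P V x (r - \<Delta>) r $ w $ y = \<tau> (r - \<Delta>) r w y" for w y
            unfolding \<tau>_def using u' V elim r t by (subst trans_matrix_nth[OF agree]) force+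
        qed (use elim in auto)
        have "\<bar>lower_trans (b - r) f w - lower_trans (b - (r - \<Delta>)) f w\<bar> \<le> \<bar>(b - r) - (b - (r - \<Delta>))\<bar> * (2 * c * B)"
          using elim r B by (intro lower_trans_time_lipschitz) auto
        hence 1: "\<bar>?g w - lower_trans (b - (r - \<Delta>)) f w\<bar> \<le> \<Delta> * (2 * c * B)" using elim by simp
        have "\<bar>\<Sum>y\<in>UNIV. ?q \<Delta> $ w $ y * ?g y\<bar> \<le> CARD('x) * (K * B)"
          using elim gB r by (intro row_sum_bound) auto
        hence "\<bar>\<Delta> * (\<Sum>y\<in>UNIV. ?q \<Delta> $ w $ y * ?g y)\<bar> \<le> \<Delta> * (CARD('x) * (K * B))"
          using elim by (simp add: abs_mult mult_left_mono)
        with 1 show ?thesis unfolding eq D_def distrib_left by linarith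
      qed
      have "\<bar>\<phi> r - \<phi> (r - \<Delta>)\<bar> \<le> (\<Sum>w\<in>UNIV. \<pi> (r - \<Delta>) w * (\<Delta> * D))"
        unfolding incr[of r "r - \<Delta>"] using step \<pi>
        by (intro order_trans[OF sum_abs] sum_mono) (simp add: abs_mult mult_left_mono)
      also have "\<dots> = \<Delta> * D" using \<pi>(2)[of "r - \<Delta>"] by (simp add: sum_distrib_right[symmetric])
      finally show ?case by (simp add: abs_minus_commute)
    qed
    moreover have "((\<lambda>\<Delta>. \<Delta> * D) \<longlongrightarrow> 0) (at_right 0)"
      using tendsto_mult_right[OF tendsto_ident_at, of D 0 "{0<..}"] by simp
    ultimately have "((\<lambda>\<Delta>. \<phi> (r - \<Delta>) - \<phi> r) \<longlongrightarrow> 0) (at_right 0)"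
      by (rule Lim_null_comparison)
    thus "((\<lambda>\<Delta>. \<phi> (r - \<Delta>)) \<longlongrightarrow> \<phi> r) (at_right 0)" by (simp add: LIM_zero_iff)
  qed
  moreover have "\<phi> t = lower_trans (b - t) f (x t)"
  proof -
    have "\<pi> t w = (if w = x t then 1 else 0)" for w
    proof (cases "w = x t")
      case True
      thus ?thesis unfolding \<pi>_def using C by (auto intro!: cp_one simp: C_def V_def cyl_def)
    next
      case False
      hence "state_at t w \<inter> C = {}" by (auto simp: C_def V_def cyl_def)
      thus ?thesis using False C cp_restrict[of "state_at t w" C] by (auto simp: \<pi>_def cp_empty)
    qed
    thus ?thesis by (simp add: \<phi>_def if_distrib[of "\<lambda>a. a * _"] cong: if_cong)
  qed
  ultimately show ?thesis by (simp add: \<phi>_def \<pi>_def C_def V_def)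
qed

end

subsection \<open>Transition families\<close>

definition kcomp :: "('x::finite \<Rightarrow> 'x \<Rightarrow> real) \<Rightarrow> ('x \<Rightarrow> 'x \<Rightarrow> real) \<Rightarrow> 'x \<Rightarrow> 'x \<Rightarrow> real" where
  "kcomp A B x y = (\<Sum>w\<in>UNIV. A x w * B w y)"

definition kid :: "'x \<Rightarrow> 'x \<Rightarrow> real" where
  "kid x y = (if x = y then 1 else 0)"

definition kact :: "('x::finite \<Rightarrow> 'x \<Rightarrow> real) \<Rightarrow> ('x \<Rightarrow> real) \<Rightarrow> 'x \<Rightarrow> real" where
  "kact A f x = (\<Sum>y\<in>UNIV. A x y * f y)"

lemma kcomp_assoc: "kcomp (kcomp A B) C = kcomp A (kcomp B C)"
proof (intro ext)
  fix x y
  have "kcomp (kcomp A B) C x y = (\<Sum>w\<in>UNIV. \<Sum>v\<in>UNIV. A x v * (B v w * C w y))"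
    by (simp add: kcomp_def sum_distrib_right mult.assoc)
  also have "\<dots> = kcomp A (kcomp B C) x y"
    by (subst sum.swap) (simp add: kcomp_def sum_distrib_left)
  finally show "kcomp (kcomp A B) C x y = kcomp A (kcomp B C) x y" .
qed

lemma kcomp_kid [simp]: "kcomp kid A = A" "kcomp A kid = A"
  by (auto simp: kcomp_def kid_def fun_eq_iff if_distrib[of "\<lambda>a. a * _"] if_distrib[of "\<lambda>a. _ * a"]
      cong: if_cong)

lemma kact_kid [simp]: "kact kid f = f"
  by (auto simp: kact_def kid_def fun_eq_iff if_distrib[of "\<lambda>a. a * _"] cong: if_cong)

lemma kact_kcomp: "kact (kcomp A B) f = kact A (kact B f)"
proof
  fix x
  have "kact (kcomp A B) f x = (\<Sum>y\<in>UNIV. \<Sum>w\<in>UNIV. A x w * (B w y * f y))"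
    by (simp add: kcomp_def kact_def sum_distrib_right mult.assoc)
  also have "\<dots> = kact A (kact B f) x"
    by (subst sum.swap) (simp add: kact_def sum_distrib_left)
  finally show "kact (kcomp A B) f x = kact A (kact B f) x" .
qed

definition stochastic_kernel :: "('x::finite \<Rightarrow> 'x \<Rightarrow> real) \<Rightarrow> bool" where
  "stochastic_kernel A \<longleftrightarrow> (\<forall>x y. 0 \<le> A x y) \<and> (\<forall>x. (\<Sum>y\<in>UNIV. A x y) = 1)"

lemma stochastic_kernel_kcomp:
  assumes "stochastic_kernel A" "stochastic_kernel B" shows "stochastic_kernel (kcomp A B)"
proof -
  have "(\<Sum>y\<in>UNIV. kcomp A B x y) = 1" for x
    unfolding kcomp_def using assms
    by (subst sum.swap) (simp add: stochastic_kernel_def sum_distrib_left[symmetric])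
  thus ?thesis using assms by (auto simp: stochastic_kernel_def kcomp_def intro!: sum_nonneg)
qed

lemma kact_mono: "stochastic_kernel A \<Longrightarrow> (\<And>y. f y \<le> g y) \<Longrightarrow> kact A f x \<le> kact A g x"
  unfolding kact_def stochastic_kernel_def by (intro sum_mono mult_left_mono) auto

lemma kact_add_const: "stochastic_kernel A \<Longrightarrow> kact A (\<lambda>y. f y + k) x = kact A f x + k"
  by (simp add: kact_def stochastic_kernel_def distrib_left sum.distrib sum_distrib_right[symmetric])

lemma kact_uminus: "kact A (\<lambda>y. - f y) x = - kact A f x"
  by (simp add: kact_def sum_negf)

lemma kact_eqD:
  assumes "\<And>f x. kact A f x = kact B f x" shows "A = B"
proof (intro ext)
  fix x y
  have "kact A (\<lambda>z. kid z y) x = A x y" for A :: "'a \<Rightarrow> 'a \<Rightarrow> real"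
    by (simp add: kact_def kid_def if_distrib[of "\<lambda>a. _ * a"] cong: if_cong)
  with assms[of "\<lambda>z. kid z y" x] show "A x y = B x y" by simp
qed

lemma lower_rate_singleton: "lower_rate {Q} f x = (\<Sum>y\<in>UNIV. Q $ x $ y * f y)"
  by (simp add: lower_rate_def)

text \<open>This is the matrix exponential of \<open>(r - t) * Q\<close>. Writing it as the lower
  semigroup of a singleton makes the estimates of \<open>rate_set\<close> available for it.\<close>

definition homogeneous :: "real^'x^('x::finite) \<Rightarrow> real \<Rightarrow> real \<Rightarrow> 'x \<Rightarrow> 'x \<Rightarrow> real" where
  "homogeneous Q t r x y = rate_set.lower_trans {Q} (r - t) (\<lambda>z. kid z y) x"

context rate_set
begin

text \<open>Genuine one-sided limits are demanded instead of limit points. The left and right rate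
  matrices are separate because they may differ at a time where the policy switches.\<close>

definition transition_family :: "(real \<Rightarrow> real \<Rightarrow> 'x \<Rightarrow> 'x \<Rightarrow> real) \<Rightarrow> bool" where
  "transition_family T \<longleftrightarrow>
     (\<forall>t r. 0 \<le> t \<longrightarrow> t \<le> r \<longrightarrow> stochastic_kernel (T t r)) \<and>
     (\<forall>t. 0 \<le> t \<longrightarrow> T t t = kid) \<and>
     (\<forall>t v r. 0 \<le> t \<longrightarrow> t \<le> v \<longrightarrow> v \<le> r \<longrightarrow> T t r = kcomp (T t v) (T v r)) \<and>
     (\<forall>t. 0 \<le> t \<longrightarrow> (\<exists>Q\<in>\<Q>. \<forall>x y. ((\<lambda>\<Delta>. (T t (t + \<Delta>) x y - kid x y) / \<Delta>) \<longlongrightarrow> Q $ x $ y) (at_right 0))) \<and>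
     (\<forall>t. 0 < t \<longrightarrow> (\<exists>Q\<in>\<Q>. \<forall>x y. ((\<lambda>\<Delta>. (T (t - \<Delta>) t x y - kid x y) / \<Delta>) \<longlongrightarrow> Q $ x $ y) (at_right 0)))"

lemma transition_familyD:
  assumes "transition_family T"
  shows "0 \<le> t \<Longrightarrow> t \<le> r \<Longrightarrow> stochastic_kernel (T t r)"
    and "0 \<le> t \<Longrightarrow> T t t = kid"
    and "0 \<le> t \<Longrightarrow> t \<le> v \<Longrightarrow> v \<le> r \<Longrightarrow> T t r = kcomp (T t v) (T v r)"
    and "0 \<le> t \<Longrightarrow> \<exists>Q\<in>\<Q>. \<forall>x y. ((\<lambda>\<Delta>. (T t (t + \<Delta>) x y - kid x y) / \<Delta>) \<longlongrightarrow> Q $ x $ y) (at_right 0)"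
    and "0 < t \<Longrightarrow> \<exists>Q\<in>\<Q>. \<forall>x y. ((\<lambda>\<Delta>. (T (t - \<Delta>) t x y - kid x y) / \<Delta>) \<longlongrightarrow> Q $ x $ y) (at_right 0)"
  using assms unfolding transition_family_def by blast+

lemma rate_set_singleton: "Q \<in> \<Q> \<Longrightarrow> rate_set {Q} c"
  using rate diag_bound by unfold_locales auto

text \<open>For a singleton the Euler steps are linear, hence so is their limit, and it is
  determined by its values on the indicator functions \<open>\<lambda>z. kid z y\<close>.\<close>

lemma kact_homogeneous:
  assumes Q: "Q \<in> \<Q>" and tr: "t \<le> r"
  shows "kact (homogeneous Q t r) f x = rate_set.lower_trans {Q} (r - t) f x"
proof -
  interpret q: rate_set "{Q}" c using rate_set_singleton[OF Q] .
  have lin: "q.euler d n (\<lambda>z. a * f z + g z) = (\<lambda>z. a * q.euler d n f z + q.euler d n g z)" for d n a f g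
  proof (induction n)
    case (Suc n)
    show ?case
      by (rule ext, simp only: q.euler_Suc Suc lower_rate_singleton)
        (simp add: algebra_simps sum.distrib sum_distrib_left)
  qed simp
  have sglin: "q.lower_trans (r - t) (\<lambda>z. a * f z + g z) x = a * q.lower_trans (r - t) f x + q.lower_trans (r - t) g x" for a f g
  proof (rule LIMSEQ_unique[OF q.euler_tendsto_lower_trans])
    show "(\<lambda>n. q.euler ((r - t) / real n) n (\<lambda>z. a * f z + g z) x) \<longlonglongrightarrow> a * q.lower_trans (r - t) f x + q.lower_trans (r - t) g x"
      unfolding lin using tr by (intro tendsto_intros q.euler_tendsto_lower_trans) auto
  qed (use tr in simp)
  have "q.lower_trans (r - t) (\<lambda>z. \<Sum>y\<in>S. f y * kid z y) x = (\<Sum>y\<in>S. f y * q.lower_trans (r - t) (\<lambda>z. kid z y) x)"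
    if "finite S" for S
    using that by induction (use tr in \<open>auto simp: sglin q.lower_trans_const\<close>)
  from this[of UNIV] show ?thesis
    by (simp add: kact_def homogeneous_def kid_def mult.commute[of _ "f _"] if_distrib[of "\<lambda>a. _ * a"] cong: if_cong)
qed

lemma transition_family_homogeneous:
  assumes Q: "Q \<in> \<Q>" shows "transition_family (homogeneous Q)"
proof -
  interpret q: rate_set "{Q}" c using rate_set_singleton[OF Q] .
  have stoch: "stochastic_kernel (homogeneous Q t r)" if tr: "t \<le> r" for t r
  proof -
    have "0 \<le> homogeneous Q t r x y" for x y
      using q.lower_trans_mono[of "r - t" "\<lambda>_. 0" "\<lambda>z. kid z y" x] tr by (simp add: homogeneous_def kid_def q.lower_trans_const)
    moreover have "(\<Sum>y\<in>UNIV. homogeneous Q t r x y) = 1" for x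
      using kact_homogeneous[OF Q tr, of "\<lambda>_. 1" x] tr by (simp add: kact_def q.lower_trans_const)
    ultimately show ?thesis by (simp add: stochastic_kernel_def)
  qed
  have CK: "homogeneous Q t r = kcomp (homogeneous Q t v) (homogeneous Q v r)" if "t \<le> v" "v \<le> r" for t v r
  proof (rule kact_eqD)
    fix f x
    have "kact (homogeneous Q v r) f = q.lower_trans (r - v) f" using that Q by (auto simp: kact_homogeneous)
    thus "kact (homogeneous Q t r) f x = kact (kcomp (homogeneous Q t v) (homogeneous Q v r)) f x"
      using that Q q.lower_trans_semigroup[of "v - t" "r - v" f] by (simp add: kact_homogeneous kact_kcomp)
  qed
  have lim: "((\<lambda>\<Delta>. (q.lower_trans \<Delta> (\<lambda>z. kid z y) x - kid x y) / \<Delta>) \<longlongrightarrow> Q $ x $ y) (at_right 0)" for x y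
  proof (rule LIM_zero_cancel, rule Lim_null_comparison)
    show "((\<lambda>\<Delta>. \<Delta> * (2 * c)\<^sup>2) \<longlongrightarrow> 0) (at_right 0)"
      using tendsto_mult_right[OF tendsto_ident_at, of "(2 * c)\<^sup>2" 0 "{0<..}"] by simp
    have "((\<lambda>\<Delta>. \<Delta> * c) \<longlongrightarrow> 0) (at_right 0)"
      using tendsto_mult_right[OF tendsto_ident_at, of c 0 "{0<..}"] by simp
    hence "\<forall>\<^sub>F \<Delta> in at_right 0. \<Delta> * c < 1" by (rule order_tendstoD) simp
    thus "\<forall>\<^sub>F \<Delta> in at_right 0. norm ((q.lower_trans \<Delta> (\<lambda>z. kid z y) x - kid x y) / \<Delta> - Q $ x $ y) \<le> \<Delta> * (2 * c)\<^sup>2"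
      using eventually_at_right_less[of 0]
    proof eventually_elim
      case (elim \<Delta>)
      have "\<bar>q.lower_trans \<Delta> (\<lambda>z. kid z y) x - (kid x y + \<Delta> * lower_rate {Q} (\<lambda>z. kid z y) x)\<bar> \<le> \<Delta>\<^sup>2 * ((2 * c)\<^sup>2 * 1)"
        using elim by (intro q.lower_trans_first_order) (auto simp: kid_def)
      moreover have "lower_rate {Q} (\<lambda>z. kid z y) x = Q $ x $ y"
        by (simp add: lower_rate_singleton kid_def if_distrib[of "\<lambda>a. _ * a"] cong: if_cong)
      moreover have "q.lower_trans \<Delta> (\<lambda>z. kid z y) x - (kid x y + \<Delta> * Q $ x $ y) =
          \<Delta> * ((q.lower_trans \<Delta> (\<lambda>z. kid z y) x - kid x y) / \<Delta> - Q $ x $ y)"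
        using elim by (simp add: field_simps)
      ultimately have "\<Delta> * \<bar>(q.lower_trans \<Delta> (\<lambda>z. kid z y) x - kid x y) / \<Delta> - Q $ x $ y\<bar> \<le> \<Delta> * (\<Delta> * (2 * c)\<^sup>2)"
        using elim by (simp add: abs_mult power2_eq_square ac_simps)
      thus ?case using elim by simp
    qed
  qed
  have "homogeneous Q t t = kid" for t
    by (auto simp: homogeneous_def fun_eq_iff)
  moreover have "\<forall>x y. ((\<lambda>\<Delta>. (homogeneous Q t (t + \<Delta>) x y - kid x y) / \<Delta>) \<longlongrightarrow> Q $ x $ y) (at_right 0)" for t
    using lim by (simp add: homogeneous_def)
  moreover have "\<forall>x y. ((\<lambda>\<Delta>. (homogeneous Q (t - \<Delta>) t x y - kid x y) / \<Delta>) \<longlongrightarrow> Q $ x $ y) (at_right 0)" for t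
    using lim by (simp add: homogeneous_def)
  ultimately show ?thesis
    unfolding transition_family_def using stoch CK Q by blast
qed

definition concat_at :: "real \<Rightarrow> (real \<Rightarrow> real \<Rightarrow> 'x \<Rightarrow> 'x \<Rightarrow> real) \<Rightarrow> (real \<Rightarrow> real \<Rightarrow> 'x \<Rightarrow> 'x \<Rightarrow> real)
    \<Rightarrow> real \<Rightarrow> real \<Rightarrow> 'x \<Rightarrow> 'x \<Rightarrow> real" where
  "concat_at a T U t r = (if r \<le> a then T t r else if a \<le> t then U t r else kcomp (T t a) (U a r))"

text \<open>The cases overlap when \<open>t\<close> or \<open>r\<close> equals \<open>a\<close>;
  they agree there because both families are \<open>kid\<close> on an interval of length
  zero.\<close>

lemma concat_at_simps:
  assumes "transition_family T" "transition_family U" "0 \<le> a" "t \<le> r" "0 \<le> t"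
  shows "r \<le> a \<Longrightarrow> concat_at a T U t r = T t r"
    and "a \<le> t \<Longrightarrow> concat_at a T U t r = U t r"
    and "t \<le> a \<Longrightarrow> a \<le> r \<Longrightarrow> concat_at a T U t r = kcomp (T t a) (U a r)"
proof -
  note T = transition_familyD[OF assms(1)] and U = transition_familyD[OF assms(2)]
  show "r \<le> a \<Longrightarrow> concat_at a T U t r = T t r" by (simp add: concat_at_def)
  show "a \<le> t \<Longrightarrow> concat_at a T U t r = U t r"
  proof (cases "r \<le> a")
    case True
    moreover assume "a \<le> t"
    ultimately have "r = t" using assms(4) by simp
    thus ?thesis using assms(5) T(2)[of t] U(2)[of t] \<open>a \<le> t\<close> by (auto simp: concat_at_def)
  qed (simp add: concat_at_def)
  show "t \<le> a \<Longrightarrow> a \<le> r \<Longrightarrow> concat_at a T U t r = kcomp (T t a) (U a r)"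
    using assms T(2)[of a] U(2)[of a] by (auto simp: concat_at_def)
qed

lemma transition_family_concat_at:
  assumes "transition_family T" "transition_family U" "0 \<le> a"
  shows "transition_family (concat_at a T U)"
proof -
  note T = transition_familyD[OF assms(1)] and U = transition_familyD[OF assms(2)]
  note cat = concat_at_simps[OF assms]
  have stoch: "stochastic_kernel (concat_at a T U t r)" if "0 \<le> t" "t \<le> r" for t r
    using that T(1) U(1) assms(3) by (auto simp: concat_at_def intro!: stochastic_kernel_kcomp)
  have id: "concat_at a T U t t = kid" if "0 \<le> t" for t
    using that T(2) U(2) by (auto simp: concat_at_def)
  have CK: "concat_at a T U t r = kcomp (concat_at a T U t v) (concat_at a T U v r)"
    if "0 \<le> t" "t \<le> v" "v \<le> r" for t v r
  proof -
    consider "r \<le> a" | "a \<le> t" | "t \<le> a" "a \<le> r" "v \<le> a" | "t \<le> a" "a \<le> r" "a \<le> v" by linarith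
    thus ?thesis
    proof cases
      case 1
      thus ?thesis using that T(3)[of t v r] by (simp add: cat(1))
    next
      case 2
      thus ?thesis using that U(3)[of t v r] by (simp add: cat(2))
    next
      case 3
      thus ?thesis using that T(3)[of t v a] by (simp add: cat(1,3) kcomp_assoc)
    next
      case 4
      thus ?thesis using that assms(3) U(3)[of a v r] by (simp add: cat(2,3) kcomp_assoc)
    qed
  qed
  have right: "\<exists>Q\<in>\<Q>. \<forall>x y. ((\<lambda>\<Delta>. (concat_at a T U t (t + \<Delta>) x y - kid x y) / \<Delta>) \<longlongrightarrow> Q $ x $ y) (at_right 0)"
    if t: "0 \<le> t" for t
  proof (cases "t < a")
    case True
    from T(4)[OF t] obtain Q where Q: "Q \<in> \<Q>"
      "\<And>x y. ((\<lambda>\<Delta>. (T t (t + \<Delta>) x y - kid x y) / \<Delta>) \<longlongrightarrow> Q $ x $ y) (at_right 0)" by blast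
    have "\<forall>\<^sub>F \<Delta> in at_right 0. \<Delta> \<in> {0<..<a - t}" using True by (intro eventually_at_right_real) simp
    hence ev: "\<forall>\<^sub>F \<Delta> in at_right 0. (T t (t + \<Delta>) x y - kid x y) / \<Delta> = (concat_at a T U t (t + \<Delta>) x y - kid x y) / \<Delta>" for x y
      by eventually_elim (use t in \<open>simp add: cat(1)\<close>)
    show ?thesis using Q(1) Lim_transform_eventually[OF Q(2) ev] by blast
  next
    case False
    from U(4)[OF t] obtain Q where Q: "Q \<in> \<Q>"
      "\<And>x y. ((\<lambda>\<Delta>. (U t (t + \<Delta>) x y - kid x y) / \<Delta>) \<longlongrightarrow> Q $ x $ y) (at_right 0)" by blast
    have "\<forall>\<^sub>F \<Delta> in at_right 0. (0::real) < \<Delta>" by (rule eventually_at_right_less)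
    hence ev: "\<forall>\<^sub>F \<Delta> in at_right 0. (U t (t + \<Delta>) x y - kid x y) / \<Delta> = (concat_at a T U t (t + \<Delta>) x y - kid x y) / \<Delta>" for x y
      by eventually_elim (use t False in \<open>simp add: cat(2)\<close>)
    show ?thesis using Q(1) Lim_transform_eventually[OF Q(2) ev] by blast
  qed
  have left: "\<exists>Q\<in>\<Q>. \<forall>x y. ((\<lambda>\<Delta>. (concat_at a T U (t - \<Delta>) t x y - kid x y) / \<Delta>) \<longlongrightarrow> Q $ x $ y) (at_right 0)"
    if t: "0 < t" for t
  proof (cases "t \<le> a")
    case True
    from T(5)[OF t] obtain Q where Q: "Q \<in> \<Q>"
      "\<And>x y. ((\<lambda>\<Delta>. (T (t - \<Delta>) t x y - kid x y) / \<Delta>) \<longlongrightarrow> Q $ x $ y) (at_right 0)" by blast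
    thus ?thesis using True by (auto simp: concat_at_def)
  next
    case False
    from U(5)[OF t] obtain Q where Q: "Q \<in> \<Q>"
      "\<And>x y. ((\<lambda>\<Delta>. (U (t - \<Delta>) t x y - kid x y) / \<Delta>) \<longlongrightarrow> Q $ x $ y) (at_right 0)" by blast
    have "\<forall>\<^sub>F \<Delta> in at_right 0. \<Delta> \<in> {0<..<t - a}" using False by (intro eventually_at_right_real) simp
    hence ev: "\<forall>\<^sub>F \<Delta> in at_right 0. (U (t - \<Delta>) t x y - kid x y) / \<Delta> = (concat_at a T U (t - \<Delta>) t x y - kid x y) / \<Delta>" for x y
      by eventually_elim (use t False assms(3) in \<open>simp add: cat(2)\<close>)
    show ?thesis using Q(1) Lim_transform_eventually[OF Q(2) ev] by blast
  qed
  show ?thesis unfolding transition_family_def using stoch id CK right left by blast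
qed

end

section \<open>Transition families that nearly attain the lower semigroup\<close>

locale separate_rates = rate_set \<Q> c
  for \<Q> :: "(real^'x^('x::finite)) set" and c +
  assumes separate: "separately_specified_rows \<Q>"
begin

lemma rows_in:
  assumes "\<And>x. \<exists>Q'\<in>\<Q>. Q $ x = Q' $ x" shows "Q \<in> \<Q>"
proof -
  have "rate_matrix Q"
    unfolding rate_matrix_def using assms rate unfolding rate_matrix_def by metis
  thus ?thesis using separate assms unfolding separately_specified_rows_def by blast
qed

text \<open>A nearly minimising matrix exists for each state by itself; separately specified rows
  allow the relevant rows to be assembled into one matrix of \<open>\<Q>\<close>.\<close>

lemma lower_rate_near_all:
  assumes "0 < \<eta>"
  obtains Q where "Q \<in> \<Q>" "\<And>x. (\<Sum>y\<in>UNIV. Q $ x $ y * f y) \<le> lower_rate \<Q> f x + \<eta>"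
proof -
  have "\<exists>Q\<in>\<Q>. (\<Sum>y\<in>UNIV. Q $ x $ y * f y) < lower_rate \<Q> f x + \<eta>" for x
    using lower_rate_near[OF assms] by blast
  then obtain q where q: "\<And>x. q x \<in> \<Q>" "\<And>x. (\<Sum>y\<in>UNIV. q x $ x $ y * f y) < lower_rate \<Q> f x + \<eta>"
    by metis
  have "(\<chi> x. q x $ x) \<in> \<Q>" using q(1) by (intro rows_in) auto
  thus thesis using q(2) by (intro that[of "\<chi> x. q x $ x"]) (auto intro: less_imp_le)
qed

text \<open>Dynamic programming: on the first interval use a matrix that is nearly minimising for
  the value \<open>lower_trans (k * d) f\<close> of the rest. Its exponential and the lower
  semigroup both differ from an Euler step by at most
  \<open>d\<^sup>2 * ((2 * c)\<^sup>2 * B)\<close>, hence the factor 2, and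
  \<open>d * \<eta>\<close> pays for the choice of the matrix. The induction prepends an interval,
  so \<open>a\<close> has to vary.\<close>

lemma near_optimal_steps:
  fixes k :: nat and d \<eta> B a :: real
  assumes d: "0 \<le> d" "d * c \<le> 1" and \<eta>: "0 < \<eta>" and B: "\<And>y. \<bar>f y\<bar> \<le> B" and a: "0 \<le> a"
  shows "\<exists>T. transition_family T \<and>
    (\<forall>x. kact (T a (a + k * d)) f x \<le> lower_trans (k * d) f x + k * (d * \<eta> + 2 * (d\<^sup>2 * ((2 * c)\<^sup>2 * B))))"
  using a
proof (induction k arbitrary: a)
  case 0
  obtain Q where "Q \<in> \<Q>" using nonempty by blast
  hence "transition_family (homogeneous Q)" by (rule transition_family_homogeneous)
  thus ?case using 0 transition_familyD(2)[of "homogeneous Q" a] by (intro exI[of _ "homogeneous Q"]) simp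
next
  case (Suc k)
  define e where "e = d * \<eta> + 2 * (d\<^sup>2 * ((2 * c)\<^sup>2 * B))"
  obtain T where T: "transition_family T" "\<And>x. kact (T (a + d) (a + d + k * d)) f x \<le> lower_trans (k * d) f x + k * e"
    using Suc.IH[of "a + d"] Suc.prems d by (auto simp: e_def)
  let ?g = "lower_trans (k * d) f"
  obtain Q where Q: "Q \<in> \<Q>" "\<And>x. (\<Sum>y\<in>UNIV. Q $ x $ y * ?g y) \<le> lower_rate \<Q> ?g x + \<eta>"
    using lower_rate_near_all[OF \<eta>] by blast
  interpret q: rate_set "{Q}" c using rate_set_singleton[OF Q(1)] .
  note H = transition_family_homogeneous[OF Q(1)]
  let ?T = "concat_at (a + d) (homogeneous Q) T"
  have gB: "\<bar>?g y\<bar> \<le> B" for y using d B by (intro lower_trans_bound) auto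
  have "kact (?T a (a + Suc k * d)) f x \<le> lower_trans (Suc k * d) f x + Suc k * e" for x
  proof -
    have "?T a (a + Suc k * d) = kcomp (homogeneous Q a (a + d)) (T (a + d) (a + d + k * d))"
      using Suc.prems d H T(1) by (subst concat_at_simps) (auto simp: algebra_simps)
    hence "kact (?T a (a + Suc k * d)) f x = kact (homogeneous Q a (a + d)) (kact (T (a + d) (a + d + k * d)) f) x"
      by (simp add: kact_kcomp)
    also have "\<dots> \<le> kact (homogeneous Q a (a + d)) (\<lambda>y. ?g y + k * e) x"
      using transition_familyD(1)[OF H, of a "a + d"] Suc.prems d T(2) by (intro kact_mono) auto
    also have "\<dots> = q.lower_trans d ?g x + k * e"
      using transition_familyD(1)[OF H, of a "a + d"] Suc.prems d Q(1)
      by (simp add: kact_add_const kact_homogeneous)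
    finally have 1: "kact (?T a (a + Suc k * d)) f x \<le> q.lower_trans d ?g x + k * e" .
    have "\<bar>q.lower_trans d ?g x - (?g x + d * (\<Sum>y\<in>UNIV. Q $ x $ y * ?g y))\<bar> \<le> d\<^sup>2 * ((2 * c)\<^sup>2 * B)"
      using q.lower_trans_first_order[of d ?g B x] d gB by (simp add: lower_rate_singleton)
    moreover have "\<bar>lower_trans d ?g x - (?g x + d * lower_rate \<Q> ?g x)\<bar> \<le> d\<^sup>2 * ((2 * c)\<^sup>2 * B)"
      using lower_trans_first_order[of d ?g B x] d gB by simp
    moreover have "d * (\<Sum>y\<in>UNIV. Q $ x $ y * ?g y) \<le> d * (lower_rate \<Q> ?g x + \<eta>)"
      using Q(2) d by (intro mult_left_mono)
    moreover have "lower_trans d ?g x = lower_trans (Suc k * d) f x"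
      using lower_trans_semigroup[of d "k * d" f] d by (simp add: distrib_right)
    moreover have "d * (lower_rate \<Q> ?g x + \<eta>) = d * lower_rate \<Q> ?g x + d * \<eta>" by (rule distrib_left)
    moreover have "Suc k * e = e + k * e" by (simp add: distrib_right)
    ultimately show ?thesis using 1 e_def by linarith
  qed
  moreover have "transition_family ?T" using H T(1) Suc.prems d by (intro transition_family_concat_at) auto
  ultimately show ?case unfolding e_def by blast
qed

lemma near_optimal_interval:
  assumes "0 \<le> a" "a \<le> b" "0 < \<eta>"
  shows "\<exists>T. transition_family T \<and> (\<forall>x. kact (T a b) f x \<le> lower_trans (b - a) f x + \<eta>)"
proof -
  obtain B where B: "\<And>y. \<bar>f y\<bar> \<le> B" using bounded_function by blast
  define l where "l = b - a"
  \<comment> \<open>Half of \<eta> is spent on the choice of the matrices over the whole length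
    \<open>l\<close>, the other half on the discretisation, which a large \<open>n\<close> makes
    small. The \<open>+ 1\<close> covers \<open>l = 0\<close>.\<close>
  define \<eta>' where "\<eta>' = \<eta> / (2 * (l + 1))"
  have l: "0 \<le> l" using assms by (simp add: l_def)
  have \<eta>': "0 < \<eta>'" using assms l by (simp add: \<eta>'_def)
  have "l * \<eta>' = \<eta> / 2 * (l / (l + 1))" using l by (simp add: \<eta>'_def)
  also have "\<dots> \<le> \<eta> / 2 * 1" using l assms by (intro mult_left_mono) auto
  finally have half: "l * \<eta>' \<le> \<eta> / 2" by simp
  have "(\<lambda>n. 2 * (l\<^sup>2 * ((2 * c)\<^sup>2 * B)) / real n) \<longlonglongrightarrow> 0" by (rule lim_const_over_n)
  hence "\<forall>\<^sub>F n in sequentially. 2 * (l\<^sup>2 * ((2 * c)\<^sup>2 * B)) / real n < \<eta> / 2"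
    by (rule order_tendstoD) (use assms in simp)
  with eventually_small_step[of l] eventually_gt_at_top[of 0]
  have "\<forall>\<^sub>F n in sequentially. 2 * (l\<^sup>2 * ((2 * c)\<^sup>2 * B)) / real n < \<eta> / 2 \<and> l / real n * c \<le> 1 \<and> 0 < n"
    by eventually_elim auto
  then obtain n where n: "2 * (l\<^sup>2 * ((2 * c)\<^sup>2 * B)) / real n < \<eta> / 2" "l / real n * c \<le> 1" "0 < n"
    using eventually_happens'[OF sequentially_bot] by blast
  obtain T where T: "transition_family T" "\<And>x. kact (T a (a + n * (l / n))) f x \<le>
      lower_trans (n * (l / n)) f x + n * (l / n * \<eta>' + 2 * ((l / n)\<^sup>2 * ((2 * c)\<^sup>2 * B)))"
    using near_optimal_steps[of "l / n" \<eta>' f B a n] assms l n B \<eta>' by auto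
  have "n * (l / n * \<eta>' + 2 * ((l / n)\<^sup>2 * ((2 * c)\<^sup>2 * B))) = l * \<eta>' + 2 * (l\<^sup>2 * ((2 * c)\<^sup>2 * B)) / n"
    using n by (simp add: field_simps power2_eq_square)
  moreover have "n * (l / n) = l" "a + l = b" using n by (simp_all add: l_def)
  ultimately have "kact (T a b) f x \<le> lower_trans l f x + (l * \<eta>' + 2 * (l\<^sup>2 * ((2 * c)\<^sup>2 * B)) / n)" for x
    using T(2)[of x] by simp
  hence "kact (T a b) f x \<le> lower_trans (b - a) f x + \<eta>" for x
    using n(1) half by (simp only: l_def[symmetric]) (meson add_left_mono add_mono less_imp_le order_trans field_sum_of_halves[THEN eq_refl])
  thus ?thesis using T(1) by blast
qed

lemma near_optimal_grid:
  fixes \<sigma> :: "nat \<Rightarrow> real" and F :: "nat \<Rightarrow> 'x \<Rightarrow> real"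
  assumes "0 < \<eta>" "0 \<le> \<sigma> 0" "\<And>i. i < m \<Longrightarrow> \<sigma> i \<le> \<sigma> (Suc i)"
  shows "\<exists>T. transition_family T \<and>
    (\<forall>i<m. \<forall>x. kact (T (\<sigma> i) (\<sigma> (Suc i))) (F i) x \<le> lower_trans (\<sigma> (Suc i) - \<sigma> i) (F i) x + \<eta>)"
  using assms(3)
proof (induction m)
  case 0
  obtain Q where "Q \<in> \<Q>" using nonempty by blast
  thus ?case using transition_family_homogeneous by auto
next
  case (Suc m)
  have mono: "\<sigma> i \<le> \<sigma> j" if "i \<le> j" "j \<le> Suc m" for i j
    using that
  proof (induction j)
    case (Suc j)
    thus ?case using Suc.prems(1) \<open>\<And>i. i < Suc m \<Longrightarrow> \<sigma> i \<le> \<sigma> (Suc i)\<close>[of j] by (cases "i = Suc j") auto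
  qed simp
  have pos: "0 \<le> \<sigma> i" if "i \<le> Suc m" for i using mono[of 0 i] that assms(2) by simp
  obtain T where T: "transition_family T"
    "\<And>i x. i < m \<Longrightarrow> kact (T (\<sigma> i) (\<sigma> (Suc i))) (F i) x \<le> lower_trans (\<sigma> (Suc i) - \<sigma> i) (F i) x + \<eta>"
    using Suc.IH Suc.prems by auto
  obtain U where U: "transition_family U"
    "\<And>x. kact (U (\<sigma> m) (\<sigma> (Suc m))) (F m) x \<le> lower_trans (\<sigma> (Suc m) - \<sigma> m) (F m) x + \<eta>"
    using near_optimal_interval[OF pos[of m] mono[of m "Suc m"] assms(1)] by auto
  let ?T = "concat_at (\<sigma> m) T U"
  have "kact (?T (\<sigma> i) (\<sigma> (Suc i))) (F i) x \<le> lower_trans (\<sigma> (Suc i) - \<sigma> i) (F i) x + \<eta>" if "i < Suc m" for i x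
  proof (cases "i = m")
    case True
    thus ?thesis using U(2) concat_at_simps(2)[OF T(1) U(1) pos[of m] mono[of m "Suc m"]] pos[of m] by simp
  next
    case False
    hence "?T (\<sigma> i) (\<sigma> (Suc i)) = T (\<sigma> i) (\<sigma> (Suc i))"
      using that mono[of "Suc i" m] by (simp add: concat_at_def)
    thus ?thesis using T(2)[of i x] that False by simp
  qed
  moreover have "transition_family ?T" using T(1) U(1) pos[of m] by (intro transition_family_concat_at) auto
  ultimately show ?case by blast
qed

end

subsection \<open>Full conditional probabilities as limits\<close>

text \<open>Tychonoff's theorem for a power of \<open>[0, 1]\<close>; the finer filter
  \<open>G\<close> plays the role of a convergent subnet.\<close>

lemma pointwise_cluster:
  fixes f :: "'i \<Rightarrow> 'k \<Rightarrow> real"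
  assumes "F \<noteq> bot" and f: "\<And>i k. 0 \<le> f i k \<and> f i k \<le> 1"
  obtains G R where "G \<noteq> bot" "G \<le> F" "\<And>k. ((\<lambda>i. f i k) \<longlongrightarrow> R k) G"
proof -
  have "compactin (product_topology (\<lambda>_. euclideanreal) (UNIV :: 'k set)) (PiE UNIV (\<lambda>_. {0..1}))"
    by (simp add: compactin_PiE)
  hence comp: "compact (PiE UNIV (\<lambda>_. {0..1}) :: ('k \<Rightarrow> real) set)"
    by (simp add: euclidean_product_topology)
  have "filtermap f F \<noteq> bot" using assms(1) by (simp add: filtermap_bot_iff)
  moreover have "eventually (\<lambda>g. g \<in> PiE UNIV (\<lambda>_. {0..1})) (filtermap f F)"
    unfolding eventually_filtermap by (rule always_eventually) (use f in auto)
  ultimately obtain R where R: "inf (nhds R) (filtermap f F) \<noteq> bot"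
    using comp unfolding compact_filter by blast
  \<comment> \<open>Pulling back the neighbourhoods of the cluster point refines \<open>F\<close>
    just enough to force convergence, and the cluster property says that this refinement is
    proper.\<close>
  define G where "G = inf F (filtercomap f (nhds R))"
  have "G \<noteq> bot"
  proof
    assume "G = bot"
    hence "eventually (\<lambda>_. False) (inf F (filtercomap f (nhds R)))" by (simp add: G_def)
    then obtain P Q where "eventually P F" "eventually Q (filtercomap f (nhds R))" "\<And>i. P i \<Longrightarrow> \<not> Q i"
      unfolding eventually_inf by auto
    then obtain Q' where Q': "eventually Q' (nhds R)" "\<And>i. P i \<Longrightarrow> \<not> Q' (f i)"
      unfolding eventually_filtercomap by blast
    have "eventually (\<lambda>g. \<not> Q' g) (filtermap f F)"
      unfolding eventually_filtermap using \<open>eventually P F\<close> by eventually_elim (use Q' in blast)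
    hence "eventually (\<lambda>_. False) (inf (nhds R) (filtermap f F))"
      unfolding eventually_inf using Q'(1) by blast
    thus False using R by (simp add: trivial_limit_def)
  qed
  moreover have "G \<le> F" by (simp add: G_def)
  moreover have "((\<lambda>i. f i k) \<longlongrightarrow> R k) G" for k
  proof -
    have "filterlim f (nhds R) (filtercomap f (nhds R))" by (rule filterlim_filtercomap)
    hence lim: "(f \<longlongrightarrow> R) G" unfolding G_def by (rule filterlim_mono) auto
    show ?thesis
    proof (rule topological_tendstoI)
      fix S :: "real set" assume S: "open S" "R k \<in> S"
      have "open ((\<lambda>g :: 'k \<Rightarrow> real. g k) -` S)"
        by (rule open_vimage[OF S(1) continuous_on_product_coordinates])
      from topological_tendstoD[OF lim this] S(2) show "\<forall>\<^sub>F i in G. f i k \<in> S" by simp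
    qed
  qed
  ultimately show thesis by (rule that)
qed

text \<open>Normalised finitely additive masses satisfy the axioms whenever the conditioning event
  has positive mass. Every nonempty event contains a point, so this holds eventually, and each axiom
  is a closed condition on finitely many values, so it survives in the limit.\<close>

lemma full_cond_prob_limit:
  fixes m :: "'i \<Rightarrow> 'w set \<Rightarrow> real"
  assumes F: "F \<noteq> bot"
    and nonneg: "\<And>i A. A \<subseteq> W \<Longrightarrow> 0 \<le> m i A"
    and add: "\<And>i A B. A \<subseteq> W \<Longrightarrow> B \<subseteq> W \<Longrightarrow> A \<inter> B = {} \<Longrightarrow> m i (A \<union> B) = m i A + m i B"
    and pos: "\<And>\<omega>. \<omega> \<in> W \<Longrightarrow> \<forall>\<^sub>F i in F. 0 < m i {\<omega>}"
  obtains R G where "G \<noteq> bot" "G \<le> F" "full_cond_prob R W"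
    "\<And>A C. A \<subseteq> W \<Longrightarrow> C \<subseteq> W \<Longrightarrow> ((\<lambda>i. m i (A \<inter> C) / m i C) \<longlongrightarrow> R (A, C)) G"
proof -
  have mono: "m i A \<le> m i B" if "A \<subseteq> B" "B \<subseteq> W" for i A B
  proof -
    have "A \<subseteq> W" "B - A \<subseteq> W" "A \<union> (B - A) = B" using that by auto
    thus ?thesis using add[of A "B - A" i] nonneg[of "B - A" i] by simp
  qed
  \<comment> \<open>Where the denominator vanishes the quotient is 0, so the values lie in
    \<open>[0, 1]\<close> for every index and not only eventually.\<close>
  define f where "f i z = (if fst z \<subseteq> W \<and> snd z \<subseteq> W then m i (fst z \<inter> snd z) / m i (snd z) else 0)" for i z
  have "0 \<le> f i z \<and> f i z \<le> 1" for i z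
  proof (cases "fst z \<subseteq> W \<and> snd z \<subseteq> W")
    case True
    hence "0 \<le> m i (fst z \<inter> snd z)" "m i (fst z \<inter> snd z) \<le> m i (snd z)"
      by (auto intro!: nonneg mono)
    thus ?thesis using True by (auto simp: f_def divide_le_eq_1)
  qed (auto simp: f_def)
  then obtain G R where G: "G \<noteq> bot" "G \<le> F" "\<And>z. ((\<lambda>i. f i z) \<longlongrightarrow> R z) G"
    using pointwise_cluster[OF F] by metis
  have R: "((\<lambda>i. m i (A \<inter> C) / m i C) \<longlongrightarrow> R (A, C)) G" if "A \<subseteq> W" "C \<subseteq> W" for A C
    using G(3)[of "(A, C)"] that by (simp add: f_def)
  have ev_pos: "\<forall>\<^sub>F i in G. 0 < m i C" if C: "C \<subseteq> W" "C \<noteq> {}" for C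
  proof -
    obtain \<omega> where "\<omega> \<in> C" using C by blast
    hence "\<forall>\<^sub>F i in F. 0 < m i {\<omega>}" using pos C by blast
    hence "\<forall>\<^sub>F i in G. 0 < m i {\<omega>}" using G(2) by (rule filter_leD[rotated])
    thus ?thesis
    proof eventually_elim
      case (elim i)
      thus ?case using mono[of "{\<omega>}" C i] C \<open>\<omega> \<in> C\<close> by simp
    qed
  qed
  have n1: "0 \<le> R (A, C)" if "A \<subseteq> W" "C \<subseteq> W" for A C
  proof (rule tendsto_lowerbound[OF R[OF that] _ G(1)])
    show "\<forall>\<^sub>F i in G. 0 \<le> m i (A \<inter> C) / m i C"
    proof (intro always_eventually allI divide_nonneg_nonneg nonneg)
    qed (use that in auto)
  qed
  have n2: "R (A, C) = 1" if "A \<subseteq> W" "C \<subseteq> W" "C \<noteq> {}" "C \<subseteq> A" for A C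
  proof -
    have "\<forall>\<^sub>F i in G. m i (A \<inter> C) / m i C = 1"
      using ev_pos[OF that(2,3)] by eventually_elim (use that in \<open>simp add: Int_absorb1\<close>)
    hence "((\<lambda>i. m i (A \<inter> C) / m i C) \<longlongrightarrow> 1) G" by (rule tendsto_eventually)
    thus ?thesis by (rule tendsto_unique[OF G(1) R[OF that(1,2)]])
  qed
  have n3: "R (A \<union> B, C) = R (A, C) + R (B, C)"
    if "A \<subseteq> W" "B \<subseteq> W" "C \<subseteq> W" "A \<inter> B = {}" for A B C
  proof (rule tendsto_unique[OF G(1) R])
    have "m i ((A \<union> B) \<inter> C) / m i C = m i (A \<inter> C) / m i C + m i (B \<inter> C) / m i C" for i
    proof -
      have "A \<inter> C \<subseteq> W" "B \<inter> C \<subseteq> W" "A \<inter> C \<inter> (B \<inter> C) = {}" using that by auto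
      from add[OF this, of i] show ?thesis by (simp add: Int_Un_distrib2 add_divide_distrib)
    qed
    thus "((\<lambda>i. m i ((A \<union> B) \<inter> C) / m i C) \<longlongrightarrow> R (A, C) + R (B, C)) G"
      using tendsto_add[OF R[of A C] R[of B C]] that by simp
  qed (use that in auto)
  have n4: "R (A \<inter> D, C) = R (A, D \<inter> C) * R (D, C)"
    if "A \<subseteq> W" "D \<subseteq> W" "C \<subseteq> W" "D \<inter> C \<noteq> {}" for A D C
  proof (rule tendsto_unique[OF G(1) R])
    have "\<forall>\<^sub>F i in G. m i (A \<inter> (D \<inter> C)) / m i (D \<inter> C) * (m i (D \<inter> C) / m i C) = m i (A \<inter> D \<inter> C) / m i C"
    proof -
      have "D \<inter> C \<subseteq> W" using that by auto
      from ev_pos[OF this that(4)] show ?thesis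
        by eventually_elim (simp add: Int_assoc)
    qed
    moreover have "((\<lambda>i. m i (A \<inter> (D \<inter> C)) / m i (D \<inter> C) * (m i (D \<inter> C) / m i C)) \<longlongrightarrow> R (A, D \<inter> C) * R (D, C)) G"
      using that by (intro tendsto_mult R) auto
    ultimately show "((\<lambda>i. m i (A \<inter> D \<inter> C) / m i C) \<longlongrightarrow> R (A, D \<inter> C) * R (D, C)) G"
      by (rule Lim_transform_eventually[rotated])
  qed (use that in auto)
  have "full_cond_prob R W"
    unfolding full_cond_prob_def by (intro conjI allI impI) (elim conjE, rule n1 n2 n3 n4; assumption)+
  from that[OF G(1,2) this R] show thesis .
qed

subsection \<open>Resampling a path at finitely many times\<close>

text \<open>The expectation of \<open>G\<close> at the path obtained from \<open>x\<close> by redrawing its values at the times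
  \<open>ws\<close> in turn; \<open>k a w x y\<close> is the probability of the value \<open>y\<close> at time \<open>w\<close>, where \<open>a\<close> is the
  preceding time.\<close>

fun resample :: "(real \<Rightarrow> real \<Rightarrow> (real \<Rightarrow> 'x::finite) \<Rightarrow> 'x \<Rightarrow> real) \<Rightarrow> real \<Rightarrow> real list
    \<Rightarrow> (real \<Rightarrow> 'x) \<Rightarrow> ((real \<Rightarrow> 'x) \<Rightarrow> real) \<Rightarrow> real" where
  "resample k a [] x G = G x"
| "resample k a (w # ws) x G = (\<Sum>y\<in>UNIV. k a w x y * resample k w ws (x(w := y)) G)"

lemma resample_append:
  "resample k a (vs @ ws) x G = resample k a vs x (\<lambda>x'. resample k (last (a # vs)) ws x' G)"
  by (induction vs arbitrary: a x) auto

lemma resample_add: "resample k a ws x (\<lambda>\<omega>. G \<omega> + H \<omega>) = resample k a ws x G + resample k a ws x H"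
  by (induction ws arbitrary: a x) (auto simp: distrib_left sum.distrib)

lemma resample_scale: "resample k a ws x (\<lambda>\<omega>. b * G \<omega>) = b * resample k a ws x G"
  by (induction ws arbitrary: a x) (auto simp: sum_distrib_left mult.left_commute)

locale positive_kernel =
  fixes k :: "real \<Rightarrow> real \<Rightarrow> (real \<Rightarrow> 'x::finite) \<Rightarrow> 'x \<Rightarrow> real"
  assumes kpos: "0 < k a w x y" and ksum: "(\<Sum>y\<in>UNIV. k a w x y) = 1"
begin

lemma resample_mono:
  "(\<And>\<omega>. (\<And>t. t \<notin> set ws \<Longrightarrow> \<omega> t = x t) \<Longrightarrow> G \<omega> \<le> H \<omega>) \<Longrightarrow> resample k a ws x G \<le> resample k a ws x H"
proof (induction ws arbitrary: a x)
  case (Cons w ws)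
  have "resample k w ws (x(w := y)) G \<le> resample k w ws (x(w := y)) H" for y
    by (rule Cons.IH, rule Cons.prems) auto
  thus ?case unfolding resample.simps by (intro sum_mono mult_left_mono less_imp_le[OF kpos])
qed simp

lemma resample_cong:
  assumes "\<And>\<omega>. (\<And>t. t \<notin> set ws \<Longrightarrow> \<omega> t = x t) \<Longrightarrow> G \<omega> = H \<omega>"
  shows "resample k a ws x G = resample k a ws x H"
  by (intro antisym resample_mono) (simp_all add: assms)

lemma resample_const: "resample k a ws x (\<lambda>_. b) = b"
  by (induction ws arbitrary: a x) (auto simp: ksum sum_distrib_right[symmetric])

lemma resample_local:
  assumes "\<And>\<omega>. (\<And>t. t \<notin> set ws \<Longrightarrow> \<omega> t = x t) \<Longrightarrow> G \<omega> = G x"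
  shows "resample k a ws x G = G x"
proof -
  have "resample k a ws x G = resample k a ws x (\<lambda>_. G x)"
    by (rule resample_cong, rule assms)
  thus ?thesis by (simp add: resample_const)
qed

lemma resample_nonneg: "(\<And>\<omega>. 0 \<le> G \<omega>) \<Longrightarrow> 0 \<le> resample k a ws x G"
  using resample_mono[of ws x "\<lambda>_. 0" G a] by (simp add: resample_const)

text \<open>Each redraw reproduces the old value with positive probability, so the starting path
  itself keeps positive weight.\<close>

lemma resample_pos: "(\<And>\<omega>. 0 \<le> G \<omega>) \<Longrightarrow> 0 < G x \<Longrightarrow> 0 < resample k a ws x G"
proof (induction ws arbitrary: a x)
  case (Cons w ws)
  have "0 < k a w x (x w) * resample k w ws (x(w := x w)) G"
    using Cons kpos by (intro mult_pos_pos) auto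
  thus ?case using Cons.prems kpos
    by (auto intro!: sum_pos2[of _ "x w"] mult_nonneg_nonneg less_imp_le[OF kpos] resample_nonneg)
qed simp

end

subsection \<open>A full conditional probability with prescribed transitions\<close>

text \<open>The transitions after time \<open>s\<close> may depend on the state at time \<open>s\<close>, the first argument of
  \<open>T\<close>. The time \<open>-1\<close> stands for the start, before the initial state is drawn.\<close>

locale branching_chain =
  fixes T :: "'x::finite \<Rightarrow> real \<Rightarrow> real \<Rightarrow> 'x \<Rightarrow> 'x \<Rightarrow> real" and p :: "'x \<Rightarrow> real" and s :: real
  assumes stoch: "0 \<le> t \<Longrightarrow> t \<le> r \<Longrightarrow> stochastic_kernel (T z t r)"
    and id: "0 \<le> t \<Longrightarrow> T z t t = kid"
    and CK: "0 \<le> t \<Longrightarrow> t \<le> v \<Longrightarrow> v \<le> r \<Longrightarrow> T z t r = kcomp (T z t v) (T z v r)"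
    and before: "0 \<le> t \<Longrightarrow> t \<le> r \<Longrightarrow> r \<le> s \<Longrightarrow> T z t r = T z' t r"
    and p: "\<And>y. 0 \<le> p y" "(\<Sum>y\<in>UNIV. p y) = 1"
begin

text \<open>The uniform part gives every state positive probability. Along increasing times
  \<open>max a w\<close> is just \<open>w\<close>; it keeps the kernel stochastic for all arguments,
  as \<open>positive_kernel\<close> demands.\<close>

definition noisy :: "real \<Rightarrow> real \<Rightarrow> real \<Rightarrow> (real \<Rightarrow> 'x) \<Rightarrow> 'x \<Rightarrow> real" where
  "noisy e a w x y = (1 - e) * (if a < 0 then p y else T (x s) a (max a w) (x a) y) + e / CARD('x)"

text \<open>Up to \<open>card W\<close> redraws contribute an error of this size each, so
  \<open>card W * noise W\<close> has to tend to 0; the summand 2 keeps the noise strictly between 0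
  and 1 even for empty \<open>W\<close>.\<close>

definition noise :: "real set \<Rightarrow> real" where
  "noise W = 1 / (real (card W) + 2) ^ 2"

lemma noise: "0 < noise W" "noise W < 1"
proof -
  have "1 < (real (card W) + 2) ^ 2" by (rule one_less_power) auto
  thus "0 < noise W" "noise W < 1" by (auto simp: noise_def)
qed

lemma noisy_sum:
  assumes "\<And>y. 0 \<le> f y" "\<And>y. f y \<le> 1" "0 \<le> a" "a \<le> w" "0 \<le> e"
  shows "\<bar>(\<Sum>y\<in>UNIV. noisy e a w x y * f y) - kact (T (x s) a w) f (x a)\<bar> \<le> e"
proof -
  let ?avg = "(\<Sum>y\<in>UNIV. f y) / CARD('x)"
  have "0 \<le> (\<Sum>y\<in>UNIV. f y)" using assms(1) by (intro sum_nonneg) auto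
  moreover have "(\<Sum>y\<in>UNIV. f y) \<le> CARD('x)"
    using sum_bounded_above[of UNIV f 1] assms(2) by simp
  ultimately have avg: "0 \<le> ?avg" "?avg \<le> 1" by auto
  have st: "stochastic_kernel (T (x s) a w)" using assms by (intro stoch)
  have "kact (T (x s) a w) (\<lambda>_. 0) (x a) \<le> kact (T (x s) a w) f (x a)"
    "kact (T (x s) a w) f (x a) \<le> kact (T (x s) a w) (\<lambda>_. 1) (x a)"
    using assms st by (intro kact_mono; simp)+
  hence K: "0 \<le> kact (T (x s) a w) f (x a)" "kact (T (x s) a w) f (x a) \<le> 1"
    using st by (auto simp: kact_def stochastic_kernel_def)
  have "(\<Sum>y\<in>UNIV. noisy e a w x y * f y) = (1 - e) * kact (T (x s) a w) f (x a) + e * ?avg"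
    using assms by (simp add: noisy_def kact_def distrib_right sum.distrib sum_distrib_left
        sum_divide_distrib mult.assoc max_absorb2)
  hence "(\<Sum>y\<in>UNIV. noisy e a w x y * f y) - kact (T (x s) a w) f (x a) = e * (?avg - kact (T (x s) a w) f (x a))"
    by (simp add: algebra_simps)
  moreover have "\<bar>?avg - kact (T (x s) a w) f (x a)\<bar> \<le> 1" using avg K by linarith
  ultimately show ?thesis using assms(5) by (simp add: abs_mult mult_left_le)
qed

sublocale noisy: positive_kernel "noisy (noise W)" for W
proof
  fix a w x and y :: 'x
  have st: "stochastic_kernel (T (x s) a (max a w))" if "\<not> a < 0" using that by (intro stoch) auto
  have "0 \<le> (1 - noise W) * (if a < 0 then p y else T (x s) a (max a w) (x a) y)"
    using noise[of W] p st by (auto simp: stochastic_kernel_def)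
  thus "0 < noisy (noise W) a w x y" unfolding noisy_def using noise[of W] by (intro add_nonneg_pos) auto
  have "(\<Sum>y\<in>UNIV. if a < 0 then p y else T (x s) a (max a w) (x a) y) = 1"
    using p st by (cases "a < 0") (auto simp: stochastic_kernel_def)
  thus "(\<Sum>y\<in>UNIV. noisy (noise W) a w x y) = 1"
    by (simp add: noisy_def sum.distrib sum_distrib_left[symmetric])
qed

text \<open>Each redraw costs at most \<open>noise W\<close>, and the kernels compose by
  Chapman-Kolmogorov. The third assumption says that the times do not straddle \<open>s\<close>:
  either all branches still coincide, or the state at \<open>s\<close> is no longer redrawn, so the
  branch stays fixed.\<close>

lemma resample_approx:
  assumes "0 \<le> a" "sorted_wrt (<) (a # ms)" "last (a # ms) \<le> s \<or> s \<le> a" "\<And>y. 0 \<le> f y" "\<And>y. f y \<le> 1"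
  shows "\<bar>resample (noisy (noise W)) a ms x (\<lambda>\<omega>. f (\<omega> (last (a # ms)))) -
      kact (T (x s) a (last (a # ms))) f (x a)\<bar> \<le> length ms * noise W"
  using assms(1,2,3)
proof (induction ms arbitrary: a x)
  case Nil
  thus ?case by (simp add: id)
next
  case (Cons w ms)
  define r where "r = last (w # ms)"
  let ?k = "noisy (noise W)"
  let ?h = "kact (T (x s) w r) f"
  have aw: "a < w" and sorted: "sorted_wrt (<) (w # ms)" using Cons.prems by auto
  have wr: "w \<le> r" unfolding r_def using sorted by (cases "ms = []") (auto intro: less_imp_le)
  have rs: "r \<le> s \<or> s \<le> a" using Cons.prems by (simp add: r_def)
  have IH: "\<bar>resample ?k w ms (x(w := y)) (\<lambda>\<omega>. f (\<omega> r)) - ?h y\<bar> \<le> length ms * noise W" for y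
  proof -
    have "T ((x(w := y)) s) w r = T (x s) w r"
    proof (cases "r \<le> s")
      case True
      thus ?thesis using wr aw Cons.prems by (intro before) auto
    qed (use rs aw in auto)
    moreover have "0 \<le> w" "last (w # ms) \<le> s \<or> s \<le> w" using Cons.prems aw rs by (auto simp: r_def)
    ultimately show ?thesis using Cons.IH[of w "x(w := y)"] sorted
      by (simp only: r_def fun_upd_same)
  qed
  have "\<bar>(\<Sum>y\<in>UNIV. ?k a w x y * resample ?k w ms (x(w := y)) (\<lambda>\<omega>. f (\<omega> r))) - (\<Sum>y\<in>UNIV. ?k a w x y * ?h y)\<bar>
      \<le> (\<Sum>y\<in>UNIV. ?k a w x y * (length ms * noise W))"
    unfolding sum_subtractf[symmetric] right_diff_distrib[symmetric]
    using IH noisy.kpos[of W a w x]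
    by (intro order_trans[OF sum_abs] sum_mono) (simp add: abs_mult mult_left_mono less_imp_le)
  also have "\<dots> = length ms * noise W" by (simp add: sum_distrib_right[symmetric] noisy.ksum)
  finally have 1: "\<bar>(\<Sum>y\<in>UNIV. ?k a w x y * resample ?k w ms (x(w := y)) (\<lambda>\<omega>. f (\<omega> r))) - (\<Sum>y\<in>UNIV. ?k a w x y * ?h y)\<bar>
      \<le> length ms * noise W" .
  have st: "stochastic_kernel (T (x s) w r)" using Cons.prems aw wr by (intro stoch) auto
  have "kact (T (x s) w r) (\<lambda>_. 0) y \<le> ?h y" "?h y \<le> kact (T (x s) w r) (\<lambda>_. 1) y" for y
    using assms(4,5) st by (intro kact_mono; simp)+
  hence h: "0 \<le> ?h y" "?h y \<le> 1" for y
    using st by (auto simp: kact_def stochastic_kernel_def)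
  have "\<bar>(\<Sum>y\<in>UNIV. ?k a w x y * ?h y) - kact (T (x s) a w) ?h (x a)\<bar> \<le> noise W"
    using h Cons.prems aw noise[of W] by (intro noisy_sum) auto
  moreover have "kact (T (x s) a w) ?h (x a) = kact (T (x s) a r) f (x a)"
    using CK[of a w r "x s"] Cons.prems aw wr by (simp add: kact_kcomp)
  ultimately have "\<bar>resample ?k a (w # ms) x (\<lambda>\<omega>. f (\<omega> r)) - kact (T (x s) a r) f (x a)\<bar>
      \<le> length ms * noise W + noise W" using 1 by simp
  thus ?case by (simp add: r_def distrib_right)
qed

text \<open>The starting path runs through the finite set \<open>fst i\<close>, so that every nonempty event has
  positive mass for large \<open>i\<close>, whatever the transitions.\<close>

definition mass :: "(real \<Rightarrow> 'x) set \<times> real set \<Rightarrow> (real \<Rightarrow> 'x) set \<Rightarrow> real" where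
  "mass i A = (\<Sum>x\<in>fst i. resample (noisy (noise (snd i))) (-1) (sorted_list_of_set (snd i)) x (indicator A))"

lemma sorted_list_of_set_split:
  fixes W :: "real set"
  assumes "finite W" "t \<in> W"
  shows "sorted_list_of_set W = sorted_list_of_set (W \<inter> {..<t}) @ t # sorted_list_of_set (W \<inter> {t<..})"
proof -
  let ?l = "sorted_list_of_set (W \<inter> {..<t}) @ t # sorted_list_of_set (W \<inter> {t<..})"
  have "sorted_wrt (<) ?l" using assms by (auto simp: sorted_wrt_append)
  moreover have "set ?l = W" using assms by auto
  ultimately show ?thesis using assms
    by (metis sorted_list_of_set.idem_if_sorted_distinct strict_sorted_iff)
qed

lemma agree_outside_paths:
  assumes "\<And>t. t \<notin> S \<Longrightarrow> \<omega> t = x t" "S \<subseteq> {0..}" shows "\<omega> \<in> paths \<longleftrightarrow> x \<in> paths"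
  using assms by (auto simp: paths_def PiE_UNIV_domain extensional_def PiE_def) (metis subsetD atLeast_iff)+

lemma mass_initial:
  assumes F: "finite F" "F \<noteq> {}" "F \<subseteq> paths" and W: "finite W" "W \<subseteq> {0..}" "0 \<in> W"
  shows "\<bar>mass (F, W) (state_at 0 y \<inter> paths) / mass (F, W) paths - p y\<bar> \<le> noise W"
proof -
  let ?k = "noisy (noise W)"
  let ?rs = "sorted_list_of_set (W \<inter> {0<..})"
  \<comment> \<open>Thus 0 is the first time to be redrawn, with predecessor \<open>-1\<close>, and
    its value comes from \<open>p\<close>; later redraws leave it unchanged.\<close>
  have "W \<inter> {..<0} = {}" using W by auto
  hence ws: "sorted_list_of_set W = 0 # ?rs" using sorted_list_of_set_split[OF W(1,3)] by simp
  have 1: "resample ?k (-1) (sorted_list_of_set W) x (indicator (state_at 0 y \<inter> paths)) = ?k (-1) 0 x y"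
    if x: "x \<in> paths" for x
  proof -
    have "resample ?k 0 ?rs (x(0 := y')) (indicator (state_at 0 y \<inter> paths)) = (if y' = y then 1 else 0)" for y'
    proof -
      have "resample ?k 0 ?rs (x(0 := y')) (indicator (state_at 0 y \<inter> paths)) =
          indicator (state_at 0 y \<inter> paths) (x(0 := y'))"
      proof (rule noisy.resample_local)
        fix \<omega> assume *: "\<And>t. t \<notin> set ?rs \<Longrightarrow> \<omega> t = (x(0 := y')) t"
        have "\<omega> \<in> paths \<longleftrightarrow> x(0 := y') \<in> paths" using * W by (intro agree_outside_paths[of "set ?rs"]) auto
        moreover have "\<omega> 0 = y'" using *[of 0] W by simp
        ultimately show "indicator (state_at 0 y \<inter> paths) \<omega> =
            (indicator (state_at 0 y \<inter> paths) (x(0 := y')) :: real)" by (simp add: indicator_def)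
      qed
      moreover have "x(0 := y') \<in> paths" using x agree_outside_paths[of "{0}" "x(0 := y')" x] by auto
      ultimately show ?thesis by (simp add: indicator_def)
    qed
    thus ?thesis by (simp add: ws if_distrib[of "\<lambda>a. _ * a"] cong: if_cong)
  qed
  have 2: "resample ?k (-1) (sorted_list_of_set W) x (indicator paths) = 1" if x: "x \<in> paths" for x
  proof (subst noisy.resample_local)
    fix \<omega> assume *: "\<And>t. t \<notin> set (sorted_list_of_set W) \<Longrightarrow> \<omega> t = x t"
    have "\<omega> \<in> paths \<longleftrightarrow> x \<in> paths" using * W by (intro agree_outside_paths[of W]) auto
    thus "indicator paths \<omega> = (indicator paths x :: real)" by (simp add: indicator_def)
  qed (use x in simp)
  have 3: "?k (-1) 0 x y = (1 - noise W) * p y + noise W / CARD('x)" for x by (simp add: noisy_def)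
  have "mass (F, W) (state_at 0 y \<inter> paths) = card F * ((1 - noise W) * p y + noise W / CARD('x))"
    unfolding mass_def using F by (simp add: 1[unfolded 3] subset_iff)
  moreover have "mass (F, W) paths = card F" unfolding mass_def using F by (simp add: 2 subset_iff)
  ultimately have "mass (F, W) (state_at 0 y \<inter> paths) / mass (F, W) paths = (1 - noise W) * p y + noise W / CARD('x)"
    using F by simp
  hence eq: "mass (F, W) (state_at 0 y \<inter> paths) / mass (F, W) paths - p y = noise W * (1 / CARD('x) - p y)"
    by (simp add: algebra_simps)
  have "p y \<le> 1" using member_le_sum[of y UNIV p] p by simp
  moreover have "0 \<le> 1 / real CARD('x)" "1 / real CARD('x) \<le> 1" by auto
  ultimately have "\<bar>1 / CARD('x) - p y\<bar> \<le> 1" using p(1)[of y] by linarith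
  thus ?thesis unfolding eq using noise[of W] by (simp add: abs_mult mult_left_le)
qed

text \<open>The redraws split into those up to \<open>t\<close>, those in \<open>(t, r]\<close> and
  those after \<open>r\<close>. The last do not affect either event, the middle ones do not affect
  the cylinder, so on the cylinder \<open>resample_approx\<close> applies to the middle ones. The
  bound is multiplied by the mass of the cylinder, not divided, so that it can be summed over the
  starting paths.\<close>

lemma mass_transition:
  assumes F: "F \<subseteq> paths" and W: "finite W" "W \<subseteq> {0..}" "insert r (insert t u) \<subseteq> W"
    and t: "0 \<le> t" "u \<subseteq> {0..<t}" "t < r" "r \<le> s \<or> s \<in> insert t u"
  shows "\<bar>mass (F, W) (state_at r y \<inter> cyl (insert t u) x) - T (x s) t r (x t) y * mass (F, W) (cyl (insert t u) x)\<bar>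
     \<le> card W * noise W * mass (F, W) (cyl (insert t u) x)"
proof -
  let ?k = "noisy (noise W)"
  define C where "C = cyl (insert t u) x"
  define A where "A = state_at r y \<inter> C"
  define \<tau> where "\<tau> = T (x s) t r (x t) y"
  define \<eta> where "\<eta> = card W * noise W"
  define vs where "vs = sorted_list_of_set (W \<inter> {..<t}) @ [t]"
  define ms where "ms = sorted_list_of_set (W \<inter> {t<..<r}) @ [r]"
  define rs where "rs = sorted_list_of_set (W \<inter> {r<..})"
  have split: "sorted_list_of_set W = vs @ ms @ rs"
  proof -
    have "sorted_list_of_set W = vs @ sorted_list_of_set (W \<inter> {t<..})"
      using sorted_list_of_set_split[of W t] W by (simp add: vs_def)
    also have "sorted_list_of_set (W \<inter> {t<..}) = sorted_list_of_set (W \<inter> {t<..} \<inter> {..<r}) @ r # sorted_list_of_set (W \<inter> {t<..} \<inter> {r<..})"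
      using W t by (intro sorted_list_of_set_split) auto
    also have "W \<inter> {t<..} \<inter> {..<r} = W \<inter> {t<..<r}" by auto
    also have "W \<inter> {t<..} \<inter> {r<..} = W \<inter> {r<..}" using t by auto
    finally show ?thesis by (simp add: ms_def rs_def)
  qed
  have len: "length ms \<le> card W"
  proof -
    have "length ms \<le> length (sorted_list_of_set W)" by (simp add: split)
    thus ?thesis by simp
  qed
  have sets: "set ms = W \<inter> {t<..r}" "set rs = W \<inter> {r<..}"
    using W t by (auto simp: ms_def rs_def)
  have decomp: "resample ?k (-1) (sorted_list_of_set W) x0 G =
      resample ?k (-1) vs x0 (\<lambda>x'. resample ?k t ms x' (\<lambda>x''. resample ?k r rs x'' G))" for x0 G
    by (simp add: split resample_append) (simp add: vs_def ms_def)
  have outside: "\<omega> \<in> C \<longleftrightarrow> x' \<in> C" if *: "\<And>q. q \<notin> S \<Longrightarrow> \<omega> q = x' q" and S: "S \<subseteq> W \<inter> {t<..}" for \<omega> x' S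
  proof -
    have "\<omega> \<in> paths \<longleftrightarrow> x' \<in> paths" using * S W by (intro agree_outside_paths[of S]) auto
    moreover have "\<omega> q = x' q" if "q \<in> insert t u" for q
    proof (rule *)
      have "q \<le> t" using that t by auto
      thus "q \<notin> S" using S by auto
    qed
    ultimately show ?thesis by (auto simp: C_def cyl_def)
  qed
  have rsA: "resample ?k r rs x' (indicator A) = indicator A x'" for x'
  proof (rule noisy.resample_local)
    fix \<omega> assume *: "\<And>t. t \<notin> set rs \<Longrightarrow> \<omega> t = x' t"
    have "\<omega> \<in> C \<longleftrightarrow> x' \<in> C" using * sets t by (intro outside[of "set rs"]) auto
    moreover have "\<omega> r = x' r" using sets by (intro *) auto
    moreover have "C \<subseteq> paths" by (simp add: C_def cyl_subset_paths)
    ultimately show "indicator A \<omega> = (indicator A x' :: real)"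
      by (auto simp: A_def indicator_def)
  qed
  have C_loc: "resample ?k t ms x' (\<lambda>x''. resample ?k r rs x'' (indicator C)) = indicator C x'" for x'
  proof -
    have "resample ?k r rs x'' (indicator C) = indicator C x''" for x''
    proof (rule noisy.resample_local)
      fix \<omega> assume *: "\<And>t. t \<notin> set rs \<Longrightarrow> \<omega> t = x'' t"
      have "\<omega> \<in> C \<longleftrightarrow> x'' \<in> C" using * sets t by (intro outside[of "set rs"]) auto
      thus "indicator C \<omega> = (indicator C x'' :: real)" by (simp add: indicator_def)
    qed
    moreover have "resample ?k t ms x' (indicator C) = indicator C x'"
    proof (rule noisy.resample_local)
      fix \<omega> assume *: "\<And>t. t \<notin> set ms \<Longrightarrow> \<omega> t = x' t"
      have "\<omega> \<in> C \<longleftrightarrow> x' \<in> C" using * sets t by (intro outside[of "set ms"]) auto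
      thus "indicator C \<omega> = (indicator C x' :: real)" by (simp add: indicator_def)
    qed
    ultimately show ?thesis by simp
  qed
  have inner: "\<bar>resample ?k t ms x' (indicator A) - \<tau> * indicator C x'\<bar> \<le> \<eta> * indicator C x'" for x'
  proof -
    let ?f = "\<lambda>z. if z = y then 1 else 0 :: real"
    have "resample ?k t ms x' (indicator A) = resample ?k t ms x' (\<lambda>\<omega>. indicator C x' * ?f (\<omega> r))"
    proof (rule noisy.resample_cong)
      fix \<omega> assume *: "\<And>t. t \<notin> set ms \<Longrightarrow> \<omega> t = x' t"
      have "\<omega> \<in> C \<longleftrightarrow> x' \<in> C" using * sets t by (intro outside[of "set ms"]) auto
      moreover have "C \<subseteq> paths" by (simp add: C_def cyl_subset_paths)
      ultimately show "indicator A \<omega> = (indicator C x' * ?f (\<omega> r) :: real)"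
        by (auto simp: A_def indicator_def)
    qed
    also have "\<dots> = indicator C x' * resample ?k t ms x' (\<lambda>\<omega>. ?f (\<omega> r))" by (rule resample_scale)
    finally have eq: "resample ?k t ms x' (indicator A) = indicator C x' * resample ?k t ms x' (\<lambda>\<omega>. ?f (\<omega> r))" .
    show ?thesis
    proof (cases "x' \<in> C")
      case True
      have "sorted_wrt (<) (t # ms)" using t W by (auto simp: ms_def sorted_wrt_append)
      moreover have last: "last (t # ms) = r" by (simp add: ms_def)
      moreover have "r \<le> s \<or> s \<le> t" using t by auto
      ultimately have "\<bar>resample ?k t ms x' (\<lambda>\<omega>. ?f (\<omega> r)) - kact (T (x' s) t r) ?f (x' t)\<bar> \<le> length ms * noise W"
        using resample_approx[of t ms ?f W x'] t by simp
      also have "\<dots> \<le> \<eta>" unfolding \<eta>_def using len noise[of W] by (intro mult_right_mono) auto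
      also have "kact (T (x' s) t r) ?f (x' t) = \<tau>"
      proof -
        have "x' t = x t" using True by (auto simp: C_def cyl_def)
        moreover have "T (x' s) t r = T (x s) t r"
        proof (cases "r \<le> s")
          case True
          thus ?thesis using t by (intro before) auto
        next
          case False
          hence "s \<in> insert t u" using t by blast
          hence "x' s = x s" using True unfolding C_def cyl_def by blast
          thus ?thesis by simp
        qed
        ultimately show ?thesis by (simp add: kact_def \<tau>_def if_distrib[of "\<lambda>a. _ * a"] cong: if_cong)
      qed
      finally show ?thesis using True eq by simp
    qed (simp add: eq)
  qed
  have each: "\<bar>resample ?k (-1) (sorted_list_of_set W) x0 (indicator A) - \<tau> * resample ?k (-1) (sorted_list_of_set W) x0 (indicator C)\<bar>
      \<le> \<eta> * resample ?k (-1) (sorted_list_of_set W) x0 (indicator C)" for x0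
  proof -
    let ?RA = "resample ?k (-1) vs x0 (\<lambda>x'. resample ?k t ms x' (indicator A))"
    let ?RC = "resample ?k (-1) vs x0 (indicator C)"
    have "?RA \<le> resample ?k (-1) vs x0 (\<lambda>x'. (\<tau> + \<eta>) * indicator C x')"
      "resample ?k (-1) vs x0 (\<lambda>x'. (\<tau> - \<eta>) * indicator C x') \<le> ?RA"
      using inner by (intro noisy.resample_mono; simp add: abs_le_iff algebra_simps)+
    hence "\<bar>?RA - \<tau> * ?RC\<bar> \<le> \<eta> * ?RC"
      unfolding resample_scale by (simp add: abs_le_iff algebra_simps)
    thus ?thesis by (simp add: decomp rsA C_loc)
  qed
  have "\<bar>mass (F, W) A - \<tau> * mass (F, W) C\<bar> \<le> (\<Sum>x0\<in>F. \<eta> * resample ?k (-1) (sorted_list_of_set W) x0 (indicator C))"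
    unfolding mass_def fst_conv snd_conv sum_distrib_left sum_subtractf[symmetric]
    using each by (intro order_trans[OF sum_abs] sum_mono) auto
  also have "\<dots> = \<eta> * mass (F, W) C" by (simp add: mass_def sum_distrib_left)
  finally show ?thesis by (simp add: A_def C_def \<tau>_def \<eta>_def)
qed

text \<open>The transition identity is claimed only where the branch is irrelevant
  (\<open>r \<le> s\<close>) or revealed by the history; for other histories the conditional law
  depends on the cluster point.\<close>

theorem full_cond_prob_exists:
  obtains R where "full_cond_prob R paths" "\<And>y. R (state_at 0 y, paths) = p y"
    "\<And>t u x r y. 0 \<le> t \<Longrightarrow> finite u \<Longrightarrow> u \<subseteq> {0..<t} \<Longrightarrow> t < r \<Longrightarrow> r \<le> s \<or> s \<in> insert t u \<Longrightarrow>
      R (state_at r y, cyl (insert t u) x) = T (x s) t r (x t) y"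
proof -
  let ?FF = "finite_subsets_at_top (paths :: (real \<Rightarrow> 'x) set) \<times>\<^sub>F finite_subsets_at_top {0::real..}"
  have nb: "?FF \<noteq> bot" by (simp add: prod_filter_eq_bot)
  have m_nonneg: "0 \<le> mass i A" for i A
    unfolding mass_def by (intro sum_nonneg noisy.resample_nonneg) simp
  have m_add: "mass i (A \<union> B) = mass i A + mass i B" if "A \<inter> B = {}" for i A B
  proof -
    have "indicator (A \<union> B) = (\<lambda>\<omega>. indicator A \<omega> + indicator B \<omega> :: real)"
      using that by (auto simp: indicator_def fun_eq_iff)
    thus ?thesis by (simp add: mass_def resample_add sum.distrib)
  qed
  have ev: "\<forall>\<^sub>F i in ?FF. finite (fst i) \<and> fst i \<subseteq> paths \<and> \<omega> \<in> fst i \<and> finite (snd i) \<and> snd i \<subseteq> {0..} \<and> V \<subseteq> snd i"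
    if "\<omega> \<in> paths" "finite V" "V \<subseteq> {0..}" for \<omega> V
  proof -
    have "\<forall>\<^sub>F F in finite_subsets_at_top paths. finite F \<and> F \<subseteq> paths \<and> \<omega> \<in> F"
      using that unfolding eventually_finite_subsets_at_top by (intro exI[of _ "{\<omega>}"]) auto
    moreover have "\<forall>\<^sub>F W in finite_subsets_at_top {0..}. finite W \<and> W \<subseteq> {0..} \<and> V \<subseteq> W"
      using that unfolding eventually_finite_subsets_at_top by (intro exI[of _ V]) auto
    ultimately show ?thesis
      using eventually_prodI by (auto elim!: eventually_mono dest: eventually_prodI)
  qed
  have m_pos: "0 < mass i {\<omega>}" if "finite (fst i)" "\<omega> \<in> fst i" for i \<omega>
    unfolding mass_def using that
    by (intro sum_pos2[of _ \<omega>] noisy.resample_pos noisy.resample_nonneg) auto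
  have m_mono: "mass i A \<le> mass i B" if "A \<subseteq> B" for i A B
    using m_add[of A "B - A" i] m_nonneg[of i "B - A"] that by (simp add: Un_absorb1)
  have paths_ne: "(restrict (\<lambda>_. undefined) {0..} :: real \<Rightarrow> 'x) \<in> paths" by (auto simp: paths_def)
  obtain R G where R: "G \<noteq> bot" "G \<le> ?FF" "full_cond_prob R paths"
    "\<And>A C. A \<subseteq> paths \<Longrightarrow> C \<subseteq> paths \<Longrightarrow> ((\<lambda>i. mass i (A \<inter> C) / mass i C) \<longlongrightarrow> R (A, C)) G"
  proof (rule full_cond_prob_limit[OF nb])
    show "\<forall>\<^sub>F i in ?FF. 0 < mass i {\<omega>}" if "\<omega> \<in> paths" for \<omega>
      using ev[OF that, of "{}"] by (auto elim!: eventually_mono intro: m_pos)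
  qed (use m_nonneg m_add in auto)
  \<comment> \<open>The factor \<open>card + 1\<close> covers both the initial error
    \<open>noise\<close> and the transition error \<open>card * noise\<close>.\<close>
  have small: "((\<lambda>i. (real (card (snd i)) + 1) * noise (snd i)) \<longlongrightarrow> 0) ?FF"
  proof (rule tendstoI)
    fix e :: real assume e: "0 < e"
    obtain N :: nat where N: "1 / e < N" using reals_Archimedean2 by blast
    obtain V where V: "V \<subseteq> {0::real..}" "finite V" "card V = N"
      using infinite_arbitrarily_large[OF infinite_Ici] by metis
    show "\<forall>\<^sub>F i in ?FF. dist ((real (card (snd i)) + 1) * noise (snd i)) 0 < e"
      using ev[OF paths_ne V(2,1)]
    proof eventually_elim
      case (elim i)
      have "N \<le> card (snd i)" using elim V(3) card_mono by metis
      hence "1 / e < real (card (snd i)) + 2" using N by linarith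
      hence "1 / (real (card (snd i)) + 2) < e" using e by (simp add: field_simps)
      moreover have "(real (card (snd i)) + 1) * noise (snd i) \<le> (real (card (snd i)) + 2) * noise (snd i)"
        using noise[of "snd i"] by (intro mult_right_mono) auto
      moreover have "(real (card (snd i)) + 2) * noise (snd i) = 1 / (real (card (snd i)) + 2)"
        unfolding noise_def power2_eq_square by (simp del: of_nat_add)
      moreover have "0 \<le> (real (card (snd i)) + 1) * noise (snd i)" using noise[of "snd i"] by simp
      ultimately show ?case by (simp add: dist_real_def)
    qed
  qed
  have limit_eq: "R (A, C) = \<tau>"
    if "A \<subseteq> paths" "C \<subseteq> paths"
      "\<forall>\<^sub>F i in ?FF. norm (mass i (A \<inter> C) / mass i C - \<tau>) \<le> (real (card (snd i)) + 1) * noise (snd i)" for A C \<tau>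
  proof (rule tendsto_unique[OF R(1) R(4)[OF that(1,2)]])
    have "((\<lambda>i. mass i (A \<inter> C) / mass i C - \<tau>) \<longlongrightarrow> 0) ?FF"
      using that(3) small by (rule Lim_null_comparison)
    hence "((\<lambda>i. mass i (A \<inter> C) / mass i C) \<longlongrightarrow> \<tau>) ?FF" by (rule LIM_zero_cancel)
    thus "((\<lambda>i. mass i (A \<inter> C) / mass i C) \<longlongrightarrow> \<tau>) G" using R(2) by (rule filterlim_mono[OF _ order_refl])
  qed
  show thesis
  proof (rule that[OF R(3)])
    fix y
    show "R (state_at 0 y, paths) = p y"
    proof (rule limit_eq)
      show "\<forall>\<^sub>F i in ?FF. norm (mass i (state_at 0 y \<inter> paths) / mass i paths - p y) \<le> (real (card (snd i)) + 1) * noise (snd i)"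
        using ev[OF paths_ne, of "{0}", simplified]
      proof eventually_elim
        case (elim i)
        have "\<bar>mass (fst i, snd i) (state_at 0 y \<inter> paths) / mass (fst i, snd i) paths - p y\<bar> \<le> noise (snd i)"
          using elim by (intro mass_initial) auto
        moreover have "noise (snd i) \<le> (real (card (snd i)) + 1) * noise (snd i)"
          using noise[of "snd i"] by (simp add: distrib_right)
        ultimately show ?case by simp
      qed
    qed auto
  next
    fix t u r y and x :: "real \<Rightarrow> 'x"
    assume t: "0 \<le> t" "finite u" "u \<subseteq> {0..<t}" "t < r" "r \<le> s \<or> s \<in> insert t u"
    let ?C = "cyl (insert t u) x"
    show "R (state_at r y, ?C) = T (x s) t r (x t) y"
    proof (rule limit_eq)
      have "insert t u \<subseteq> {0..}" using t by auto
      then obtain \<omega> where \<omega>: "\<omega> \<in> ?C" using cyl_nonempty by blast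
      hence \<omega>p: "\<omega> \<in> paths" by (auto simp: cyl_def)
      have "insert r (insert t u) \<subseteq> {0..}" using t by auto
      hence "\<forall>\<^sub>F i in ?FF. finite (fst i) \<and> fst i \<subseteq> paths \<and> \<omega> \<in> fst i \<and> finite (snd i) \<and> snd i \<subseteq> {0..} \<and> insert r (insert t u) \<subseteq> snd i"
        using t by (intro ev \<omega>p) auto
      thus "\<forall>\<^sub>F i in ?FF. norm (mass i (state_at r y \<inter> ?C) / mass i ?C - T (x s) t r (x t) y) \<le> (real (card (snd i)) + 1) * noise (snd i)"
      proof eventually_elim
        case (elim i)
        have "0 < mass i {\<omega>}" using elim by (intro m_pos) auto
        hence C: "0 < mass i ?C" using m_mono[of "{\<omega>}" ?C i] \<omega> by simp
        have "\<bar>mass (fst i, snd i) (state_at r y \<inter> ?C) - T (x s) t r (x t) y * mass (fst i, snd i) ?C\<bar>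
           \<le> card (snd i) * noise (snd i) * mass (fst i, snd i) ?C"
          using elim t by (intro mass_transition) auto
        moreover have "mass i (state_at r y \<inter> ?C) - T (x s) t r (x t) y * mass i ?C =
            (mass i (state_at r y \<inter> ?C) / mass i ?C - T (x s) t r (x t) y) * mass i ?C"
          using C by (simp add: left_diff_distrib)
        ultimately have "\<bar>mass i (state_at r y \<inter> ?C) / mass i ?C - T (x s) t r (x t) y\<bar> * mass i ?C
            \<le> card (snd i) * noise (snd i) * mass i ?C" using C by (simp add: abs_mult)
        hence "\<bar>mass i (state_at r y \<inter> ?C) / mass i ?C - T (x s) t r (x t) y\<bar> \<le> card (snd i) * noise (snd i)"
          using C by simp
        thus ?case using noise[of "snd i"] by (simp add: distrib_right)
      qed
    qed (auto simp: cyl_subset_paths)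
  qed
qed

end

subsection \<open>Processes with prescribed transitions\<close>

context separate_rates
begin

text \<open>The weights \<open>L\<close> may depend on \<Delta> and on the row and need not
  converge. Still, row \<open>w\<close> of \<open>F\<close> approaches the convex hull of the
  finitely many limiting rows \<open>Qf z $ w\<close>. This hull is compact and, by convexity,
  consists of rows of matrices in \<open>\<Q>\<close>; separately specified rows reassemble the
  limit inside \<open>\<Q>\<close>.\<close>

lemma mixture_limit_points:
  fixes F :: "real \<Rightarrow> real^'x^'x" and q :: "'x \<Rightarrow> real \<Rightarrow> 'x \<Rightarrow> 'x \<Rightarrow> real"
  assumes conv: "convex \<Q>"
    and q: "\<And>z. \<exists>Q\<in>\<Q>. \<forall>w y. ((\<lambda>\<Delta>. q z \<Delta> w y) \<longlongrightarrow> Q $ w $ y) (at_right 0)"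
    and F: "\<forall>\<^sub>F \<Delta> in at_right 0. \<forall>w. \<exists>L. (\<forall>z. 0 \<le> L z) \<and> (\<Sum>z\<in>UNIV. L z) = 1 \<and>
      (\<forall>y. F \<Delta> $ w $ y = (\<Sum>z\<in>UNIV. L z * q z \<Delta> w y))"
  shows "Bfun F (at_right 0)" and "limit_points_at_0 F \<subseteq> \<Q>"
proof -
  obtain Qf where Qf: "\<And>z. Qf z \<in> \<Q>" "\<And>z w y. ((\<lambda>\<Delta>. q z \<Delta> w y) \<longlongrightarrow> Qf z $ w $ y) (at_right 0)"
    using q by metis
  define good where "good \<Delta> w L \<longleftrightarrow> (\<forall>z. 0 \<le> L z) \<and> (\<Sum>z\<in>UNIV. L z) = 1 \<and>
      (\<forall>y. F \<Delta> $ w $ y = (\<Sum>z\<in>UNIV. L z * q z \<Delta> w y))" for \<Delta> w and L :: "'x \<Rightarrow> real"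
  define L where "L \<Delta> w = (SOME L. good \<Delta> w L)" for \<Delta> w
  have good: "\<forall>\<^sub>F \<Delta> in at_right 0. \<forall>w. good \<Delta> w (L \<Delta> w)"
    using F unfolding good_def[symmetric] by eventually_elim (simp add: L_def some_eq_ex[of "good _ _"])
  have L: "0 \<le> L \<Delta> w z" "(\<Sum>z\<in>UNIV. L \<Delta> w z) = 1" "F \<Delta> $ w $ y = (\<Sum>z\<in>UNIV. L \<Delta> w z * q z \<Delta> w y)"
    if "\<forall>w. good \<Delta> w (L \<Delta> w)" for \<Delta> w z y
    using that unfolding good_def by blast+
  have L1: "L \<Delta> w z \<le> 1" if "\<forall>w. good \<Delta> w (L \<Delta> w)" for \<Delta> w z
    using member_le_sum[of z UNIV "L \<Delta> w"] L(1,2)[OF that, of w] by simp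
  have weighted: "\<bar>\<Sum>z\<in>UNIV. L \<Delta> w z * a z\<bar> \<le> (\<Sum>z\<in>UNIV. \<bar>a z\<bar>)"
    if "\<forall>w. good \<Delta> w (L \<Delta> w)" for \<Delta> w a
    using L(1)[OF that] L1[OF that]
    by (intro order_trans[OF sum_abs] sum_mono) (simp add: abs_mult mult_left_le_one_le)
  \<comment> \<open>Eventually each branch quotient is within 1 of its limit, and all weights are at
    most 1.\<close>
  define K where "K = (\<Sum>w\<in>UNIV. \<Sum>y\<in>UNIV. \<Sum>z\<in>UNIV. \<bar>Qf z $ w $ y\<bar> + 1)"
  have "\<forall>\<^sub>F \<Delta> in at_right 0. \<forall>w y z. \<bar>q z \<Delta> w y\<bar> < \<bar>Qf z $ w $ y\<bar> + 1"
    by (intro eventually_all_finite order_tendstoD(2)[OF tendsto_rabs[OF Qf(2)]]) simp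
  with good have "\<forall>\<^sub>F \<Delta> in at_right 0. norm (F \<Delta>) \<le> K"
  proof eventually_elim
    case (elim \<Delta>)
    have "norm (F \<Delta>) \<le> (\<Sum>w\<in>UNIV. \<Sum>y\<in>UNIV. \<bar>F \<Delta> $ w $ y\<bar>)"
      unfolding norm_vec_def[of "F \<Delta>"]
      by (intro order_trans[OF L2_set_le_sum] sum_mono norm_le_l1_cart) auto
    also have "\<dots> \<le> K" unfolding K_def
    proof (intro sum_mono)
      fix w y
      have "\<bar>F \<Delta> $ w $ y\<bar> \<le> (\<Sum>z\<in>UNIV. \<bar>q z \<Delta> w y\<bar>)"
        unfolding L(3)[OF elim(1)] by (rule weighted[OF elim(1)])
      also have "\<dots> \<le> (\<Sum>z\<in>UNIV. \<bar>Qf z $ w $ y\<bar> + 1)"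
        using elim(2) by (intro sum_mono) (auto intro: less_imp_le)
      finally show "\<bar>F \<Delta> $ w $ y\<bar> \<le> (\<Sum>z\<in>UNIV. \<bar>Qf z $ w $ y\<bar> + 1)" .
    qed
    finally show ?case .
  qed
  thus "Bfun F (at_right 0)" by (rule BfunI)
  show "limit_points_at_0 F \<subseteq> \<Q>"
  proof
    fix S assume "S \<in> limit_points_at_0 F"
    then obtain d where d: "filterlim d (at_right 0) sequentially" "(\<lambda>n. F (d n)) \<longlonglongrightarrow> S"
      by (auto simp: limit_points_at_0_def)
    have goodn: "\<forall>\<^sub>F n in sequentially. \<forall>w. good (d n) w (L (d n) w)"
      using good d(1) by (rule eventually_compose_filterlim)
    show "S \<in> \<Q>"
    proof (rule rows_in)
      fix w
      define H where "H = convex hull (range (\<lambda>z. Qf z $ w))"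
      define b where "b n = (\<Sum>z\<in>UNIV. L (d n) w z *\<^sub>R Qf z $ w)" for n
      have "\<forall>\<^sub>F n in sequentially. b n \<in> H"
        using goodn
      proof eventually_elim
        case (elim n)
        show ?case unfolding b_def H_def
          using L(1,2)[OF elim] by (intro convex_sum convex_convex_hull) (auto intro: hull_inc)
      qed
      moreover have "b \<longlonglongrightarrow> S $ w"
      proof (rule vec_tendstoI)
        fix y
        show "(\<lambda>n. b n $ y) \<longlonglongrightarrow> S $ w $ y"
        proof (rule Lim_transform2)
          show "(\<lambda>n. F (d n) $ w $ y) \<longlonglongrightarrow> S $ w $ y" using d(2) by (intro tendsto_intros)
          show "(\<lambda>n. F (d n) $ w $ y - b n $ y) \<longlonglongrightarrow> 0"
          proof (rule Lim_null_comparison)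
            have "((\<lambda>\<Delta>. \<Sum>z\<in>UNIV. \<bar>q z \<Delta> w y - Qf z $ w $ y\<bar>) \<longlongrightarrow> 0) (at_right 0)"
              by (intro tendsto_null_sum tendsto_rabs_zero LIM_zero Qf(2))
            thus "(\<lambda>n. \<Sum>z\<in>UNIV. \<bar>q z (d n) w y - Qf z $ w $ y\<bar>) \<longlonglongrightarrow> 0"
              using d(1) by (rule filterlim_compose)
            show "\<forall>\<^sub>F n in sequentially. norm (F (d n) $ w $ y - b n $ y) \<le> (\<Sum>z\<in>UNIV. \<bar>q z (d n) w y - Qf z $ w $ y\<bar>)"
              using goodn
            proof eventually_elim
              case (elim n)
              have "F (d n) $ w $ y - b n $ y = (\<Sum>z\<in>UNIV. L (d n) w z * (q z (d n) w y - Qf z $ w $ y))"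
                unfolding L(3)[OF elim] b_def by (simp add: right_diff_distrib sum_subtractf)
              thus ?case using weighted[OF elim] by simp
            qed
          qed
        qed
      qed
      moreover have "closed H" unfolding H_def
        by (intro compact_imp_closed finite_imp_compact_convex_hull) simp
      ultimately have "S $ w \<in> H"
        using Lim_in_closed_set[of H b sequentially "S $ w"] by simp
      also have "H \<subseteq> (\<lambda>Q. Q $ w) ` \<Q>" unfolding H_def
      proof (rule hull_minimal)
        show "convex ((\<lambda>Q. Q $ w) ` \<Q>)"
          by (intro convex_linear_image conv linear_componentwise) (auto intro!: linearI)
      qed (use Qf(1) in auto)
      finally show "\<exists>Q'\<in>\<Q>. S $ w = Q' $ w" by auto
    qed
  qed
qed

theorem ictmc_with_transitions:
  fixes T :: "'x \<Rightarrow> real \<Rightarrow> real \<Rightarrow> 'x \<Rightarrow> 'x \<Rightarrow> real" and p :: "'x pmf"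
  assumes conv: "convex \<Q>"
    and T: "\<And>z. transition_family (T z)"
    and before: "\<And>z z' t r. 0 \<le> t \<Longrightarrow> t \<le> r \<Longrightarrow> r \<le> s \<Longrightarrow> T z t r = T z' t r"
    and s: "0 \<le> s" and pM: "p \<in> \<M>"
  obtains P R where "P \<in> ICTMC \<Q> \<M>" "full_cond_prob R paths" "\<And>z. z \<in> process_domain \<Longrightarrow> R z = P z"
    "\<And>y. R (state_at 0 y, paths) = pmf p y"
    "\<And>t u x r y. 0 \<le> t \<Longrightarrow> finite u \<Longrightarrow> u \<subseteq> {0..<t} \<Longrightarrow> t < r \<Longrightarrow> r \<le> s \<or> s \<in> insert t u \<Longrightarrow>
      R (state_at r y, cyl (insert t u) x) = T (x s) t r (x t) y"
proof -
  interpret branching_chain T "pmf p" s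
    by unfold_locales (fact transition_familyD(1,2,3)[OF T] before pmf_nonneg sum_pmf_eq_1[OF finite subset_UNIV])+
  obtain R where R: "full_cond_prob R paths" "\<And>y. R (state_at 0 y, paths) = pmf p y"
    "\<And>t u x r y. 0 \<le> t \<Longrightarrow> finite u \<Longrightarrow> u \<subseteq> {0..<t} \<Longrightarrow> t < r \<Longrightarrow> r \<le> s \<or> s \<in> insert t u \<Longrightarrow>
      R (state_at r y, cyl (insert t u) x) = T (x s) t r (x t) y"
    by (rule full_cond_prob_exists) (rule that; simp)
  interpret path_cond_prob R using R(1) by unfold_locales
  define P where "P = restrict R process_domain"
  have agree: "R z = P z" if "z \<in> process_domain" for z using that by (simp add: P_def)
  have mixture: "\<exists>L. (\<forall>z. 0 \<le> L z) \<and> (\<Sum>z\<in>UNIV. L z) = 1 \<and>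
      (\<forall>y. ((1 / \<Delta>) *\<^sub>R (trans_matrix P u x t r - mat 1)) $ w $ y = (\<Sum>z\<in>UNIV. L z * ((T z t r w y - kid w y) / \<Delta>)))"
    if t: "0 \<le> t" "finite u" "u \<subseteq> {0..<t}" "t < r" "r \<le> s \<or> s \<le> t" for t u x r w \<Delta>
  proof -
    let ?x = "x(t := w)"
    have "\<exists>L. (\<forall>z. 0 \<le> L z) \<and> (\<Sum>z\<in>UNIV. L z) = 1 \<and>
        (\<forall>y. R (state_at r y, cyl (insert t u) ?x) = (\<Sum>z\<in>UNIV. L z * T z t r w y))"
    \<comment> \<open>If the branch is known or irrelevant, the mixture is a point mass. Otherwise
      \<open>s\<close> is a past time missing from the history, and the mixture is obtained by
      conditioning additionally on the state at \<open>s\<close>.\<close>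
    proof (cases "r \<le> s \<or> s \<in> insert t u")
      case True
      define L :: "'x \<Rightarrow> real" where "L z = (if z = ?x s then 1 else 0)" for z
      have "R (state_at r y, cyl (insert t u) ?x) = T (?x s) t r w y" for y
        using R(3)[OF t(1-4) True, of y ?x] by simp
      moreover have "(\<Sum>z\<in>UNIV. L z * T z t r w y) = T (?x s) t r w y" for y
        by (simp add: L_def if_distrib[of "\<lambda>a. a * _"] cong: if_cong)
      moreover have "(\<forall>z. 0 \<le> L z) \<and> (\<Sum>z\<in>UNIV. L z) = 1" by (simp add: L_def)
      ultimately show ?thesis by (intro exI[of _ L]) simp
    next
      case False
      hence st: "s < t" "s \<notin> u" using t by auto
      have V: "insert t u \<subseteq> {0..}" using t by auto
      \<comment> \<open>The conditional law of a past state given later ones: in general such a pair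
        lies outside \<open>process_domain\<close>, and the extension \<open>R\<close> supplies its
        value.\<close>
      define L where "L z = R (state_at s z, cyl (insert t u) ?x)" for z
      have "R (state_at r y, cyl (insert t u) ?x) = (\<Sum>z\<in>UNIV. L z * T z t r w y)" for y
      proof -
        have "R (state_at r y, cyl (insert s (insert t u)) (?x(s := z))) = T z t r w y" for z
          using R(3)[of t "insert s u" r y "?x(s := z)"] t st s by (simp add: insert_commute)
        thus ?thesis using V by (subst cp_total[of _ _ _ s]) (auto simp: L_def)
      qed
      moreover have "\<forall>z. 0 \<le> L z" unfolding L_def
        using V by (auto intro!: cp_nonneg cyl_subset_paths cyl_nonempty)
      moreover have "(\<Sum>z\<in>UNIV. L z) = 1" unfolding L_def
        using V by (intro cp_state_sum_1 cyl_subset_paths cyl_nonempty)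
      ultimately show ?thesis by blast
    qed
    then obtain L where L: "\<forall>z. 0 \<le> L z" "(\<Sum>z\<in>UNIV. L z) = 1"
      "\<And>y. R (state_at r y, cyl (insert t u) ?x) = (\<Sum>z\<in>UNIV. L z * T z t r w y)" by blast
    have "((1 / \<Delta>) *\<^sub>R (trans_matrix P u x t r - mat 1)) $ w $ y = (\<Sum>z\<in>UNIV. L z * ((T z t r w y - kid w y) / \<Delta>))" for y
    proof -
      have "trans_matrix P u x t r $ w $ y = R (state_at r y, cyl (insert t u) ?x)"
        using t by (intro trans_matrix_nth agree) auto
      moreover have "(\<Sum>z\<in>UNIV. L z * kid w y) = kid w y"
        using L(2) by (simp add: sum_distrib_right[symmetric])
      ultimately show ?thesis
        by (simp add: L(3) mat_def kid_def[symmetric] right_diff_distrib diff_divide_distrib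
            sum_subtractf sum_divide_distrib[symmetric])
    qed
    thus ?thesis using L(1,2) by blast
  qed
  have right: "Bfun (right_quotient P u x t) (at_right 0)" "limit_points_at_0 (right_quotient P u x t) \<subseteq> \<Q>"
    if t: "0 \<le> t" "finite u" "u \<subseteq> {0..<t}" for t u x
  proof -
    \<comment> \<open>For small \<Delta> the interval from \<open>t\<close> to
      \<open>t + \<Delta>\<close> does not have \<open>s\<close> in its interior, as
      \<open>mixture\<close> requires.\<close>
    have "\<forall>\<^sub>F \<Delta> in at_right 0. 0 < \<Delta> \<and> (t + \<Delta> \<le> s \<or> s \<le> t)"
    proof (cases "t < s")
      case True
      have "\<forall>\<^sub>F \<Delta> in at_right 0. \<Delta> \<in> {0<..<s - t}" using True by (intro eventually_at_right_real) simp
      thus ?thesis by eventually_elim auto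
    next
      case False
      thus ?thesis using eventually_at_right_less[of "0::real"] by (auto elim: eventually_mono)
    qed
    hence "\<forall>\<^sub>F \<Delta> in at_right 0. \<forall>w. \<exists>L. (\<forall>z. 0 \<le> L z) \<and> (\<Sum>z\<in>UNIV. L z) = 1 \<and>
      (\<forall>y. right_quotient P u x t \<Delta> $ w $ y = (\<Sum>z\<in>UNIV. L z * ((T z t (t + \<Delta>) w y - kid w y) / \<Delta>)))"
    proof eventually_elim
      case (elim \<Delta>)
      show ?case unfolding right_quotient_def using t elim by (intro allI mixture) auto
    qed
    from mixture_limit_points[OF conv transition_familyD(4)[OF T t(1)] this]
    show "Bfun (right_quotient P u x t) (at_right 0)" "limit_points_at_0 (right_quotient P u x t) \<subseteq> \<Q>" .
  qed
  have left: "Bfun (left_quotient P u x t) (at_right 0)" "limit_points_at_0 (left_quotient P u x t) \<subseteq> \<Q>"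
    if t: "0 < t" "finite u" "u \<subseteq> {0..<t}" for t u x
  proof -
    have "\<forall>\<^sub>F \<Delta> in at_right 0. t \<le> s \<or> s \<le> t - \<Delta>"
    proof (cases "t \<le> s")
      case False
      hence "\<forall>\<^sub>F \<Delta> in at_right 0. \<Delta> \<in> {0<..<t - s}" by (intro eventually_at_right_real) simp
      thus ?thesis by eventually_elim auto
    qed simp
    moreover have "\<forall>\<^sub>F \<Delta> in at_right 0. \<forall>v\<in>u. v < t - \<Delta>"
    proof (intro eventually_ball_finite t(2) ballI)
      fix v assume "v \<in> u"
      hence "v < t" using t(3) by auto
      hence "\<forall>\<^sub>F \<Delta> in at_right 0. \<Delta> \<in> {0<..<t - v}" by (intro eventually_at_right_real) simp
      thus "\<forall>\<^sub>F \<Delta> in at_right 0. v < t - \<Delta>" by eventually_elim auto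
    qed
    moreover have "\<forall>\<^sub>F \<Delta> in at_right 0. \<Delta> \<in> {0<..<t}" using t(1) by (rule eventually_at_right_real)
    ultimately have "\<forall>\<^sub>F \<Delta> in at_right 0. \<forall>w. \<exists>L. (\<forall>z. 0 \<le> L z) \<and> (\<Sum>z\<in>UNIV. L z) = 1 \<and>
      (\<forall>y. left_quotient P u x t \<Delta> $ w $ y = (\<Sum>z\<in>UNIV. L z * ((T z (t - \<Delta>) t w y - kid w y) / \<Delta>)))"
    proof eventually_elim
      case (elim \<Delta>)
      show ?case unfolding left_quotient_def using t elim by (intro allI mixture) auto
    qed
    from mixture_limit_points[OF conv transition_familyD(5)[OF T t(1)] this]
    show "Bfun (left_quotient P u x t) (at_right 0)" "limit_points_at_0 (left_quotient P u x t) \<subseteq> \<Q>" .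
  qed
  have "stochastic_process P"
    unfolding stochastic_process_def using R(1) agree by (auto simp: P_def)
  moreover have "well_behaved P" unfolding well_behaved_def using right(1) left(1) by blast
  moreover have "consistent_with P \<Q>" unfolding consistent_with_def
    by (intro allI impI conjI right(2) left(2)) auto
  moreover have "P (state_at 0 y, paths) = pmf p y" for y
    using R(2)[of y] agree[OF state_at_process_domain[of "{}" 0 y "\<lambda>_. y"]] by (simp add: cyl_empty)
  ultimately have "P \<in> ICTMC \<Q> \<M>" using pM by (auto simp: ICTMC_def intro!: bexI[of _ p])
  from that[OF this R(1) agree R(2) R(3)] show thesis by blast
qed

end

subsection \<open>Expectations of products\<close>

lemma sum_PiE_insert:
  assumes "r \<notin> V"
  shows "(\<Sum>x\<in>insert r V \<rightarrow>\<^sub>E UNIV. F x) = (\<Sum>x\<in>V \<rightarrow>\<^sub>E UNIV. \<Sum>y\<in>(UNIV :: 'x::finite set). F (x(r := y)))"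
proof -
  have inj: "inj_on (\<lambda>(y, x). x(r := y)) ((UNIV :: 'x set) \<times> (V \<rightarrow>\<^sub>E UNIV))"
    using inj_combinator[of r V "\<lambda>_. UNIV"] assms by simp
  have "(\<Sum>x\<in>insert r V \<rightarrow>\<^sub>E UNIV. F x) = (\<Sum>(y, x)\<in>UNIV \<times> (V \<rightarrow>\<^sub>E UNIV). F (x(r := y)))"
    unfolding PiE_insert_eq by (subst sum.reindex[OF inj]) (simp add: o_def case_prod_beta')
  also have "\<dots> = (\<Sum>y\<in>UNIV. \<Sum>x\<in>V \<rightarrow>\<^sub>E UNIV. F (x(r := y)))"
    by (simp add: sum.cartesian_product)
  finally show ?thesis by (simp add: sum.swap[of _ UNIV])
qed

context path_cond_prob
begin

lemma expect_insert:
  assumes "V \<subseteq> {0..}" "r \<notin> V"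
  shows "expect R (insert r V) h = (\<Sum>x\<in>V \<rightarrow>\<^sub>E UNIV. R (cyl V x, paths) *
      (\<Sum>y\<in>UNIV. R (state_at r y, cyl V x) * h (x(r := y))))"
proof -
  have "R (cyl (insert r V) (x(r := y)), paths) = R (state_at r y, cyl V x) * R (cyl V x, paths)" for x y
  proof -
    have "cyl V (x(r := y)) = cyl V x" using assms(2) by (intro cyl_cong) auto
    hence "cyl (insert r V) (x(r := y)) = state_at r y \<inter> cyl V x" by (simp add: cyl_insert)
    moreover have "cyl V x \<inter> paths = cyl V x" using cyl_subset_paths[of V x] by blast
    ultimately show ?thesis
      using cp_mult[of "state_at r y" "cyl V x" paths] cyl_subset_paths[of V x] cyl_nonempty[OF assms(1), of x]
      by simp
  qed
  thus ?thesis using assms(2)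
    by (simp add: expect_def sum_PiE_insert sum_distrib_left mult.commute mult.left_commute)
qed

lemma expect_singleton:
  assumes "0 \<le> t" shows "expect R {t} (\<lambda>x. f (x t)) = (\<Sum>y\<in>UNIV. R (state_at t y, paths) * f y)"
proof -
  have "R (paths, paths) = 1" using cyl_nonempty[of "{}" undefined] by (intro cp_one) (auto simp: cyl_empty)
  thus ?thesis using expect_insert[of "{}" t "\<lambda>x. f (x t)"] by (simp add: cyl_empty)
qed

lemma expect_one:
  assumes "finite V" "V \<subseteq> {0..}" shows "expect R V (\<lambda>_. 1) = 1"
  using assms
proof (induction V)
  case empty
  have "R (paths, paths) = 1" using cyl_nonempty[of "{}" undefined] by (intro cp_one) (auto simp: cyl_empty)
  thus ?case by (simp add: expect_def cyl_empty)
next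
  case (insert r V)
  have "(\<Sum>y\<in>UNIV. R (state_at r y, cyl V x)) = 1" for x
    using insert.prems by (intro cp_state_sum_1 cyl_subset_paths cyl_nonempty) auto
  thus ?case using insert expect_insert[of V r "\<lambda>_. 1"] by (simp add: expect_def)
qed

lemma cyl_prob_nonneg: "0 \<le> R (cyl V x, paths)"
  using cyl_nonempty[of "{}" undefined] by (intro cp_nonneg cyl_subset_paths) (auto simp: cyl_empty)

lemma expect_insert_ge:
  assumes "finite V" "V \<subseteq> {0..}" "r \<notin> V"
    and "\<And>x. W x \<le> (\<Sum>y\<in>UNIV. R (state_at r y, cyl V x) * W' (x(r := y)))"
  shows "expect R V W \<le> expect R (insert r V) W'"
  unfolding expect_insert[OF assms(2,3)] expect_def[of R V]
  using assms(4) cyl_prob_nonneg by (intro sum_mono) (subst mult.commute, intro mult_left_mono)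

lemma expect_insert_le:
  assumes "finite V" "V \<subseteq> {0..}" "r \<notin> V"
    and "\<And>x. (\<Sum>y\<in>UNIV. R (state_at r y, cyl V x) * W' (x(r := y))) \<le> W x + e"
  shows "expect R (insert r V) W' \<le> expect R V W + e"
proof -
  have "expect R (insert r V) W' \<le> (\<Sum>x\<in>V \<rightarrow>\<^sub>E UNIV. R (cyl V x, paths) * (W x + e))"
    unfolding expect_insert[OF assms(2,3)]
    using assms(4) cyl_prob_nonneg by (intro sum_mono mult_left_mono)
  also have "\<dots> = expect R V W + e * expect R V (\<lambda>_. 1)"
    by (simp add: expect_def algebra_simps sum.distrib sum_distrib_left)
  finally show ?thesis using expect_one[OF assms(1,2)] by simp
qed

lemma initial_mixture:
  assumes "0 \<le> t"
  shows "(\<Sum>y\<in>UNIV. R (state_at t y, paths) * f y) =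
    (\<Sum>w\<in>UNIV. R (state_at 0 w, paths) * (\<Sum>y\<in>UNIV. R (state_at t y, cyl {0} (\<lambda>_. w)) * f y))"
proof -
  have "R (state_at t y, paths) = (\<Sum>w\<in>UNIV. R (state_at 0 w, paths) * R (state_at t y, cyl {0} (\<lambda>_. w)))" for y
  proof -
    have "cyl {0} (x(0 := w)) = cyl {0} (\<lambda>_. w)" for x :: "real \<Rightarrow> 'x" and w by (rule cyl_cong) simp
    thus ?thesis using cp_total[of "state_at t y" "{}" undefined 0] by (simp add: cyl_empty)
  qed
  hence "(\<Sum>y\<in>UNIV. R (state_at t y, paths) * f y) =
      (\<Sum>y\<in>UNIV. \<Sum>w\<in>UNIV. R (state_at 0 w, paths) * (R (state_at t y, cyl {0} (\<lambda>_. w)) * f y))"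
    by (simp add: sum_distrib_right mult.assoc)
  thus ?thesis by (subst (asm) sum.swap) (simp add: sum_distrib_left)
qed

end

lemma expect_agree:
  assumes "\<And>z. z \<in> process_domain \<Longrightarrow> R z = P z" "finite V" "V \<subseteq> {0..}"
  shows "expect P V h = expect R V h"
  unfolding expect_def using assms(1)[OF cyl_process_domain[OF assms(2,3)]] by simp

text \<open>Applied with \<open>a\<close> the expectation of the product and \<open>b\<close> that
  of the recursion's first function. The comparison is process by process: \<open>P'\<close> will be
  built with the initial mass function of \<open>P\<close>.\<close>

lemma INF_eq_of_approx:
  fixes a b :: "'p \<Rightarrow> real"
  assumes le: "\<And>P. P \<in> I \<Longrightarrow> b P \<le> a P" and bd: "\<And>P. P \<in> I \<Longrightarrow> k \<le> b P"
    and approx: "\<And>P \<epsilon>. P \<in> I \<Longrightarrow> 0 < \<epsilon> \<Longrightarrow> \<exists>P'\<in>I. a P' \<le> b P + \<epsilon>"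
  shows "(INF P\<in>I. a P) = (INF P\<in>I. b P)"
proof (cases "I = {}")
  case False
  have bdb: "bdd_below (b ` I)" using bd by (rule bdd_belowI2)
  have bda: "bdd_below (a ` I)" using order_trans[OF bd le] by (rule bdd_belowI2)
  show ?thesis
  proof (rule antisym)
    show "(INF P\<in>I. b P) \<le> (INF P\<in>I. a P)"
      using le by (intro cINF_mono False bdb) auto
    show "(INF P\<in>I. a P) \<le> (INF P\<in>I. b P)"
    proof (rule cINF_greatest[OF False], rule field_le_epsilon)
      fix P and \<epsilon> :: real assume "P \<in> I" "0 < \<epsilon>"
      then obtain P' where "P' \<in> I" "a P' \<le> b P + \<epsilon>" using approx by blast
      thus "(INF P\<in>I. a P) \<le> b P + \<epsilon>" using cINF_lower[OF bda] by fastforce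
    qed
  qed
qed simp

section \<open>The backward recursion as a dynamic programming principle on the time grid\<close>

text \<open>Here \<open>j\<close> is the index of \<open>s\<close>, the one time at which
  \<open>g\<close> may be negative. Nothing refers to \<open>f\<close>, \<mu> or \<open>h\<close>,
  so the locale can also be instantiated with the sign of \<open>g\<close> at \<open>s\<close>
  reversed.\<close>

locale backward_recursion = separate_rates \<Q> c
  for \<Q> :: "(real^'x^('x::finite)) set" and c +
  fixes g gp gm :: "real \<Rightarrow> 'x \<Rightarrow> real" and \<tau> :: "nat \<Rightarrow> real" and n j :: nat
  assumes conv: "convex \<Q>"
    and mono: "strict_mono_on {..n} \<tau>" and start: "0 \<le> \<tau> 0" and j: "j \<le> n"
    and g_nonneg: "\<And>i x. i \<le> n \<Longrightarrow> i \<noteq> j \<Longrightarrow> 0 \<le> g (\<tau> i) x"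
    and last: "gp (\<tau> n) = g (\<tau> n)" "gm (\<tau> n) = g (\<tau> n)"
    and rec_gp: "\<And>i x. i < n \<Longrightarrow> gp (\<tau> i) x =
      (if 0 \<le> g (\<tau> i) x
       then g (\<tau> i) x * cond_lower_expect \<Q> (\<tau> i) (\<tau> (Suc i)) (gp (\<tau> (Suc i))) x
       else g (\<tau> i) x * cond_upper_expect \<Q> (\<tau> i) (\<tau> (Suc i)) (gm (\<tau> (Suc i))) x)"
    and rec_gm: "\<And>i x. i < n \<Longrightarrow> gm (\<tau> i) x =
      (if 0 \<le> g (\<tau> i) x
       then g (\<tau> i) x * cond_upper_expect \<Q> (\<tau> i) (\<tau> (Suc i)) (gm (\<tau> (Suc i))) x
       else g (\<tau> i) x * cond_lower_expect \<Q> (\<tau> i) (\<tau> (Suc i)) (gp (\<tau> (Suc i))) x)"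
begin

abbreviation "grid k \<equiv> \<tau> ` {..k}"

definition factor :: "nat \<Rightarrow> (real \<Rightarrow> 'x) \<Rightarrow> real" where
  "factor k x = (\<Prod>i<k. g (\<tau> i) (x (\<tau> i)))"

text \<open>The value function of the minimisation given the history up to \<open>\<tau> k\<close>:
  a nonnegative product of the earlier factors calls for minimising the rest, a negative one for
  maximising it.\<close>

definition partial_value :: "nat \<Rightarrow> (real \<Rightarrow> 'x) \<Rightarrow> real" where
  "partial_value k x = factor k x * (if 0 \<le> factor k x then gp (\<tau> k) (x (\<tau> k)) else gm (\<tau> k) (x (\<tau> k)))"

lemma \<tau>_less: "i < k \<Longrightarrow> k \<le> n \<Longrightarrow> \<tau> i < \<tau> k"
  using mono by (auto simp: strict_mono_on_def)

lemma \<tau>_le: "i \<le> k \<Longrightarrow> k \<le> n \<Longrightarrow> \<tau> i \<le> \<tau> k"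
  using \<tau>_less[of i k] by (cases "i = k") auto

lemma \<tau>_nonneg: "k \<le> n \<Longrightarrow> 0 \<le> \<tau> k"
  using \<tau>_le[of 0 k] start by simp

lemma grid: "finite (grid k)" "k \<le> n \<Longrightarrow> grid k \<subseteq> {0..}" "grid (Suc k) = insert (\<tau> (Suc k)) (grid k)"
    "k < n \<Longrightarrow> \<tau> (Suc k) \<notin> grid k" "grid k = insert (\<tau> k) (\<tau> ` {..<k})"
    "k \<le> n \<Longrightarrow> \<tau> ` {..<k} \<subseteq> {0..<\<tau> k}"
proof -
  show "finite (grid k)" by simp
  show "k \<le> n \<Longrightarrow> grid k \<subseteq> {0..}" using \<tau>_nonneg by force
  show "grid (Suc k) = insert (\<tau> (Suc k)) (grid k)" by (simp add: atMost_Suc)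
  show "\<tau> (Suc k) \<notin> grid k" if "k < n"
  proof -
    have "\<tau> i < \<tau> (Suc k)" if "i \<le> k" for i using \<tau>_less[of i "Suc k"] that \<open>k < n\<close> by simp
    thus ?thesis by force
  qed
  show "grid k = insert (\<tau> k) (\<tau> ` {..<k})"
    unfolding lessThan_Suc_atMost[symmetric] lessThan_Suc by simp
  show "k \<le> n \<Longrightarrow> \<tau> ` {..<k} \<subseteq> {0..<\<tau> k}" using \<tau>_nonneg \<tau>_less[of _ k] by force
qed

lemma factor_Suc: "factor (Suc k) x = factor k x * g (\<tau> k) (x (\<tau> k))"
  by (simp add: factor_def)

lemma factor_update: "k < n \<Longrightarrow> factor (Suc k) (x(\<tau> (Suc k) := y)) = factor (Suc k) x"
  unfolding factor_def using \<tau>_less[of _ "Suc k"] by (intro prod.cong) force+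

lemma partial_value_Suc:
  "k < n \<Longrightarrow> partial_value (Suc k) (x(\<tau> (Suc k) := y)) =
    factor (Suc k) x * (if 0 \<le> factor (Suc k) x then gp (\<tau> (Suc k)) y else gm (\<tau> (Suc k)) y)"
  by (simp add: partial_value_def factor_update)

text \<open>The sign of \<open>factor (Suc k) x\<close> combines the signs of
  \<open>factor k x\<close> and of \<open>g\<close> at \<open>\<tau> k\<close>; these four
  combinations are exactly the branches of the two recursions.\<close>

lemma partial_value_step:
  assumes "k < n"
  shows "partial_value k x = factor (Suc k) x *
     (if 0 \<le> factor (Suc k) x then lower_trans (\<tau> (Suc k) - \<tau> k) (gp (\<tau> (Suc k))) (x (\<tau> k))
      else - lower_trans (\<tau> (Suc k) - \<tau> k) (\<lambda>y. - gm (\<tau> (Suc k)) y) (x (\<tau> k)))"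
proof -
  show ?thesis
    unfolding partial_value_def factor_Suc rec_gp[OF assms] rec_gm[OF assms]
      cond_upper_expect_def cond_lower_expect_eq
    by (auto simp: zero_le_mult_iff not_le mult_less_0_iff)
qed

lemma partial_value_0: "partial_value 0 x = gp (\<tau> 0) (x (\<tau> 0))"
  by (simp add: partial_value_def factor_def)

lemma partial_value_n: "partial_value n x = (\<Prod>t\<in>grid n. g t (x t))"
proof -
  have "partial_value n x = factor (Suc n) x"
    by (simp add: partial_value_def last factor_Suc)
  also have "\<dots> = (\<Prod>i\<le>n. g (\<tau> i) (x (\<tau> i)))" by (simp add: factor_def lessThan_Suc_atMost)
  also have "\<dots> = (\<Prod>t\<in>grid n. g t (x t))"
    using strict_mono_on_imp_inj_on[OF mono] by (simp add: prod.reindex)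
  finally show ?thesis .
qed

text \<open>The expected partial value is nondecreasing in \<open>k\<close>:
  \<open>cond_expect_ge\<close> holds for every history, and for a negative factor it is applied to
  \<open>- gm\<close>. The endpoints are the two expectations compared.\<close>

lemma expect_product_ge:
  assumes "ictmc_process \<Q> c R P"
  shows "expect R {\<tau> 0} (\<lambda>x. gp (\<tau> 0) (x (\<tau> 0))) \<le> expect R (grid n) (\<lambda>x. \<Prod>t\<in>grid n. g t (x t))"
proof -
  interpret ictmc_process \<Q> c R P by fact
  have "expect R (grid 0) (partial_value 0) \<le> expect R (grid k) (partial_value k)" if "k \<le> n" for k
    using that
  proof (induction k)
    case (Suc k)
    hence k: "k < n" "k \<le> n" by auto
    let ?d = "\<tau> (Suc k) - \<tau> k"
    have "expect R (grid k) (partial_value k) \<le> expect R (grid (Suc k)) (partial_value (Suc k))"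
      unfolding grid(3)
    proof (rule expect_insert_ge[OF grid(1) grid(2)[OF k(2)] grid(4)[OF k(1)]])
      fix x
      have ge: "lower_trans ?d f (x (\<tau> k)) \<le> (\<Sum>y\<in>UNIV. R (state_at (\<tau> (Suc k)) y, cyl (grid k) x) * f y)" for f
        unfolding grid(5)[of k] using k \<tau>_nonneg[of k] grid(6)[of k] \<tau>_less[of k "Suc k"]
        by (intro cond_expect_ge) auto
      have "partial_value k x \<le> factor (Suc k) x * (\<Sum>y\<in>UNIV. R (state_at (\<tau> (Suc k)) y, cyl (grid k) x) *
          (if 0 \<le> factor (Suc k) x then gp (\<tau> (Suc k)) y else gm (\<tau> (Suc k)) y))"
      proof (cases "0 \<le> factor (Suc k) x")
        case True
        thus ?thesis using ge[of "gp (\<tau> (Suc k))"] by (simp add: partial_value_step[OF k(1)] mult_left_mono)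
      next
        case False
        have "(\<Sum>y\<in>UNIV. R (state_at (\<tau> (Suc k)) y, cyl (grid k) x) * gm (\<tau> (Suc k)) y) \<le>
            - lower_trans ?d (\<lambda>y. - gm (\<tau> (Suc k)) y) (x (\<tau> k))"
          using ge[of "\<lambda>y. - gm (\<tau> (Suc k)) y"] by (simp add: sum_negf)
        from mult_left_mono_neg[OF this, of "factor (Suc k) x"] False show ?thesis
          by (simp add: partial_value_step[OF k(1)])
      qed
      thus "partial_value k x \<le> (\<Sum>y\<in>UNIV. R (state_at (\<tau> (Suc k)) y, cyl (grid k) x) * partial_value (Suc k) (x(\<tau> (Suc k) := y)))"
        by (simp add: partial_value_Suc[OF k(1)] sum_distrib_left mult.left_commute)
    qed
    with Suc show ?case by simp
  qed simp
  from this[of n] show ?thesis by (simp add: partial_value_0[abs_def] partial_value_n[abs_def])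
qed

text \<open>Only the factor with index \<open>j\<close> can be negative, so a nonzero product after
  it has the sign prescribed by the state at \<open>\<tau> j\<close>. This is why that state is all
  a policy has to remember.\<close>

lemma factor_sign:
  assumes "k < n"
  shows "k < j \<Longrightarrow> 0 \<le> factor (Suc k) x"
    and "j \<le> k \<Longrightarrow> 0 < factor (Suc k) x \<Longrightarrow> 0 \<le> g (\<tau> j) (x (\<tau> j))"
    and "j \<le> k \<Longrightarrow> factor (Suc k) x < 0 \<Longrightarrow> g (\<tau> j) (x (\<tau> j)) < 0"
proof -
  show "k < j \<Longrightarrow> 0 \<le> factor (Suc k) x"
    unfolding factor_def using assms by (intro prod_nonneg g_nonneg) auto
  have "0 \<le> (\<Prod>i\<in>{..<Suc k} - {j}. g (\<tau> i) (x (\<tau> i)))"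
    using assms by (intro prod_nonneg g_nonneg) auto
  moreover have "factor (Suc k) x = g (\<tau> j) (x (\<tau> j)) * (\<Prod>i\<in>{..<Suc k} - {j}. g (\<tau> i) (x (\<tau> i)))" if "j \<le> k"
    unfolding factor_def using that by (intro prod.remove) auto
  ultimately show "j \<le> k \<Longrightarrow> 0 < factor (Suc k) x \<Longrightarrow> 0 \<le> g (\<tau> j) (x (\<tau> j))"
    and "j \<le> k \<Longrightarrow> factor (Suc k) x < 0 \<Longrightarrow> g (\<tau> j) (x (\<tau> j)) < 0"
    by (auto simp: zero_less_mult_iff mult_less_0_iff)
qed

lemma factor_bounded: "\<exists>M. 0 < M \<and> (\<forall>k<n. \<forall>x. \<bar>factor (Suc k) x\<bar> \<le> M)"
proof -
  define b where "b = 1 + (\<Sum>i\<le>n. \<Sum>z\<in>UNIV. \<bar>g (\<tau> i) z\<bar>)"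
  have b: "1 \<le> b" unfolding b_def by (simp add: sum_nonneg)
  have g: "\<bar>g (\<tau> i) z\<bar> \<le> b" if "i \<le> n" for i z
  proof -
    have "\<bar>g (\<tau> i) z\<bar> \<le> (\<Sum>z\<in>UNIV. \<bar>g (\<tau> i) z\<bar>)" by (intro member_le_sum) auto
    also have "\<dots> \<le> (\<Sum>i\<le>n. \<Sum>z\<in>UNIV. \<bar>g (\<tau> i) z\<bar>)"
      using that by (intro member_le_sum[of i]) (auto intro: sum_nonneg)
    finally show ?thesis by (simp add: b_def)
  qed
  have "\<bar>factor (Suc k) x\<bar> \<le> b ^ n" if "k < n" for k x
  proof -
    have "\<bar>factor (Suc k) x\<bar> \<le> (\<Prod>i<Suc k. b)"
      unfolding factor_def abs_prod using that g by (intro prod_mono) auto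
    also have "\<dots> \<le> b ^ n" using that b by (simp add: power_increasing del: power_Suc)
    finally show ?thesis .
  qed
  moreover have "0 < b ^ n" using b by simp
  ultimately show ?thesis by blast
qed

text \<open>The history-dependent policy: before time \<open>\<tau> j\<close> and for a nonnegative factor at \<open>\<tau> j\<close> minimise
  \<open>gp\<close>; for a negative factor maximise \<open>gm\<close> afterwards.\<close>

lemma near_optimal_process:
  assumes \<epsilon>: "0 < \<epsilon>" and p: "p \<in> \<M>"
  obtains P R where "P \<in> ICTMC \<Q> \<M>" "\<And>z. z \<in> process_domain \<Longrightarrow> R z = P z"
    "expect R (grid n) (\<lambda>x. \<Prod>t\<in>grid n. g t (x t)) \<le> (\<Sum>w\<in>UNIV. pmf p w * lower_trans (\<tau> 0) (gp (\<tau> 0)) w) + \<epsilon>"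
proof -
  let ?s = "\<tau> j"
  obtain M where M: "0 < M" "\<And>k x. k < n \<Longrightarrow> \<bar>factor (Suc k) x\<bar> \<le> M" using factor_bounded by blast
  \<comment> \<open>The budget is one \<eta> for the way from time 0 to \<open>\<tau> 0\<close> and
    \<open>M * \<eta>\<close> for each of the \<open>n\<close> grid intervals, where an error is
    multiplied by a factor of size at most \<open>M\<close>.\<close>
  define \<eta> where "\<eta> = \<epsilon> / (n * M + 1)"
  have nM: "0 \<le> n * M" using M by simp
  have \<eta>0: "0 < \<eta>" using \<epsilon> nM by (simp add: \<eta>_def divide_pos_pos)
  have "\<eta> * (n * M + 1) = \<epsilon>" using nM by (simp add: \<eta>_def)
  hence "\<eta> + n * (M * \<eta>) = \<epsilon>" by (simp add: algebra_simps)
  note \<eta> = \<eta>0 this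
  \<comment> \<open>Time 0 is put in front of the grid, so that interval \<open>i\<close> of
    \<sigma> ends at \<open>\<tau> i\<close>; the first interval may have length zero.\<close>
  define \<sigma> where "\<sigma> i = (case i of 0 \<Rightarrow> 0 | Suc i \<Rightarrow> \<tau> i)" for i
  have \<sigma>: "0 \<le> \<sigma> 0" "\<And>i. i < Suc n \<Longrightarrow> \<sigma> i \<le> \<sigma> (Suc i)"
    using start \<tau>_le by (auto simp: \<sigma>_def split: nat.split)
  have opt: "\<exists>T. transition_family T \<and> (\<forall>i<Suc n. \<forall>x.
      kact (T (\<sigma> i) (\<sigma> (Suc i))) (F i) x \<le> lower_trans (\<sigma> (Suc i) - \<sigma> i) (F i) x + \<eta>)" for F
    by (rule near_optimal_grid[OF \<eta>(1) \<sigma>])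
  obtain T0 where T0: "transition_family T0"
    "\<And>i x. i < Suc n \<Longrightarrow> kact (T0 (\<sigma> i) (\<sigma> (Suc i))) (gp (\<tau> i)) x \<le> lower_trans (\<sigma> (Suc i) - \<sigma> i) (gp (\<tau> i)) x + \<eta>"
    using opt[of "\<lambda>i. gp (\<tau> i)"]
    by (elim exE conjE) (erule that, simp)
  obtain T1 where T1: "transition_family T1"
    "\<And>i x. i < Suc n \<Longrightarrow> kact (T1 (\<sigma> i) (\<sigma> (Suc i))) (\<lambda>y. - gm (\<tau> i) y) x \<le> lower_trans (\<sigma> (Suc i) - \<sigma> i) (\<lambda>y. - gm (\<tau> i) y) x + \<eta>"
    using opt[of "\<lambda>i y. - gm (\<tau> i) y"]
    by (elim exE conjE) (erule that, simp)
  define T where "T z = (if 0 \<le> g ?s z then T0 else concat_at ?s T0 T1)" for z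
  have s: "0 \<le> ?s" using \<tau>_nonneg j by simp
  have T: "transition_family (T z)" for z
    using T0(1) T1(1) s by (simp add: T_def transition_family_concat_at)
  have T_before: "T z t r = T0 t r" if "r \<le> ?s" for z t r
    using that by (simp add: T_def concat_at_def)
  obtain P R where P: "P \<in> ICTMC \<Q> \<M>" and R: "full_cond_prob R paths" and agree: "\<And>z. z \<in> process_domain \<Longrightarrow> R z = P z"
    and init: "\<And>y. R (state_at 0 y, paths) = pmf p y"
    and trans: "\<And>t u x r y. 0 \<le> t \<Longrightarrow> finite u \<Longrightarrow> u \<subseteq> {0..<t} \<Longrightarrow> t < r \<Longrightarrow> r \<le> ?s \<or> ?s \<in> insert t u \<Longrightarrow>
      R (state_at r y, cyl (insert t u) x) = T (x ?s) t r (x t) y"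
  proof (rule ictmc_with_transitions[OF conv T _ s p])
    show "T z t r = T z' t r" if "r \<le> ?s" for z z' t r using T_before[OF that] by simp
  qed (erule (1) that; simp)
  interpret path_cond_prob R using R by unfold_locales
  have first: "expect R (grid 0) (partial_value 0) \<le> (\<Sum>w\<in>UNIV. pmf p w * lower_trans (\<tau> 0) (gp (\<tau> 0)) w) + \<eta>"
  proof -
    have eq: "expect R (grid 0) (partial_value 0) = (\<Sum>y\<in>UNIV. R (state_at (\<tau> 0) y, paths) * gp (\<tau> 0) y)"
      using expect_singleton[OF start, of "gp (\<tau> 0)"] by (simp add: partial_value_0[abs_def])
    show ?thesis
    proof (cases "\<tau> 0 = 0")
      case True
      thus ?thesis unfolding eq using \<eta>(1) by (simp add: init)
    next
      case False
      hence pos: "0 < \<tau> 0" using start by simp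
      have "R (state_at (\<tau> 0) y, cyl {0} (\<lambda>_. w)) = T0 0 (\<tau> 0) w y" for y w
        using trans[of 0 "{}" "\<tau> 0" y "\<lambda>_. w"] pos \<tau>_le[of 0 j] j T_before[of "\<tau> 0" w 0] by simp
      hence "(\<Sum>y\<in>UNIV. R (state_at (\<tau> 0) y, paths) * gp (\<tau> 0) y) =
          (\<Sum>w\<in>UNIV. pmf p w * kact (T0 0 (\<tau> 0)) (gp (\<tau> 0)) w)"
        by (subst initial_mixture[OF start]) (simp add: init kact_def)
      also have "\<dots> \<le> (\<Sum>w\<in>UNIV. pmf p w * (lower_trans (\<tau> 0) (gp (\<tau> 0)) w + \<eta>))"
        using T0(2)[of 0] by (intro sum_mono mult_left_mono) (auto simp: \<sigma>_def)
      also have "\<dots> = (\<Sum>w\<in>UNIV. pmf p w * lower_trans (\<tau> 0) (gp (\<tau> 0)) w) + \<eta>"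
        by (simp add: distrib_left sum.distrib sum_distrib_right[symmetric] sum_pmf_eq_1)
      finally show ?thesis unfolding eq .
    qed
  qed
  have "expect R (grid k) (partial_value k) \<le> expect R (grid 0) (partial_value 0) + k * (M * \<eta>)" if "k \<le> n" for k
    using that
  proof (induction k)
    case (Suc k)
    hence k: "k < n" "k \<le> n" by auto
    let ?d = "\<tau> (Suc k) - \<tau> k"
    have "expect R (grid (Suc k)) (partial_value (Suc k)) \<le> expect R (grid k) (partial_value k) + M * \<eta>"
      unfolding grid(3)
    proof (rule expect_insert_le[OF grid(1) grid(2)[OF k(2)] grid(4)[OF k(1)]])
      fix x
      let ?D = "factor (Suc k) x"
      let ?T = "T (x ?s) (\<tau> k) (\<tau> (Suc k))"
      have tr: "R (state_at (\<tau> (Suc k)) y, cyl (grid k) x) = ?T (x (\<tau> k)) y" for y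
        unfolding grid(5)[of k]
      proof (rule trans)
        show "\<tau> (Suc k) \<le> ?s \<or> ?s \<in> insert (\<tau> k) (\<tau> ` {..<k})"
        proof (cases "j \<le> k")
          case True
          thus ?thesis using grid(5)[of k] by blast
        next
          case False
          thus ?thesis using \<tau>_le[of "Suc k" j] j by simp
        qed
      qed (use k \<tau>_nonneg[of k] grid(6)[of k] \<tau>_less[of k "Suc k"] in auto)
      have "?D * kact ?T (if 0 \<le> ?D then gp (\<tau> (Suc k)) else gm (\<tau> (Suc k))) (x (\<tau> k)) \<le> partial_value k x + \<bar>?D\<bar> * \<eta>"
      \<comment> \<open>A vanishing factor is separated because the sign at \<open>s\<close> may
        then select either branch; both sides of the claim are zero.\<close>
      proof (cases "?D" "0 :: real" rule: linorder_cases)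
        case less
        hence jk: "j \<le> k" using factor_sign(1)[OF k(1), of x] by force
        have "?T = T1 (\<tau> k) (\<tau> (Suc k))"
          using factor_sign(3)[OF k(1) jk less] concat_at_simps(2)[OF T0(1) T1(1) s, of "\<tau> k" "\<tau> (Suc k)"]
            \<tau>_le[OF jk k(2)] \<tau>_less[of k "Suc k"] k \<tau>_nonneg[of k] by (simp add: T_def)
        hence "- kact ?T (gm (\<tau> (Suc k))) (x (\<tau> k)) \<le> lower_trans ?d (\<lambda>y. - gm (\<tau> (Suc k)) y) (x (\<tau> k)) + \<eta>"
          using T1(2)[of "Suc k" "x (\<tau> k)"] k by (simp add: \<sigma>_def kact_uminus)
        hence "- ?D * - kact ?T (gm (\<tau> (Suc k))) (x (\<tau> k)) \<le> - ?D * (lower_trans ?d (\<lambda>y. - gm (\<tau> (Suc k)) y) (x (\<tau> k)) + \<eta>)"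
          using less by (intro mult_left_mono) auto
        thus ?thesis using less by (simp add: partial_value_step[OF k(1)] algebra_simps)
      next
        case equal
        thus ?thesis by (simp add: partial_value_step[OF k(1)])
      next
        case greater
        have "?T = T0 (\<tau> k) (\<tau> (Suc k))"
        proof (cases "j \<le> k")
          case True
          thus ?thesis using factor_sign(2)[OF k(1) True greater] by (simp add: T_def)
        next
          case False
          thus ?thesis using \<tau>_le[of "Suc k" j] j by (intro T_before) auto
        qed
        hence "kact ?T (gp (\<tau> (Suc k))) (x (\<tau> k)) \<le> lower_trans ?d (gp (\<tau> (Suc k))) (x (\<tau> k)) + \<eta>"
          using T0(2)[of "Suc k" "x (\<tau> k)"] k by (simp add: \<sigma>_def)
        hence "?D * kact ?T (gp (\<tau> (Suc k))) (x (\<tau> k)) \<le> ?D * (lower_trans ?d (gp (\<tau> (Suc k))) (x (\<tau> k)) + \<eta>)"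
          using greater by (intro mult_left_mono) auto
        thus ?thesis using greater by (simp add: partial_value_step[OF k(1)] algebra_simps)
      qed
      also have "\<bar>?D\<bar> * \<eta> \<le> M * \<eta>" using M(2)[OF k(1)] \<eta>(1) by (intro mult_right_mono) auto
      finally have "?D * kact ?T (if 0 \<le> ?D then gp (\<tau> (Suc k)) else gm (\<tau> (Suc k))) (x (\<tau> k)) \<le> partial_value k x + M * \<eta>"
        by simp
      thus "(\<Sum>y\<in>UNIV. R (state_at (\<tau> (Suc k)) y, cyl (grid k) x) * partial_value (Suc k) (x(\<tau> (Suc k) := y)))
          \<le> partial_value k x + M * \<eta>"
        by (simp add: partial_value_Suc[OF k(1)] tr kact_def sum_distrib_left mult.left_commute split: if_splits)
    qed
    with Suc show ?case by (simp add: distrib_right)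
  qed simp
  from this[of n] first \<eta>(2) have "expect R (grid n) (partial_value n) \<le> (\<Sum>w\<in>UNIV. pmf p w * lower_trans (\<tau> 0) (gp (\<tau> 0)) w) + \<epsilon>"
    by simp
  with that[OF P agree] show thesis by (simp add: partial_value_n[abs_def])
qed

lemma ICTMC_extension:
  assumes "P \<in> ICTMC \<Q> \<M>"
  obtains R p where "ictmc_process \<Q> c R P" "p \<in> \<M>" "\<And>x. R (state_at 0 x, paths) = pmf p x"
proof -
  obtain R where R: "full_cond_prob R paths" "\<forall>z\<in>process_domain. R z = P z"
    using assms unfolding ICTMC_def stochastic_process_def by blast
  have "ictmc_process \<Q> c R P"
    using assms R by unfold_locales (auto simp: ICTMC_def)
  moreover obtain p where "p \<in> \<M>" "\<And>x. P (state_at 0 x, paths) = pmf p x"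
    using assms unfolding ICTMC_def by blast
  moreover have "R (state_at 0 x, paths) = P (state_at 0 x, paths)" for x
    using R(2) state_at_process_domain[of "{}" 0 x "\<lambda>_. x"] by (simp add: cyl_empty)
  ultimately show thesis using that by simp
qed

text \<open>Both expectations are compared with the average of
  \<open>lower_trans (\<tau> 0) (gp (\<tau> 0))\<close> under the initial mass function
  \<open>p\<close> of \<open>P\<close>: it bounds the expectation of \<open>gp\<close> under
  \<open>P\<close> from below, and a process with the same \<open>p\<close> brings the product
  within \<epsilon> of it.\<close>

theorem lower_expect_product:
  "lower_expect \<Q> \<M> (grid n) (\<lambda>x. \<Prod>t\<in>grid n. g t (x t)) = lower_expect \<Q> \<M> {\<tau> 0} (\<lambda>x. gp (\<tau> 0) (x (\<tau> 0)))"
proof -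
  obtain B where B: "\<And>y. \<bar>gp (\<tau> 0) y\<bar> \<le> B" using bounded_function by blast
  show ?thesis unfolding lower_expect_def
  proof (rule INF_eq_of_approx[where k = "- B"])
    fix P assume P: "P \<in> ICTMC \<Q> \<M>"
    then obtain R p where R: "ictmc_process \<Q> c R P" and p: "p \<in> \<M>" "\<And>x. R (state_at 0 x, paths) = pmf p x"
      by (rule ICTMC_extension) (erule (1) that, simp)
    interpret ictmc_process \<Q> c R P by (rule R)
    have eq: "expect P {\<tau> 0} h = expect R {\<tau> 0} h" "expect P (grid n) h = expect R (grid n) h" for h
      using grid(1,2) start by (auto intro!: expect_agree agree)
    show "expect P {\<tau> 0} (\<lambda>x. gp (\<tau> 0) (x (\<tau> 0))) \<le> expect P (grid n) (\<lambda>x. \<Prod>t\<in>grid n. g t (x t))"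
      unfolding eq using expect_product_ge[OF R] .
    have "paths \<noteq> ({} :: (real \<Rightarrow> 'x) set)" using cyl_nonempty[of "{}" undefined] by (auto simp: cyl_empty)
    hence q: "0 \<le> R (state_at t y, paths)" "(\<Sum>y\<in>UNIV. R (state_at t y, paths)) = 1" for t y
      by (auto intro!: cp_nonneg cp_state_sum_1)
    have "(\<Sum>y\<in>UNIV. R (state_at (\<tau> 0) y, paths) * - B) \<le> (\<Sum>y\<in>UNIV. R (state_at (\<tau> 0) y, paths) * gp (\<tau> 0) y)"
      using B q by (intro sum_mono mult_left_mono) (auto simp: abs_le_iff minus_le_iff)
    thus "- B \<le> expect P {\<tau> 0} (\<lambda>x. gp (\<tau> 0) (x (\<tau> 0)))"
      unfolding eq expect_singleton[OF start] using q(2)[of "\<tau> 0"] by (simp add: sum_distrib_right[symmetric] sum_negf)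
    fix \<epsilon> :: real assume "0 < \<epsilon>"
    then obtain P' R' where P': "P' \<in> ICTMC \<Q> \<M>" "\<And>z. z \<in> process_domain \<Longrightarrow> R' z = P' z"
      "expect R' (grid n) (\<lambda>x. \<Prod>t\<in>grid n. g t (x t)) \<le> (\<Sum>w\<in>UNIV. pmf p w * lower_trans (\<tau> 0) (gp (\<tau> 0)) w) + \<epsilon>"
      using p(1) by (rule near_optimal_process) (erule that, simp_all)
    have "(\<Sum>w\<in>UNIV. pmf p w * lower_trans (\<tau> 0) (gp (\<tau> 0)) w) \<le> expect R {\<tau> 0} (\<lambda>x. gp (\<tau> 0) (x (\<tau> 0)))"
      unfolding expect_singleton[OF start] initial_mixture[OF start] p(2)
    proof (intro sum_mono mult_left_mono)
      fix w
      show "lower_trans (\<tau> 0) (gp (\<tau> 0)) w \<le> (\<Sum>y\<in>UNIV. R (state_at (\<tau> 0) y, cyl {0} (\<lambda>_. w)) * gp (\<tau> 0) y)"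
        using cond_expect_ge[of 0 "{}" "\<tau> 0" "gp (\<tau> 0)" "\<lambda>_. w"] start by simp
    qed simp
    moreover have "expect P' (grid n) h = expect R' (grid n) h" for h
      using grid(1,2) by (intro expect_agree P'(2)) auto
    ultimately show "\<exists>P'\<in>ICTMC \<Q> \<M>. expect P' (grid n) (\<lambda>x. \<Prod>t\<in>grid n. g t (x t)) \<le>
        expect P {\<tau> 0} (\<lambda>x. gp (\<tau> 0) (x (\<tau> 0))) + \<epsilon>"
      using P'(1,3) by (intro bexI[of _ P']) (simp_all add: eq)
  qed
qed

end

theorem proposition11:
  fixes \<M> :: "'x::finite pmf set"
    and \<Q> :: "(real^'x^'x) set"
    and u :: "real set"
    and h g gp gm :: "real \<Rightarrow> 'x \<Rightarrow> real"
    and f :: "'x \<Rightarrow> real"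
    and s \<mu> :: real
    and \<tau> :: "nat \<Rightarrow> real"
    and n :: nat
  assumes "\<M> \<noteq> {}"
    and "\<Q> \<noteq> {}" "\<forall>Q\<in>\<Q>. rate_matrix Q" "bounded_rates \<Q>" "convex \<Q>"
      "separately_specified_rows \<Q>"
    and "finite u" "u \<noteq> {}" "u \<subseteq> {0..}"
    and "\<forall>t\<in>u. \<forall>x. 0 \<le> h t x"
    and "0 \<le> s"
    and g_at_s: "\<forall>x. g s x = (if s \<in> u then (f x - \<mu>) * h s x else f x - \<mu>)"
    and g_else: "\<forall>t \<in> u - {s}. g t = h t"
    and times: "strict_mono_on {..n} \<tau>" "insert s u = \<tau> ` {..n}"
    and last: "gp (\<tau> n) = g (\<tau> n)" "gm (\<tau> n) = g (\<tau> n)"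
    and rec_gp: "\<forall>i<n. \<forall>x. gp (\<tau> i) x =
      (if 0 \<le> g (\<tau> i) x
       then g (\<tau> i) x * cond_lower_expect \<Q> (\<tau> i) (\<tau> (Suc i)) (gp (\<tau> (Suc i))) x
       else g (\<tau> i) x * cond_upper_expect \<Q> (\<tau> i) (\<tau> (Suc i)) (gm (\<tau> (Suc i))) x)"
    and rec_gm: "\<forall>i<n. \<forall>x. gm (\<tau> i) x =
      (if 0 \<le> g (\<tau> i) x
       then g (\<tau> i) x * cond_upper_expect \<Q> (\<tau> i) (\<tau> (Suc i)) (gm (\<tau> (Suc i))) x
       else g (\<tau> i) x * cond_lower_expect \<Q> (\<tau> i) (\<tau> (Suc i)) (gp (\<tau> (Suc i))) x)"
  shows "lower_expect \<Q> \<M> (insert s u) (\<lambda>x. \<Prod>t \<in> insert s u. g t (x t)) =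
           lower_expect \<Q> \<M> {\<tau> 0} (\<lambda>x. gp (\<tau> 0) (x (\<tau> 0)))
       \<and> upper_expect \<Q> \<M> (insert s u) (\<lambda>x. \<Prod>t \<in> insert s u. g t (x t)) =
           upper_expect \<Q> \<M> {\<tau> 0} (\<lambda>x. gm (\<tau> 0) (x (\<tau> 0)))"
proof -
  obtain c where "\<And>Q x. Q \<in> \<Q> \<Longrightarrow> \<bar>Q $ x $ x\<bar> \<le> c"
    using \<open>bounded_rates \<Q>\<close> unfolding bounded_rates_def by (meson less_imp_le)
  then interpret separate_rates \<Q> c
    using assms by unfold_locales auto
  obtain j where j: "j \<le> n" "s = \<tau> j" using times(2) by blast
  have inj: "\<tau> i = \<tau> k \<longleftrightarrow> i = k" if "i \<le> n" "k \<le> n" for i k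
    using strict_mono_on_imp_inj_on[OF times(1)] that by (auto simp: inj_on_def)
  have le: "\<tau> i \<le> \<tau> k \<longleftrightarrow> i \<le> k" if "i \<le> n" "k \<le> n" for i k
    using strict_mono_on_less_eq[OF times(1)] that by simp
  have nonneg: "0 \<le> g (\<tau> i) x" if "i \<le> n" "i \<noteq> j" for i x
  proof -
    have "\<tau> i \<in> insert s u" "\<tau> i \<noteq> s" using that times(2) j inj by auto
    hence "\<tau> i \<in> u - {s}" by blast
    thus ?thesis using g_else \<open>\<forall>t\<in>u. \<forall>x. 0 \<le> h t x\<close> by auto
  qed
  have start: "0 \<le> \<tau> 0"
  proof -
    have "\<tau> 0 \<in> insert s u" using times(2) by auto
    thus ?thesis using \<open>u \<subseteq> {0..}\<close> \<open>0 \<le> s\<close> by auto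
  qed
  interpret lower: backward_recursion \<Q> c g gp gm \<tau> n j
    using assms(5) times(1) start j(1) nonneg last rec_gp rec_gm by unfold_locales auto
  text \<open>Changing the sign of \<open>g\<close> at \<open>s\<close> alone negates the product and, at times up to \<open>s\<close>, exchanges
    \<open>gp\<close> with \<open>- gm\<close>.\<close>
  define g' where "g' t x = (if t = s then - g t x else g t x)" for t x
  define gp' where "gp' t x = (if t \<le> s then - gm t x else gp t x)" for t x
  define gm' where "gm' t x = (if t \<le> s then - gp t x else gm t x)" for t x
  interpret upper: backward_recursion \<Q> c g' gp' gm' \<tau> n j
  proof unfold_locales
    show "0 \<le> g' (\<tau> i) x" if "i \<le> n" "i \<noteq> j" for i x
      using nonneg[OF that] inj[OF that(1) j(1)] that(2) j(2) by (simp add: g'_def)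
    show "gp' (\<tau> n) = g' (\<tau> n)" "gm' (\<tau> n) = g' (\<tau> n)"
      using last le[of n j] j by (auto simp: gp'_def gm'_def g'_def fun_eq_iff)
    fix i x assume i: "i < n"
    have Suc_le: "\<tau> (Suc i) \<le> s \<longleftrightarrow> i < j" using le[of "Suc i" j] i j by auto
    have le_s: "\<tau> i \<le> s \<longleftrightarrow> i \<le> j" using le[of i j] i j by simp
    have eq_s: "\<tau> i = s \<longleftrightarrow> i = j" using inj[of i j] i j by simp
    consider "i < j" | "i = j" | "j < i" by linarith
    hence "gp' (\<tau> i) x = (if 0 \<le> g' (\<tau> i) x
         then g' (\<tau> i) x * cond_lower_expect \<Q> (\<tau> i) (\<tau> (Suc i)) (gp' (\<tau> (Suc i))) x
         else g' (\<tau> i) x * cond_upper_expect \<Q> (\<tau> i) (\<tau> (Suc i)) (gm' (\<tau> (Suc i))) x) \<and>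
       gm' (\<tau> i) x = (if 0 \<le> g' (\<tau> i) x
         then g' (\<tau> i) x * cond_upper_expect \<Q> (\<tau> i) (\<tau> (Suc i)) (gm' (\<tau> (Suc i))) x
         else g' (\<tau> i) x * cond_lower_expect \<Q> (\<tau> i) (\<tau> (Suc i)) (gp' (\<tau> (Suc i))) x)"
    proof cases
      case 1
      hence "gp' (\<tau> (Suc i)) = (\<lambda>y. - gm (\<tau> (Suc i)) y)" "gm' (\<tau> (Suc i)) = (\<lambda>y. - gp (\<tau> (Suc i)) y)"
        "gp' (\<tau> i) x = - gm (\<tau> i) x" "gm' (\<tau> i) x = - gp (\<tau> i) x" "g' (\<tau> i) x = g (\<tau> i) x"
        using Suc_le le_s eq_s by (simp_all add: gp'_def gm'_def g'_def fun_eq_iff)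
      thus ?thesis using rec_gp rec_gm i nonneg[of i x] 1 by (simp add: cond_upper_expect_def)
    next
      \<comment> \<open>The changed sign of \<open>g\<close> exchanges the two branches of the
        recursion; if \<open>g\<close> vanishes, both branches are zero, so the boundary case also
        agrees.\<close>
      case 2
      hence "gp' (\<tau> (Suc i)) = gp (\<tau> (Suc i))" "gm' (\<tau> (Suc i)) = gm (\<tau> (Suc i))"
        "gp' (\<tau> i) x = - gm (\<tau> i) x" "gm' (\<tau> i) x = - gp (\<tau> i) x" "g' (\<tau> i) x = - g (\<tau> i) x"
        using Suc_le le_s eq_s by (simp_all add: gp'_def gm'_def g'_def fun_eq_iff)
      thus ?thesis using rec_gp rec_gm i by auto
    next
      case 3
      hence "gp' (\<tau> (Suc i)) = gp (\<tau> (Suc i))" "gm' (\<tau> (Suc i)) = gm (\<tau> (Suc i))"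
        "gp' (\<tau> i) x = gp (\<tau> i) x" "gm' (\<tau> i) x = gm (\<tau> i) x" "g' (\<tau> i) x = g (\<tau> i) x"
        using Suc_le le_s eq_s by (simp_all add: gp'_def gm'_def g'_def fun_eq_iff)
      thus ?thesis using rec_gp rec_gm i by simp
    qed
    thus "gp' (\<tau> i) x = (if 0 \<le> g' (\<tau> i) x
         then g' (\<tau> i) x * cond_lower_expect \<Q> (\<tau> i) (\<tau> (Suc i)) (gp' (\<tau> (Suc i))) x
         else g' (\<tau> i) x * cond_upper_expect \<Q> (\<tau> i) (\<tau> (Suc i)) (gm' (\<tau> (Suc i))) x)"
      and "gm' (\<tau> i) x = (if 0 \<le> g' (\<tau> i) x
         then g' (\<tau> i) x * cond_upper_expect \<Q> (\<tau> i) (\<tau> (Suc i)) (gm' (\<tau> (Suc i))) x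
         else g' (\<tau> i) x * cond_lower_expect \<Q> (\<tau> i) (\<tau> (Suc i)) (gp' (\<tau> (Suc i))) x)"
      by blast+
  qed (use assms(5) times(1) start j(1) in auto)
  have prod: "(\<Prod>t \<in> insert s u. g' t (x t)) = - (\<Prod>t \<in> insert s u. g t (x t))" for x
  proof -
    have "(\<Prod>t\<in>u - {s}. g' t (x t)) = (\<Prod>t\<in>u - {s}. g t (x t))"
      by (intro prod.cong) (auto simp: g'_def)
    thus ?thesis using \<open>finite u\<close> by (simp add: prod.insert_remove g'_def)
  qed
  have "\<tau> 0 \<le> s" using le[of 0 j] j by simp
  hence "gp' (\<tau> 0) = (\<lambda>y. - gm (\<tau> 0) y)" by (simp add: gp'_def fun_eq_iff)
  thus ?thesis
    using lower.lower_expect_product upper.lower_expect_product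
    by (simp add: upper_expect_def times(2)[symmetric] prod)
qed

end
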